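(* There are $\Sigma^0_4$ formulas $\psi_U,\psi_N$ such that for all $f,g\in\omega^\omega$: $$ \bigl(f\ge_{NC} g\iff\psi_N(f,g)\bigr)\ \wedge\ \bigl(f\ge_{UC} g\iff\psi_U(f,g)\bigr).$$
   Context: A set $S\subseteq\omega$ has density $0$ iff $\lim_{l\to\infty}|S\cap\{0,\dots,l-1\}|/l=0$. For total $f,f':\omega\to\omega$, $f'$ is a coarse description of $f$ if $\{x: f(x)\ne f'(x)\}$ has density $0$. $f\ge_{NC} g$ (non-uniform coarse reducibility) means every coarse description of $f$ (Turing) computes a coarse description of $g$. $f\ge_{UC} g$ (uniform coarse reducibility) means a single computable functional maps every coarse description of $f$ to a coarse description of $g$. $\Sigma^0_4$ formulas are arithmetical formulas with two free function variables. *)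

theory Defs
  imports Complex_Main
begin

text \<open>
  Terms for the partial recursive functions relative to a total function. A term is not tied to an
  arity; \<open>runs\<close> has no rule for an argument list of an unsuitable length, so such
  an application is simply undefined.
\<close>

datatype prog =
    Zero
  | Succ
  | Proj nat
  | Query
  | Comp prog "prog list"
  | PrimRec prog prog
  | Minimize prog

inductive runs :: "(nat \<Rightarrow> nat) \<Rightarrow> prog \<Rightarrow> nat list \<Rightarrow> nat \<Rightarrow> bool" for A :: "nat \<Rightarrow> nat" where
  zero: "runs A Zero xs 0"
| succ: "runs A Succ [x] (Suc x)"
| proj: "i < length xs \<Longrightarrow> runs A (Proj i) xs (xs ! i)"
| query: "runs A Query [x] (A x)"
| comp: "length ys = length qs \<Longrightarrow> (\<forall>i < length qs. runs A (qs ! i) xs (ys ! i)) \<Longrightarrow>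
    runs A p ys y \<Longrightarrow> runs A (Comp p qs) xs y"
| primrec_0: "runs A p xs y \<Longrightarrow> runs A (PrimRec p q) (0 # xs) y"
| primrec_Suc: "runs A (PrimRec p q) (n # xs) r \<Longrightarrow> runs A q (n # r # xs) y \<Longrightarrow>
    runs A (PrimRec p q) (Suc n # xs) y"
| minimize: "runs A p (n # xs) 0 \<Longrightarrow> (\<forall>m < n. \<exists>k. runs A p (m # xs) (Suc k)) \<Longrightarrow>
    runs A (Minimize p) xs n"

lemma runs_deterministic: "runs A p xs y \<Longrightarrow> runs A p xs z \<Longrightarrow> y = z"
proof (induction arbitrary: z rule: runs.induct)
  case (comp ys qs xs p y)
  from comp.prems obtain ys' where ys': "length ys' = length qs"
    "\<forall>i < length qs. runs A (qs ! i) xs (ys' ! i)" "runs A p ys' z"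
    by (auto elim: runs.cases)
  have "ys = ys'"
    using comp.hyps comp.IH ys' by (intro nth_equalityI) auto
  then show ?case using comp.IH ys' by blast
next
  case (primrec_0 p xs y q)
  from primrec_0.prems have "runs A p xs z" by (cases rule: runs.cases) auto
  then show ?case by (rule primrec_0.IH)
next
  case (primrec_Suc p q n xs r y)
  from primrec_Suc.prems obtain r' where
    "runs A (PrimRec p q) (n # xs) r'" "runs A q (n # r' # xs) z"
    by (cases rule: runs.cases) auto
  then show ?case using primrec_Suc.IH by blast
next
  case (minimize p n xs)
  from minimize.prems have z: "runs A p (z # xs) 0" "\<forall>m < z. \<exists>k. runs A p (m # xs) (Suc k)"
    by (auto elim: runs.cases)
  show ?case
    using z minimize.IH by (metis nat.distinct(1) linorder_neqE_nat)
qed (auto elim: runs.cases)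

definition computes_via :: "prog \<Rightarrow> (nat \<Rightarrow> nat) \<Rightarrow> (nat \<Rightarrow> nat) \<Rightarrow> bool" where
  "computes_via p A h \<longleftrightarrow> (\<forall>x. runs A p [x] (h x))"

definition turing_computes :: "(nat \<Rightarrow> nat) \<Rightarrow> (nat \<Rightarrow> nat) \<Rightarrow> bool" where
  "turing_computes A h \<longleftrightarrow> (\<exists>p. computes_via p A h)"

definition density_zero :: "nat set \<Rightarrow> bool" where
  "density_zero S \<longleftrightarrow> (\<lambda>l. real (card (S \<inter> {..<l})) / real l) \<longlonglongrightarrow> 0"

definition coarse_description :: "(nat \<Rightarrow> nat) \<Rightarrow> (nat \<Rightarrow> nat) \<Rightarrow> bool" where
  "coarse_description f' f \<longleftrightarrow> density_zero {x. f x \<noteq> f' x}"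

definition nc_reducible :: "(nat \<Rightarrow> nat) \<Rightarrow> (nat \<Rightarrow> nat) \<Rightarrow> bool"  (infix \<open>\<ge>\<^sub>N\<^sub>C\<close> 50) where
  "f \<ge>\<^sub>N\<^sub>C g \<longleftrightarrow>
    (\<forall>f'. coarse_description f' f \<longrightarrow> (\<exists>g'. coarse_description g' g \<and> turing_computes f' g'))"

definition uc_reducible :: "(nat \<Rightarrow> nat) \<Rightarrow> (nat \<Rightarrow> nat) \<Rightarrow> bool"  (infix \<open>\<ge>\<^sub>U\<^sub>C\<close> 50) where
  "f \<ge>\<^sub>U\<^sub>C g \<longleftrightarrow>
    (\<exists>p. \<forall>f'. coarse_description f' f \<longrightarrow> (\<exists>g'. coarse_description g' g \<and> computes_via p f' g'))"

text \<open>
  Number variables are named by natural numbers. \<open>AppF\<close> and \<open>AppG\<close> apply the first and the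
  second function variable, which are never quantified.
\<close>

datatype tm =
    Var nat
  | Const0
  | S tm
  | Plus tm tm
  | Times tm tm
  | AppF tm
  | AppG tm

datatype fm =
    Eq tm tm
  | Less tm tm
  | Neg fm
  | And fm fm
  | Or fm fm
  | BExists nat tm fm
  | BForall nat tm fm
  | Exists nat fm
  | Forall nat fm

primrec tm_val :: "(nat \<Rightarrow> nat) \<Rightarrow> (nat \<Rightarrow> nat) \<Rightarrow> (nat \<Rightarrow> nat) \<Rightarrow> tm \<Rightarrow> nat" where
  "tm_val f g v (Var x) = v x"
| "tm_val f g v Const0 = 0"
| "tm_val f g v (S t) = Suc (tm_val f g v t)"
| "tm_val f g v (Plus s t) = tm_val f g v s + tm_val f g v t"
| "tm_val f g v (Times s t) = tm_val f g v s * tm_val f g v t"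
| "tm_val f g v (AppF t) = f (tm_val f g v t)"
| "tm_val f g v (AppG t) = g (tm_val f g v t)"

text \<open>
  The bound of a bounded quantifier lies outside the scope of the variable it binds.
\<close>

primrec sat :: "(nat \<Rightarrow> nat) \<Rightarrow> (nat \<Rightarrow> nat) \<Rightarrow> (nat \<Rightarrow> nat) \<Rightarrow> fm \<Rightarrow> bool" where
  "sat f g v (Eq s t) \<longleftrightarrow> tm_val f g v s = tm_val f g v t"
| "sat f g v (Less s t) \<longleftrightarrow> tm_val f g v s < tm_val f g v t"
| "sat f g v (Neg \<phi>) \<longleftrightarrow> \<not> sat f g v \<phi>"
| "sat f g v (And \<phi> \<psi>) \<longleftrightarrow> sat f g v \<phi> \<and> sat f g v \<psi>"
| "sat f g v (Or \<phi> \<psi>) \<longleftrightarrow> sat f g v \<phi> \<or> sat f g v \<psi>"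
| "sat f g v (BExists x t \<phi>) \<longleftrightarrow> (\<exists>n < tm_val f g v t. sat f g (v(x := n)) \<phi>)"
| "sat f g v (BForall x t \<phi>) \<longleftrightarrow> (\<forall>n < tm_val f g v t. sat f g (v(x := n)) \<phi>)"
| "sat f g v (Exists x \<phi>) \<longleftrightarrow> (\<exists>n. sat f g (v(x := n)) \<phi>)"
| "sat f g v (Forall x \<phi>) \<longleftrightarrow> (\<forall>n. sat f g (v(x := n)) \<phi>)"

primrec tm_vars :: "tm \<Rightarrow> nat set" where
  "tm_vars (Var x) = {x}"
| "tm_vars Const0 = {}"
| "tm_vars (S t) = tm_vars t"
| "tm_vars (Plus s t) = tm_vars s \<union> tm_vars t"
| "tm_vars (Times s t) = tm_vars s \<union> tm_vars t"
| "tm_vars (AppF t) = tm_vars t"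
| "tm_vars (AppG t) = tm_vars t"

primrec free_num_vars :: "fm \<Rightarrow> nat set" where
  "free_num_vars (Eq s t) = tm_vars s \<union> tm_vars t"
| "free_num_vars (Less s t) = tm_vars s \<union> tm_vars t"
| "free_num_vars (Neg \<phi>) = free_num_vars \<phi>"
| "free_num_vars (And \<phi> \<psi>) = free_num_vars \<phi> \<union> free_num_vars \<psi>"
| "free_num_vars (Or \<phi> \<psi>) = free_num_vars \<phi> \<union> free_num_vars \<psi>"
| "free_num_vars (BExists x t \<phi>) = tm_vars t \<union> (free_num_vars \<phi> - {x})"
| "free_num_vars (BForall x t \<phi>) = tm_vars t \<union> (free_num_vars \<phi> - {x})"
| "free_num_vars (Exists x \<phi>) = free_num_vars \<phi> - {x}"
| "free_num_vars (Forall x \<phi>) = free_num_vars \<phi> - {x}"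

primrec bounded_fm :: "fm \<Rightarrow> bool" where
  "bounded_fm (Eq s t) \<longleftrightarrow> True"
| "bounded_fm (Less s t) \<longleftrightarrow> True"
| "bounded_fm (Neg \<phi>) \<longleftrightarrow> bounded_fm \<phi>"
| "bounded_fm (And \<phi> \<psi>) \<longleftrightarrow> bounded_fm \<phi> \<and> bounded_fm \<psi>"
| "bounded_fm (Or \<phi> \<psi>) \<longleftrightarrow> bounded_fm \<phi> \<and> bounded_fm \<psi>"
| "bounded_fm (BExists x t \<phi>) \<longleftrightarrow> bounded_fm \<phi>"
| "bounded_fm (BForall x t \<phi>) \<longleftrightarrow> bounded_fm \<phi>"
| "bounded_fm (Exists x \<phi>) \<longleftrightarrow> False"
| "bounded_fm (Forall x \<phi>) \<longleftrightarrow> False"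

text \<open>
  \<open>n\<close> alternating blocks of unbounded number quantifiers in front of a bounded formula. Blocks
  may be empty, so the classes are cumulative in \<open>n\<close>.
\<close>

inductive Sigma0 :: "nat \<Rightarrow> fm \<Rightarrow> bool" and Pi0 :: "nat \<Rightarrow> fm \<Rightarrow> bool" where
  "bounded_fm \<phi> \<Longrightarrow> Sigma0 0 \<phi>"
| "bounded_fm \<phi> \<Longrightarrow> Pi0 0 \<phi>"
| "Pi0 n \<phi> \<Longrightarrow> Sigma0 (Suc n) \<phi>"
| "Sigma0 (Suc n) \<phi> \<Longrightarrow> Sigma0 (Suc n) (Exists x \<phi>)"
| "Sigma0 n \<phi> \<Longrightarrow> Pi0 (Suc n) \<phi>"
| "Pi0 (Suc n) \<phi> \<Longrightarrow> Pi0 (Suc n) (Forall x \<phi>)"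

text \<open>
  Truth of a formula without free number variables; the valuation is then irrelevant.
\<close>

definition holds :: "fm \<Rightarrow> (nat \<Rightarrow> nat) \<Rightarrow> (nat \<Rightarrow> nat) \<Rightarrow> bool" where
  "holds \<phi> f g \<longleftrightarrow> sat f g (\<lambda>_. 0) \<phi>"

end

theory Submission
  imports Defs "HOL-Library.Nat_Bijection" "HOL-Number_Theory.Cong"
begin

text \<open>
  Both reducibilities quantify over all coarse descriptions of \<open>f\<close>, which looks \<open>\<Pi>\<close>-1-1. They become
  arithmetical because every coarse description of \<open>f\<close> is the limit of a descending sequence in a notion of
  forcing with finite conditions. A condition is a string together with a number \<open>k\<close>, its gap; its points are the functions that
  extend the string and, from its end on, differ from \<open>f\<close> on at most \<open>l / k\<close> of the first \<open>l\<close> arguments. Relative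
  to \<open>f\<close> it is decidable whether one condition extends another (\<open>ext\<close>). A condition \<open>c\<close> forces a functional \<open>e\<close>
  to produce coarse descriptions of \<open>g\<close> (\<open>forces\<close>) if for all \<open>m\<close>, each condition below \<open>c\<close> has an extension that
  makes \<open>e\<close> converge at \<open>m\<close> and below which \<open>e\<close> never errs on more than \<open>l / m\<close> of the first \<open>l\<close> arguments, for
  all large \<open>l\<close>. This is a \<open>\<Pi>\<close>-3 property of \<open>f\<close> and \<open>g\<close>. Non-uniform reducibility holds iff some condition
  forces some functional (\<open>nc_reducible_iff\<close>), uniform reducibility iff a condition without constraints forces
  some functional (\<open>uc_reducible_iff\<close>). A condition and an index of a functional are numbers, so both are
  \<open>\<Sigma>\<close>-4 (\<open>sigma_4_forces\<close>).

  That reducibility implies forcing is a Baire category argument. If \<open>c\<close> does not force \<open>e\<close>, an extension of \<open>c\<close>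
  rules out for good that \<open>e\<close> succeeds on a generic point (\<open>not_forces_hopeless\<close>); a generic descending sequence
  does this for all programs in question and converges to a coarse description of \<open>f\<close> because the gaps tend to
  infinity (\<open>generic_coarse_description\<close>).

  For the converse, let \<open>c\<close> force \<open>e\<close>, and let \<open>h\<close> be a coarse description of \<open>f\<close>. The conditions relative to \<open>f\<close>
  and those relative to \<open>h\<close> are cofinal in each other, so that a condition relative to \<open>h\<close> forces \<open>e\<close> as well
  (\<open>transfer_forces\<close>). Hence it suffices that \<open>f\<close> itself computes a coarse description of \<open>g\<close>, by a program that
  depends on \<open>e\<close> and \<open>c\<close> only (\<open>forces_computes\<close>). The difficulty is that no oracle for \<open>g\<close> is at hand to tell which
  conditions have small error. Call a condition coherent of level \<open>m\<close> if any two strings below it yield outputs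
  that differ from each other on at most \<open>2 * l / m\<close> arguments. This does not mention \<open>g\<close> and is \<open>\<Pi>\<close>-1 in \<open>f\<close>, it
  holds on a dense set of conditions, and it implies an error of at most \<open>3 * l / m\<close>, since accurate strings exist
  below every condition (\<open>coherent_dense\<close>, \<open>coherent_correct\<close>). At stage \<open>s\<close> one guesses a descending chain of
  conditions: the next one is always the least that is not yet refuted as coherent of the next level. The last
  condition of the chain supplies the output for the arguments of size about \<open>2 ^ s\<close>. Every link of the chain is
  eventually right (\<open>chain_stabilizes\<close>). The later links may be wrong, but they lie below the right ones, so
  the density of the errors still tends to \<open>0\<close> (\<open>stage_correct\<close>, \<open>block_value_correct\<close>).

  The arithmetical side consists of three facts: the classes of \<open>\<Sigma>\<close>-1 and \<open>\<Delta>\<close>-1 relations have the usual closure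
  properties, so that definability is read off from the definitions; a \<open>\<Sigma>\<close>-1 relation that is total can be
  uniformized by a program (\<open>sigma1_uniformization\<close>); and the runs of all programs form a single \<open>\<Sigma>\<close>-1
  relation (\<open>conv\<close>).
\<close>

section \<open>Formulas and definable relations\<close>

primrec ren_tm :: "(nat \<Rightarrow> nat) \<Rightarrow> tm \<Rightarrow> tm" where
  "ren_tm r (Var x) = Var (r x)"
| "ren_tm r Const0 = Const0"
| "ren_tm r (S t) = S (ren_tm r t)"
| "ren_tm r (Plus s t) = Plus (ren_tm r s) (ren_tm r t)"
| "ren_tm r (Times s t) = Times (ren_tm r s) (ren_tm r t)"
| "ren_tm r (AppF t) = AppF (ren_tm r t)"
| "ren_tm r (AppG t) = AppG (ren_tm r t)"

primrec ren_fm :: "(nat \<Rightarrow> nat) \<Rightarrow> fm \<Rightarrow> fm" where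
  "ren_fm r (Eq s t) = Eq (ren_tm r s) (ren_tm r t)"
| "ren_fm r (Less s t) = Less (ren_tm r s) (ren_tm r t)"
| "ren_fm r (Neg \<phi>) = Neg (ren_fm r \<phi>)"
| "ren_fm r (And \<phi> \<psi>) = And (ren_fm r \<phi>) (ren_fm r \<psi>)"
| "ren_fm r (Or \<phi> \<psi>) = Or (ren_fm r \<phi>) (ren_fm r \<psi>)"
| "ren_fm r (BExists x t \<phi>) = BExists (r x) (ren_tm r t) (ren_fm r \<phi>)"
| "ren_fm r (BForall x t \<phi>) = BForall (r x) (ren_tm r t) (ren_fm r \<phi>)"
| "ren_fm r (Exists x \<phi>) = Exists (r x) (ren_fm r \<phi>)"
| "ren_fm r (Forall x \<phi>) = Forall (r x) (ren_fm r \<phi>)"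

lemma tm_val_ren: "tm_val f g v (ren_tm r t) = tm_val f g (\<lambda>i. v (r i)) t"
  by (induction t) auto

lemma sat_ren:
  assumes "inj r"
  shows "sat f g v (ren_fm r \<phi>) \<longleftrightarrow> sat f g (\<lambda>i. v (r i)) \<phi>"
proof -
  have upd: "(\<lambda>i. (w(r x := n)) (r i)) = (\<lambda>i. w (r i))(x := n)" for w :: "nat \<Rightarrow> nat" and x n
    using assms by (auto simp: fun_eq_iff inj_eq)
  show ?thesis
    by (induction \<phi> arbitrary: v) (simp_all add: tm_val_ren upd del: fun_upd_apply)
qed

lemma bounded_fm_ren: "bounded_fm (ren_fm r \<phi>) \<longleftrightarrow> bounded_fm \<phi>"
  by (induction \<phi>) auto

lemma hierarchy_ren:
  "Sigma0 n \<phi> \<Longrightarrow> Sigma0 n (ren_fm r \<phi>)" "Pi0 n \<phi> \<Longrightarrow> Pi0 n (ren_fm r \<phi>)"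
  by (induction rule: Sigma0_Pi0.inducts)
     (auto simp: bounded_fm_ren intro: Sigma0_Pi0.intros)

lemma tm_val_cong: "\<forall>i\<in>tm_vars t. v i = w i \<Longrightarrow> tm_val f g v t = tm_val f g w t"
  by (induction t) auto

lemma sat_cong: "\<forall>i\<in>free_num_vars \<phi>. v i = w i \<Longrightarrow> sat f g v \<phi> \<longleftrightarrow> sat f g w \<phi>"
proof (induction \<phi> arbitrary: v w)
  case (Eq s t)
  then show ?case using tm_val_cong[of s v w] tm_val_cong[of t v w] by auto
next
  case (Less s t)
  then show ?case using tm_val_cong[of s v w] tm_val_cong[of t v w] by auto
next
  case (BExists x t \<phi>)
  have "tm_val f g v t = tm_val f g w t" using BExists.prems by (intro tm_val_cong) auto
  moreover have "sat f g (v(x := n)) \<phi> \<longleftrightarrow> sat f g (w(x := n)) \<phi>" for n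
    using BExists.prems by (intro BExists.IH) auto
  ultimately show ?case by simp
next
  case (BForall x t \<phi>)
  have "tm_val f g v t = tm_val f g w t" using BForall.prems by (intro tm_val_cong) auto
  moreover have "sat f g (v(x := n)) \<phi> \<longleftrightarrow> sat f g (w(x := n)) \<phi>" for n
    using BForall.prems by (intro BForall.IH) auto
  ultimately show ?case by simp
next
  case (Exists x \<phi>)
  have "sat f g (v(x := n)) \<phi> \<longleftrightarrow> sat f g (w(x := n)) \<phi>" for n
    using Exists.prems by (intro Exists.IH) auto
  then show ?case by simp
next
  case (Forall x \<phi>)
  have "sat f g (v(x := n)) \<phi> \<longleftrightarrow> sat f g (w(x := n)) \<phi>" for n
    using Forall.prems by (intro Forall.IH) auto
  then show ?case by simp
next
  case (And a b)
  have "sat f g v a \<longleftrightarrow> sat f g w a" "sat f g v b \<longleftrightarrow> sat f g w b"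
    using And.prems by (auto intro!: And.IH)
  then show ?case by simp
next
  case (Or a b)
  have "sat f g v a \<longleftrightarrow> sat f g w a" "sat f g v b \<longleftrightarrow> sat f g w b"
    using Or.prems by (auto intro!: Or.IH)
  then show ?case by simp
next
  case (Neg a)
  have "sat f g v a \<longleftrightarrow> sat f g w a"
    using Neg.prems by (auto intro!: Neg.IH)
  then show ?case by simp
qed

lemma finite_tm_vars: "finite (tm_vars t)"
  by (induction t) auto

lemma finite_free_num_vars: "finite (free_num_vars \<phi>)"
  by (induction \<phi>) (auto simp: finite_tm_vars)

text \<open>
  Moves variable \<open>0\<close> to the name \<open>K\<close> and all smaller names down by one. The
  renaming fixes all names above \<open>K\<close>, so that it is injective and captures no bound variable.
\<close>

definition push_ren :: "nat \<Rightarrow> nat \<Rightarrow> nat" where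
  "push_ren K i = (if i = 0 then K else if i \<le> K then i - 1 else i)"

lemma inj_push_ren: "inj (push_ren K)"
  by (auto simp: inj_def push_ren_def split: if_splits)

text \<open>
  Quantifying the name \<open>K\<close> after this renaming amounts to quantifying the de Bruijn variable \<open>0\<close>. It is what turns
  named quantifiers into the de Bruijn quantifiers of the closure rules below.
\<close>

lemma sat_push:
  assumes "free_num_vars \<phi> \<subseteq> {..K}"
  shows "sat f g (v(K := n)) (ren_fm (push_ren K) \<phi>) \<longleftrightarrow> sat f g (case_nat n v) \<phi>"
  unfolding sat_ren[OF inj_push_ren]
  by (rule sat_cong) (use assms in \<open>auto simp: push_ren_def split: nat.split\<close>)

lemma free_num_vars_bound: "\<exists>K. free_num_vars \<phi> \<subseteq> {..K}"
  using finite_free_num_vars[of \<phi>] unfolding finite_nat_set_iff_bounded_le by auto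

text \<open>
  Definable relations are handled semantically, as predicates of the two functions and a valuation. The valuation is
  read in de Bruijn style: below a quantifier, variable \<open>0\<close> is the quantified one and all others are shifted by one.
  The hypothesis of a quantifier rule thus has the form \<open>\<lambda>f g v. Q f g (\<lambda>i. v (Suc i)) (v 0)\<close>, and resolution with such
  rules proves a concrete relation definable by following its syntax.
\<close>

type_synonym env_pred = "(nat \<Rightarrow> nat) \<Rightarrow> (nat \<Rightarrow> nat) \<Rightarrow> (nat \<Rightarrow> nat) \<Rightarrow> bool"
type_synonym env_fun = "(nat \<Rightarrow> nat) \<Rightarrow> (nat \<Rightarrow> nat) \<Rightarrow> (nat \<Rightarrow> nat) \<Rightarrow> nat"

definition term_fun :: "env_fun \<Rightarrow> bool" where
  "term_fun e \<longleftrightarrow> (\<exists>t. \<forall>f g v. tm_val f g v t = e f g v)"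

definition delta0 :: "env_pred \<Rightarrow> bool" where
  "delta0 P \<longleftrightarrow> (\<exists>\<phi>. bounded_fm \<phi> \<and> (\<forall>f g v. sat f g v \<phi> \<longleftrightarrow> P f g v))"

definition sigma :: "nat \<Rightarrow> env_pred \<Rightarrow> bool" where
  "sigma n P \<longleftrightarrow> (\<exists>\<phi>. Sigma0 n \<phi> \<and> (\<forall>f g v. sat f g v \<phi> \<longleftrightarrow> P f g v))"

definition pi_class :: "nat \<Rightarrow> env_pred \<Rightarrow> bool" where
  "pi_class n P \<longleftrightarrow> (\<exists>\<phi>. Pi0 n \<phi> \<and> (\<forall>f g v. sat f g v \<phi> \<longleftrightarrow> P f g v))"

lemma term_fun_intros:
  "term_fun (\<lambda>f g v. v i)"
  "term_fun (\<lambda>f g v. 0)"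
  "term_fun a \<Longrightarrow> term_fun (\<lambda>f g v. Suc (a f g v))"
  "term_fun a \<Longrightarrow> term_fun b \<Longrightarrow> term_fun (\<lambda>f g v. a f g v + b f g v)"
  "term_fun a \<Longrightarrow> term_fun b \<Longrightarrow> term_fun (\<lambda>f g v. a f g v * b f g v)"
  "term_fun a \<Longrightarrow> term_fun (\<lambda>f g v. f (a f g v))"
  "term_fun a \<Longrightarrow> term_fun (\<lambda>f g v. g (a f g v))"
  unfolding term_fun_def
  by (metis tm_val.simps)+

lemma delta0_intros:
  "term_fun a \<Longrightarrow> term_fun b \<Longrightarrow> delta0 (\<lambda>f g v. a f g v = b f g v)"
  "term_fun a \<Longrightarrow> term_fun b \<Longrightarrow> delta0 (\<lambda>f g v. a f g v < b f g v)"
  "delta0 P \<Longrightarrow> delta0 (\<lambda>f g v. \<not> P f g v)"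
  "delta0 P \<Longrightarrow> delta0 Q \<Longrightarrow> delta0 (\<lambda>f g v. P f g v \<and> Q f g v)"
  "delta0 P \<Longrightarrow> delta0 Q \<Longrightarrow> delta0 (\<lambda>f g v. P f g v \<or> Q f g v)"
proof -
  assume "term_fun a" "term_fun b"
  then obtain s t where "\<And>f g v. tm_val f g v s = a f g v" "\<And>f g v. tm_val f g v t = b f g v"
    unfolding term_fun_def by auto
  then show "delta0 (\<lambda>f g v. a f g v = b f g v)" "delta0 (\<lambda>f g v. a f g v < b f g v)"
    unfolding delta0_def by (auto intro: exI[of _ "Eq s t"] exI[of _ "Less s t"])
next
  assume "delta0 P"
  then obtain \<phi> where "bounded_fm \<phi>" "\<And>f g v. sat f g v \<phi> \<longleftrightarrow> P f g v"
    unfolding delta0_def by auto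
  then show "delta0 (\<lambda>f g v. \<not> P f g v)"
    unfolding delta0_def by (auto intro: exI[of _ "Neg \<phi>"])
next
  assume "delta0 P" "delta0 Q"
  then obtain \<phi> \<psi> where "bounded_fm \<phi>" "\<And>f g v. sat f g v \<phi> \<longleftrightarrow> P f g v"
     "bounded_fm \<psi>" "\<And>f g v. sat f g v \<psi> \<longleftrightarrow> Q f g v"
    unfolding delta0_def by auto
  then show "delta0 (\<lambda>f g v. P f g v \<and> Q f g v)" "delta0 (\<lambda>f g v. P f g v \<or> Q f g v)"
    unfolding delta0_def by (auto intro: exI[of _ "And \<phi> \<psi>"] exI[of _ "Or \<phi> \<psi>"])
qed

lemma delta0_ex:
  assumes "delta0 (\<lambda>f g v. Q f g (\<lambda>i. v (Suc i)) (v 0))" "term_fun e"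
  shows "delta0 (\<lambda>f g v. \<exists>n<e f g v. Q f g v n)"
proof -
  obtain \<phi> where b: "bounded_fm \<phi>" and \<phi>: "\<And>f g v. sat f g v \<phi> \<longleftrightarrow> Q f g (\<lambda>i. v (Suc i)) (v 0)"
    using assms(1) unfolding delta0_def by auto
  obtain t where t: "\<And>f g v. tm_val f g v t = e f g v"
    using assms(2) unfolding term_fun_def by auto
  obtain K where K: "free_num_vars \<phi> \<subseteq> {..K}" using free_num_vars_bound by blast
  show ?thesis unfolding delta0_def
    by (rule exI[of _ "BExists K t (ren_fm (push_ren K) \<phi>)"])
      (auto simp: b bounded_fm_ren sat_push[OF K] \<phi> t simp del: fun_upd_apply)
qed

lemma delta0_all:
  assumes "delta0 (\<lambda>f g v. Q f g (\<lambda>i. v (Suc i)) (v 0))" "term_fun e"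
  shows "delta0 (\<lambda>f g v. \<forall>n<e f g v. Q f g v n)"
proof -
  have "delta0 (\<lambda>f g v. \<not> (\<exists>n<e f g v. \<not> Q f g v n))"
    by (intro delta0_intros delta0_ex assms)
  then show ?thesis by simp
qed

lemma delta0_ren:
  assumes "delta0 P" "inj r"
  shows "delta0 (\<lambda>f g v. P f g (\<lambda>i. v (r i)))"
proof -
  obtain \<phi> where "bounded_fm \<phi>" "\<And>f g v. sat f g v \<phi> \<longleftrightarrow> P f g v"
    using assms(1) unfolding delta0_def by auto
  then show ?thesis unfolding delta0_def
    by (intro exI[of _ "ren_fm r \<phi>"]) (simp add: bounded_fm_ren sat_ren[OF assms(2)])
qed

lemma term_fun_ren: "term_fun e \<Longrightarrow> term_fun (\<lambda>f g v. e f g (\<lambda>i. v (r i)))"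
  unfolding term_fun_def by (elim exE, rule_tac x="ren_tm r t" in exI) (simp add: tm_val_ren)

lemma sigma_ex:
  assumes "sigma (Suc k) (\<lambda>f g v. Q f g (\<lambda>i. v (Suc i)) (v 0))"
  shows "sigma (Suc k) (\<lambda>f g v. \<exists>n. Q f g v n)"
proof -
  obtain \<phi> where b: "Sigma0 (Suc k) \<phi>" and \<phi>: "\<And>f g v. sat f g v \<phi> \<longleftrightarrow> Q f g (\<lambda>i. v (Suc i)) (v 0)"
    using assms(1) unfolding sigma_def by auto
  obtain K where K: "free_num_vars \<phi> \<subseteq> {..K}" using free_num_vars_bound by blast
  have "Sigma0 (Suc k) (Exists K (ren_fm (push_ren K) \<phi>))"
    by (rule Sigma0_Pi0.intros(4), rule hierarchy_ren(1), rule b)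
  then show ?thesis unfolding sigma_def
    by (intro exI[of _ "Exists K (ren_fm (push_ren K) \<phi>)"])
      (auto simp: sat_push[OF K] \<phi> simp del: fun_upd_apply)
qed

lemma pi_all:
  assumes "pi_class (Suc k) (\<lambda>f g v. Q f g (\<lambda>i. v (Suc i)) (v 0))"
  shows "pi_class (Suc k) (\<lambda>f g v. \<forall>n. Q f g v n)"
proof -
  obtain \<phi> where b: "Pi0 (Suc k) \<phi>" and \<phi>: "\<And>f g v. sat f g v \<phi> \<longleftrightarrow> Q f g (\<lambda>i. v (Suc i)) (v 0)"
    using assms(1) unfolding pi_class_def by auto
  obtain K where K: "free_num_vars \<phi> \<subseteq> {..K}" using free_num_vars_bound by blast
  have "Pi0 (Suc k) (Forall K (ren_fm (push_ren K) \<phi>))"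
    by (rule Sigma0_Pi0.intros(6), rule hierarchy_ren(2), rule b)
  then show ?thesis unfolding pi_class_def
    by (intro exI[of _ "Forall K (ren_fm (push_ren K) \<phi>)"])
      (auto simp: sat_push[OF K] \<phi> simp del: fun_upd_apply)
qed

lemma sigma_Suc: "pi_class k P \<Longrightarrow> sigma (Suc k) P"
  unfolding sigma_def pi_class_def by (elim ex_forward) (auto intro: Sigma0_Pi0.intros(3))

lemma pi_Suc: "sigma k P \<Longrightarrow> pi_class (Suc k) P"
  unfolding sigma_def pi_class_def by (elim ex_forward) (auto intro: Sigma0_Pi0.intros(5))

text \<open>
  A variable that does not influence the truth value may as well be quantified existentially. This removes the free
  variables without leaving the class.
\<close>

lemma sigma_sentence:
  assumes "sigma (Suc k) (\<lambda>f g v. P f g)"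
  shows "\<exists>\<psi>. Sigma0 (Suc k) \<psi> \<and> free_num_vars \<psi> = {} \<and> (\<forall>f g. holds \<psi> f g \<longleftrightarrow> P f g)"
proof -
  define defines_P where "defines_P \<phi> \<longleftrightarrow> Sigma0 (Suc k) \<phi> \<and> (\<forall>f g v. sat f g v \<phi> \<longleftrightarrow> P f g)" for \<phi>
  have "\<exists>\<psi>. defines_P \<psi> \<and> free_num_vars \<psi> = {}"
    if "finite X" "free_num_vars \<phi> = X" "defines_P \<phi>" for X \<phi>
    using that
  proof (induction X arbitrary: \<phi> rule: finite_induct)
    case empty
    then show ?case by blast
  next
    case (insert x F)
    have "free_num_vars (Exists x \<phi>) = F" using insert by auto
    moreover have "defines_P (Exists x \<phi>)" using insert.prems(2) unfolding defines_P_def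
      by (simp add: Sigma0_Pi0.intros(4))
    ultimately show ?case using insert.IH[of "Exists x \<phi>"] by blast
  qed
  moreover obtain \<phi> where "defines_P \<phi>"
    using assms unfolding sigma_def defines_P_def by blast
  ultimately obtain \<psi> where "defines_P \<psi>" "free_num_vars \<psi> = {}"
    using finite_free_num_vars[of \<phi>] by blast
  then show ?thesis unfolding defines_P_def holds_def by auto
qed

section \<open>Sigma-1 relations and recursive functions\<close>

text \<open>
  \<open>\<Sigma>\<close>-1 relations are put in a normal form with a single unbounded quantifier, so that closure under bounded
  universal quantification only takes a common bound on the witnesses. The constant \<open>delta0_matrix\<close> keeps the matrix
  \<open>Q\<close> out of the higher-order pattern in which it occurs, which would have many unifiers.
\<close>

definition delta0_matrix :: "((nat \<Rightarrow> nat) \<Rightarrow> (nat \<Rightarrow> nat) \<Rightarrow> (nat \<Rightarrow> nat) \<Rightarrow> nat \<Rightarrow> bool) \<Rightarrow> bool" where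
  "delta0_matrix Q \<longleftrightarrow> delta0 (\<lambda>f g v. Q f g (\<lambda>i. v (Suc i)) (v 0))"

definition sigma1 :: "env_pred \<Rightarrow> bool" where
  "sigma1 P \<longleftrightarrow> (\<exists>Q. delta0_matrix Q \<and>
     (\<forall>f g v. P f g v \<longleftrightarrow> (\<exists>m. Q f g v m)))"

definition delta1 :: "env_pred \<Rightarrow> bool" where
  "delta1 P \<longleftrightarrow> sigma1 P \<and> sigma1 (\<lambda>f g v. \<not> P f g v)"

definition rec_fun :: "env_fun \<Rightarrow> bool" where
  "rec_fun e \<longleftrightarrow> sigma1 (\<lambda>f g v. v 0 = e f g (\<lambda>i. v (Suc i)))"

lemma sigma1E:
  assumes "sigma1 P"
  obtains Q where "delta0_matrix Q" "\<forall>f g v. P f g v \<longleftrightarrow> (\<exists>m. Q f g v m)"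
  using assms unfolding sigma1_def by (elim exE conjE)

lemma sigma1I:
  assumes "delta0 (\<lambda>f g v. Q f g (\<lambda>i. v (Suc i)) (v 0))" "\<And>f g v. P f g v \<longleftrightarrow> (\<exists>m. Q f g v m)"
  shows "sigma1 P"
  unfolding sigma1_def
  by (rule exI[of _ Q]) (use assms(2) in \<open>auto simp: delta0_matrix_def intro: assms(1)\<close>)

lemma sigma1_if_delta0: 
  assumes "delta0 P" shows "sigma1 P"
  by (rule sigma1I[of "\<lambda>f g v m. P f g v"]) (use delta0_ren[OF assms inj_Suc] in simp_all)

lemma inj_lift: "inj r \<Longrightarrow> inj (case_nat 0 (\<lambda>i. Suc (r i)))"
proof (rule injI)
  fix x y assume "inj r" "case_nat 0 (\<lambda>i. Suc (r i)) x = case_nat 0 (\<lambda>i. Suc (r i)) y"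
  then show "x = y" by (cases x; cases y) (simp_all add: inj_eq)
qed

lemma sigma1_ren:
  assumes "sigma1 P" "inj r"
  shows "sigma1 (\<lambda>f g v. P f g (\<lambda>i. v (r i)))"
proof -
  obtain Q where Q: "delta0_matrix Q"
     "\<forall>f g v. P f g v \<longleftrightarrow> (\<exists>m. Q f g v m)" by (rule sigma1E[OF assms(1)])
  have "inj (case_nat 0 (\<lambda>i. Suc (r i)))" by (rule inj_lift[OF assms(2)])
  from delta0_ren[OF Q(1)[unfolded delta0_matrix_def] this]
  show ?thesis
    by (intro sigma1I[of "\<lambda>f g v. Q f g (\<lambda>i. v (r i))"]) (simp_all add: Q(2)[rule_format])
qed

lemma delta0_shift_pair:
  assumes "delta0 (\<lambda>f g v. Q f g (\<lambda>i. v (Suc i)) (v 0))"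
  shows "delta0 (\<lambda>f g v. Q f g (\<lambda>i. v (Suc (Suc i))) (v 0))"
proof -
  have "inj (case_nat 0 (\<lambda>i. Suc (Suc i)))" by (auto simp: inj_def split: nat.splits)
  from delta0_ren[OF assms this] show ?thesis by simp
qed

lemma sigma1_conj:
  assumes "sigma1 P" "sigma1 P'"
  shows "sigma1 (\<lambda>f g v. P f g v \<and> P' f g v)"
proof -
  obtain Q where Q: "delta0_matrix Q"
     "\<forall>f g v. P f g v \<longleftrightarrow> (\<exists>m. Q f g v m)" by (rule sigma1E[OF assms(1)])
  obtain Q' where Q': "delta0_matrix Q'"
     "\<forall>f g v. P' f g v \<longleftrightarrow> (\<exists>m. Q' f g v m)" by (rule sigma1E[OF assms(2)])
  have "(P f g v \<and> P' f g v) = (\<exists>m. (\<exists>a<m. Q f g v a) \<and> (\<exists>b<m. Q' f g v b))" for f g v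
  proof
    assume "P f g v \<and> P' f g v"
    then obtain a b where "Q f g v a" "Q' f g v b" using Q(2)[rule_format] Q'(2)[rule_format] by blast
    then show "\<exists>m. (\<exists>a<m. Q f g v a) \<and> (\<exists>b<m. Q' f g v b)"
      by (intro exI[of _ "Suc (max a b)"]) (metis less_Suc_eq_le max.cobounded1 max.cobounded2)
  qed (use Q(2)[rule_format] Q'(2)[rule_format] in blast)
  then show ?thesis
    by (intro sigma1I[of "\<lambda>f g v m. (\<exists>a<m. Q f g v a) \<and> (\<exists>b<m. Q' f g v b)"])
      (auto intro!: delta0_intros delta0_ex term_fun_intros delta0_shift_pair[OF Q(1)[unfolded delta0_matrix_def]] delta0_shift_pair[OF Q'(1)[unfolded delta0_matrix_def]])
qed

lemma sigma1_disj:
  assumes "sigma1 P" "sigma1 P'"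
  shows "sigma1 (\<lambda>f g v. P f g v \<or> P' f g v)"
proof -
  obtain Q where Q: "delta0_matrix Q"
     "\<forall>f g v. P f g v \<longleftrightarrow> (\<exists>m. Q f g v m)" by (rule sigma1E[OF assms(1)])
  obtain Q' where Q': "delta0_matrix Q'"
     "\<forall>f g v. P' f g v \<longleftrightarrow> (\<exists>m. Q' f g v m)" by (rule sigma1E[OF assms(2)])
  show ?thesis
    by (intro sigma1I[of "\<lambda>f g v m. Q f g v m \<or> Q' f g v m"])
      (auto intro!: delta0_intros Q(1)[unfolded delta0_matrix_def] Q'(1)[unfolded delta0_matrix_def] simp: Q(2)[rule_format] Q'(2)[rule_format])
qed

text \<open>
  For a relation \<open>Q\<close> with a quantified variable that is itself bounded: of the variables \<open>0\<close> (the witness), \<open>1\<close> (the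
  quantified variable) and \<open>2\<close> (the common bound of both), the matrix does not see the last.
\<close>

lemma delta0_matrix_skip:
  assumes "delta0_matrix Q"
  shows "delta0 (\<lambda>f g v. Q f g (case_nat (v 1) (\<lambda>i. v (Suc (Suc (Suc i))))) (v 0))"
proof -
  have "inj (case_nat 0 (case_nat 1 (\<lambda>i. Suc (Suc (Suc i)))))" by (auto simp: inj_def split: nat.splits)
  from delta0_ren[OF assms[unfolded delta0_matrix_def] this]
  have "delta0 (\<lambda>f g v. Q f g (\<lambda>i. v (case_nat (1::nat) (\<lambda>i. Suc (Suc (Suc i))) i)) (v 0))"
    by simp
  moreover have eq: "(\<lambda>i. v (case_nat (1::nat) (\<lambda>i. Suc (Suc (Suc i))) i)) = case_nat (v 1) (\<lambda>i. v (Suc (Suc (Suc i))))" for v :: "nat \<Rightarrow> nat"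
    by (auto simp: fun_eq_iff split: nat.split)
  ultimately show ?thesis unfolding eq by -
qed

lemma sigma1_ex:
  assumes "sigma1 (\<lambda>f g v. P f g (\<lambda>i. v (Suc i)) (v 0))"
  shows "sigma1 (\<lambda>f g v. \<exists>n. P f g v n)"
proof -
  obtain Q where Q: "delta0_matrix Q"
     "\<forall>f g v. P f g (\<lambda>i. v (Suc i)) (v 0) \<longleftrightarrow> (\<exists>m. Q f g v m)" by (rule sigma1E[OF assms(1)])
  have P: "P f g v n \<longleftrightarrow> (\<exists>m. Q f g (case_nat n v) m)" for f g v n
    using Q(2)[rule_format, of f g "case_nat n v"] by simp
  have "(\<exists>n. P f g v n) = (\<exists>b. \<exists>n<b. \<exists>m<b. Q f g (case_nat n v) m)" for f g v
  proof
    assume "\<exists>n. P f g v n"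
    then obtain n m where "Q f g (case_nat n v) m" using P by blast
    then show "\<exists>b. \<exists>n<b. \<exists>m<b. Q f g (case_nat n v) m"
      by (rule_tac exI[of _ "Suc (max n m)"]) (metis less_Suc_eq_le max.cobounded1 max.cobounded2)
  qed (use P in blast)
  moreover note delta0_matrix_skip[OF Q(1)]
  ultimately show ?thesis
    by (intro sigma1I[of "\<lambda>f g v b. \<exists>n<b. \<exists>m<b. Q f g (case_nat n v) m"])
      (auto intro!: delta0_ex term_fun_intros)
qed

lemma sigma1_ball_term:
  assumes "sigma1 (\<lambda>f g v. P f g (\<lambda>i. v (Suc i)) (v 0))" "term_fun e"
  shows "sigma1 (\<lambda>f g v. \<forall>n<e f g v. P f g v n)"
proof -
  obtain Q where Q: "delta0_matrix Q"
     "\<forall>f g v. P f g (\<lambda>i. v (Suc i)) (v 0) \<longleftrightarrow> (\<exists>m. Q f g v m)" by (rule sigma1E[OF assms(1)])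
  have P: "P f g v n \<longleftrightarrow> (\<exists>m. Q f g (case_nat n v) m)" for f g v n
    using Q(2)[rule_format, of f g "case_nat n v"] by simp
  have "(\<forall>n<e f g v. P f g v n) = (\<exists>b. \<forall>n<e f g v. \<exists>m<b. Q f g (case_nat n v) m)" for f g v
  proof
    assume "\<forall>n<e f g v. P f g v n"
    then obtain h where h: "\<And>n. n < e f g v \<Longrightarrow> Q f g (case_nat n v) (h n)" using P by metis
    have "h n < Suc (Max (h ` {..<e f g v}))" if "n < e f g v" for n
      using that by (simp add: less_Suc_eq_le)
    then show "\<exists>b. \<forall>n<e f g v. \<exists>m<b. Q f g (case_nat n v) m"
      using h by blast
  qed (use P in blast)
  moreover note delta0_matrix_skip[OF Q(1)]
  ultimately show ?thesis
    by (intro sigma1I[of "\<lambda>f g v b. \<forall>n<e f g v. \<exists>m<b. Q f g (case_nat n v) m"])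
      (auto intro!: delta0_ex delta0_all term_fun_intros term_fun_ren[OF assms(2), of Suc])
qed

lemma rec_fun_term: "term_fun e \<Longrightarrow> rec_fun e"
  unfolding rec_fun_def
  by (intro sigma1_if_delta0 delta0_intros(1) term_fun_intros(1) term_fun_ren[of e Suc])

lemma sigma1_subst:
  assumes "sigma1 (\<lambda>f g v. P f g (\<lambda>i. v (Suc i)) (v 0))" "rec_fun e"
  shows "sigma1 (\<lambda>f g v. P f g v (e f g v))"
proof -
  have "sigma1 (\<lambda>f g v. \<exists>n. n = e f g v \<and> P f g v n)"
    using assms unfolding rec_fun_def by (intro sigma1_ex sigma1_conj) auto
  then show ?thesis by simp
qed

text \<open>
  A formula sees finitely many variables only. This is what allows the simultaneous substitution below to be
  carried out by finitely many quantifiers.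
\<close>

lemma sigma1_finitary:
  assumes "sigma1 P"
  shows "\<exists>K. \<forall>f g v w. (\<forall>i<K. v i = w i) \<longrightarrow> P f g v = P f g w"
proof -
  obtain Q where Q: "delta0_matrix Q"
     "\<forall>f g v. P f g v \<longleftrightarrow> (\<exists>m. Q f g v m)" by (rule sigma1E[OF assms(1)])
  note Q(1)[unfolded delta0_matrix_def]
  obtain \<phi> where \<phi>: "\<And>f g v. sat f g v \<phi> \<longleftrightarrow> Q f g (\<lambda>i. v (Suc i)) (v 0)"
    using Q(1) unfolding delta0_matrix_def delta0_def by auto
  obtain K where K: "free_num_vars \<phi> \<subseteq> {..K}" using free_num_vars_bound by blast
  have "Q f g v m = Q f g w m" if "\<forall>i<K. v i = w i" for f g v w m
  proof -
    have "\<forall>i\<in>free_num_vars \<phi>. case_nat m v i = case_nat m w i"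
      using K that by (auto split: nat.split)
    then have "sat f g (case_nat m v) \<phi> = sat f g (case_nat m w) \<phi>"
      by (rule sat_cong)
    then show ?thesis by (simp add: \<phi>)
  qed
  then have "\<forall>f g v w. (\<forall>i<K. v i = w i) \<longrightarrow> P f g v = P f g w"
    unfolding Q(2)[rule_format] by blast
  then show ?thesis ..
qed

text \<open>
  Substituting a value means quantifying over it and asserting its graph, one variable after the other. Once this is
  available, definability of a relation need only be checked with variables as arguments.
\<close>

lemma sigma1_subst_all:
  assumes P: "sigma1 P" and e: "\<And>i. rec_fun (e i)"
  shows "sigma1 (\<lambda>f g v. P f g (\<lambda>i. e i f g v))"
proof -
  obtain K where K: "\<And>f g v w. (\<forall>i<K. v i = w i) \<Longrightarrow> P f g v = P f g w"
    using sigma1_finitary[OF P] by blast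
  \<comment> \<open>After \<open>j\<close> replacements the valuation still carries the \<open>K - j\<close> variables of \<open>P\<close> that are
    to be replaced in front of the variables of the result, so \<open>e i\<close> reads its own variables behind them.\<close>
  have "sigma1 (\<lambda>f g v. P f g (\<lambda>i. if i < j then e i f g (\<lambda>k. v (k + (K - j))) else v (i - j)))" if "j \<le> K" for j
    using that
  proof (induction j)
    case 0
    then show ?case using P by simp
  next
    case (Suc j)
    let ?d = "K - Suc j"
    have d: "K - j = Suc ?d" using Suc.prems by simp
    have eq: "(\<lambda>i. if i < Suc j then e i f g (\<lambda>k. v (k + ?d)) else v (i - Suc j)) =
      (\<lambda>i. if i < j then e i f g (\<lambda>k. (case_nat (e j f g (\<lambda>k. v (k + ?d))) v) (k + (K - j)))
        else (case_nat (e j f g (\<lambda>k. v (k + ?d))) v) (i - j))" (is "?l = ?r") for f g v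
    proof
      fix i
      consider "i < j" | "i = j" | m where "i = Suc (j + m)"
        by (metis less_imp_Suc_add linorder_neqE_nat)
      then show "?l i = ?r i" by cases (simp_all add: d)
    qed
    have e': "rec_fun (\<lambda>f g v. e j f g (\<lambda>k. v (k + ?d)))"
    proof -
      have "inj (case_nat 0 (\<lambda>i. Suc (i + ?d)))" by (auto simp: inj_def split: nat.splits)
      from sigma1_ren[OF e[of j, unfolded rec_fun_def] this]
      show ?thesis unfolding rec_fun_def by simp
    qed
    have IH: "sigma1 (\<lambda>f g v. P f g (\<lambda>i. if i < j then e i f g (\<lambda>k. v (k + (K - j))) else v (i - j)))"
      using Suc by simp
    have cn: "case_nat (v 0) (\<lambda>i. v (Suc i)) = v" for v :: "nat \<Rightarrow> nat"
      by (auto simp: fun_eq_iff split: nat.split)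
    show ?case unfolding eq
      by (rule sigma1_subst[OF _ e', of "\<lambda>f g v n. P f g (\<lambda>i. if i < j then e i f g (\<lambda>k. case_nat n v (k + (K - j))) else case_nat n v (i - j))"])
        (simp only: cn IH)
  qed
  from this[of K]
  have "sigma1 (\<lambda>f g v. P f g (\<lambda>i. if i < K then e i f g v else v (i - K)))"
    unfolding diff_self_eq_0 add_0_right by simp
  moreover have "P f g (\<lambda>i. if i < K then e i f g v else v (i - K)) = P f g (\<lambda>i. e i f g v)" for f g v
    by (rule K) simp
  ultimately show ?thesis by simp
qed

lemma rec_fun_ren:
  assumes "rec_fun e" "inj r"
  shows "rec_fun (\<lambda>f g v. e f g (\<lambda>i. v (r i)))"
proof -
  have "inj (case_nat 0 (\<lambda>i. Suc (r i)))" by (rule inj_lift[OF assms(2)])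
  from sigma1_ren[OF assms(1)[unfolded rec_fun_def] this]
  show ?thesis unfolding rec_fun_def by simp
qed

lemma rec_fun_var: "rec_fun (\<lambda>f g v. v i)"
  by (intro rec_fun_term term_fun_intros)

lemma rec_fun_subst_all:
  assumes a: "rec_fun a" and e: "\<And>i. rec_fun (e i)"
  shows "rec_fun (\<lambda>f g v. a f g (\<lambda>i. e i f g v))"
proof -
  have "sigma1 (\<lambda>f g v. (\<lambda>i. (case_nat (\<lambda>f g v. v 0) (\<lambda>i f g v. e i f g (\<lambda>i. v (Suc i))) i) f g v) 0 = 
     a f g (\<lambda>i. (\<lambda>i. (case_nat (\<lambda>f g v. v 0) (\<lambda>i f g v. e i f g (\<lambda>i. v (Suc i))) i) f g v) (Suc i)))"
    by (rule sigma1_subst_all[OF a[unfolded rec_fun_def]])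
      (auto split: nat.split intro!: rec_fun_var rec_fun_ren[OF e, of Suc])
  then show ?thesis unfolding rec_fun_def by simp
qed

lemma delta1_subst_all:
  assumes "delta1 P" "\<And>i. rec_fun (e i)"
  shows "delta1 (\<lambda>f g v. P f g (\<lambda>i. e i f g v))"
  using sigma1_subst_all assms unfolding delta1_def by blast

lemma delta1_sigma1: "delta1 P \<Longrightarrow> sigma1 P" 
  and delta1_sigma1_neg: "delta1 P \<Longrightarrow> sigma1 (\<lambda>f g v. \<not> P f g v)"
  unfolding delta1_def by auto

lemma delta1_if_delta0: "delta0 P \<Longrightarrow> delta1 P"
  unfolding delta1_def by (auto intro: sigma1_if_delta0 delta0_intros)

lemma delta1_not: "delta1 P \<Longrightarrow> delta1 (\<lambda>f g v. \<not> P f g v)"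
  unfolding delta1_def by auto

lemma delta1_conj: "delta1 P \<Longrightarrow> delta1 Q \<Longrightarrow> delta1 (\<lambda>f g v. P f g v \<and> Q f g v)"
  unfolding delta1_def de_Morgan_conj by (elim conjE, intro conjI sigma1_conj sigma1_disj)

lemma delta1_disj: "delta1 P \<Longrightarrow> delta1 Q \<Longrightarrow> delta1 (\<lambda>f g v. P f g v \<or> Q f g v)"
  unfolding delta1_def de_Morgan_disj by (elim conjE, intro conjI sigma1_conj sigma1_disj)

lemma delta1_imp: "delta1 P \<Longrightarrow> delta1 Q \<Longrightarrow> delta1 (\<lambda>f g v. P f g v \<longrightarrow> Q f g v)"
  unfolding imp_conv_disj by (intro delta1_disj delta1_not)

lemma delta1_subst2:
  assumes "delta0 (\<lambda>f g v. R (v 0) (v 1))" "rec_fun a" "rec_fun b"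
  shows "delta1 (\<lambda>f g v. R (a f g v) (b f g v))"
  using delta1_subst_all[OF delta1_if_delta0[OF assms(1)], of "\<lambda>i. if i = 0 then a else b"] assms(2,3)
  by simp

lemma delta1_eq: "rec_fun a \<Longrightarrow> rec_fun b \<Longrightarrow> delta1 (\<lambda>f g v. a f g v = b f g v)"
  by (rule delta1_subst2) (intro delta0_intros term_fun_intros)

lemma delta1_less: "rec_fun a \<Longrightarrow> rec_fun b \<Longrightarrow> delta1 (\<lambda>f g v. a f g v < b f g v)"
  by (rule delta1_subst2) (intro delta0_intros term_fun_intros)

lemma delta1_le: "rec_fun a \<Longrightarrow> rec_fun b \<Longrightarrow> delta1 (\<lambda>f g v. a f g v \<le> b f g v)"
  unfolding not_less[symmetric] by (intro delta1_not delta1_less)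

lemma sigma1_ball:
  assumes P: "sigma1 (\<lambda>f g v. P f g (\<lambda>i. v (Suc i)) (v 0))" and e: "rec_fun e"
  shows "sigma1 (\<lambda>f g v. \<forall>n<e f g v. P f g v n)"
proof -
  have "inj (case_nat 0 (\<lambda>i. Suc (Suc i)))" by (auto simp: inj_def split: nat.splits)
  from sigma1_ren[OF P this]
  have "sigma1 (\<lambda>f g v. P f g (\<lambda>i. v (Suc (Suc i))) (v 0))" by simp
  then have "sigma1 (\<lambda>f g v. \<forall>n<v 0. P f g (\<lambda>i. v (Suc i)) n)"
    by (intro sigma1_ball_term term_fun_intros) auto
  then show ?thesis using sigma1_subst[of "\<lambda>f g v m. \<forall>n<m. P f g v n", OF _ e] by simp
qed

lemma sigma1_bex:
  assumes P: "sigma1 (\<lambda>f g v. P f g (\<lambda>i. v (Suc i)) (v 0))" and e: "rec_fun e"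
  shows "sigma1 (\<lambda>f g v. \<exists>n<e f g v. P f g v n)"
  by (intro sigma1_ex sigma1_conj P delta1_sigma1 delta1_less rec_fun_var rec_fun_ren[OF e, of Suc]) auto

lemma delta1_bex:
  assumes "delta1 (\<lambda>f g v. P f g (\<lambda>i. v (Suc i)) (v 0))" and "rec_fun e"
  shows "delta1 (\<lambda>f g v. \<exists>n<e f g v. P f g v n)"
  using sigma1_bex[of P] sigma1_ball[of "\<lambda>f g v n. \<not> P f g v n"] assms unfolding delta1_def by auto

lemma delta1_ball:
  assumes "delta1 (\<lambda>f g v. P f g (\<lambda>i. v (Suc i)) (v 0))" and "rec_fun e"
  shows "delta1 (\<lambda>f g v. \<forall>n<e f g v. P f g v n)"
  using sigma1_ball[of P] sigma1_bex[of "\<lambda>f g v n. \<not> P f g v n"] assms unfolding delta1_def by auto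

lemma delta1_const: "delta1 (\<lambda>f g v. True)"
  using delta1_eq[OF rec_fun_var rec_fun_var, of 0 0] by simp

lemma rec_fun_const: "rec_fun (\<lambda>f g v. n)"
proof -
  have "term_fun (\<lambda>f g v. n)"
    by (induction n) (rule term_fun_intros(2), rule term_fun_intros(3))
  then show ?thesis by (rule rec_fun_term)
qed

lemma rec_fun_subst1:
  assumes "rec_fun (\<lambda>f g v. R f g (v 0))" "rec_fun a"
  shows "rec_fun (\<lambda>f g v. R f g (a f g v))"
  using rec_fun_subst_all[OF assms(1), of "\<lambda>i. a"] assms(2) by simp

lemma rec_fun_subst2:
  assumes "rec_fun (\<lambda>f g v. R f g (v 0) (v 1))" "rec_fun a" "rec_fun b"
  shows "rec_fun (\<lambda>f g v. R f g (a f g v) (b f g v))"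
  using rec_fun_subst_all[OF assms(1), of "\<lambda>i. if i = 0 then a else b"] assms(2,3) by simp

lemma rec_fun_Suc: "rec_fun a \<Longrightarrow> rec_fun (\<lambda>f g v. Suc (a f g v))"
  by (rule rec_fun_subst1[of "\<lambda>f g. Suc", OF rec_fun_term[OF term_fun_intros(3)]]) (rule term_fun_intros(1))

lemma rec_fun_plus: "rec_fun a \<Longrightarrow> rec_fun b \<Longrightarrow> rec_fun (\<lambda>f g v. a f g v + b f g v)"
  by (rule rec_fun_subst2[of "\<lambda>f g x y. x + y", OF rec_fun_term[OF term_fun_intros(4)]]) (rule term_fun_intros(1) | assumption)+

lemma rec_fun_times: "rec_fun a \<Longrightarrow> rec_fun b \<Longrightarrow> rec_fun (\<lambda>f g v. a f g v * b f g v)"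
  by (rule rec_fun_subst2[of "\<lambda>f g x y. x * y", OF rec_fun_term[OF term_fun_intros(5)]]) (rule term_fun_intros(1) | assumption)+

lemma rec_fun_f: "rec_fun a \<Longrightarrow> rec_fun (\<lambda>f g v. f (a f g v))"
  by (rule rec_fun_subst1[of "\<lambda>f g. f", OF rec_fun_term[OF term_fun_intros(6)]]) (rule term_fun_intros(1))

lemma rec_fun_g: "rec_fun a \<Longrightarrow> rec_fun (\<lambda>f g v. g (a f g v))"
  by (rule rec_fun_subst1[of "\<lambda>f g. g", OF rec_fun_term[OF term_fun_intros(7)]]) (rule term_fun_intros(1))

lemma rec_fun_if:
  assumes "delta1 P" "rec_fun a" "rec_fun b"
  shows "rec_fun (\<lambda>f g v. if P f g v then a f g v else b f g v)"
proof -
  have "sigma1 (\<lambda>f g v. (P f g (\<lambda>i. v (Suc i)) \<and> v 0 = a f g (\<lambda>i. v (Suc i))) \<or>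
     (\<not> P f g (\<lambda>i. v (Suc i)) \<and> v 0 = b f g (\<lambda>i. v (Suc i))))"
    using assms unfolding rec_fun_def delta1_def
    by (intro sigma1_disj sigma1_conj sigma1_ren[of P Suc] sigma1_ren[of "\<lambda>f g v. \<not> P f g v" Suc]) auto
  then show ?thesis unfolding rec_fun_def
    by (rule back_subst[of sigma1]) (auto simp: fun_eq_iff)
qed

lemma rec_funI: "sigma1 (\<lambda>f g v. v 0 = e f g (\<lambda>i. v (Suc i))) \<Longrightarrow> rec_fun e"
  unfolding rec_fun_def .

lemmas rec_rules = rec_fun_var rec_fun_const rec_fun_Suc rec_fun_plus rec_fun_times 
lemmas delta1_rules = delta1_not delta1_conj delta1_disj delta1_imp delta1_eq delta1_less delta1_le
  delta1_bex delta1_ball delta1_const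

section \<open>Coding of pairs and finite sequences\<close>

definition pair :: "nat \<Rightarrow> nat \<Rightarrow> nat" where "pair a b = prod_encode (a, b)"
definition pfst :: "nat \<Rightarrow> nat" where "pfst c = fst (prod_decode c)"
definition psnd :: "nat \<Rightarrow> nat" where "psnd c = snd (prod_decode c)"

lemma pair_simps [simp]: "pfst (pair a b) = a" "psnd (pair a b) = b" "pair (pfst c) (psnd c) = c"
  by (auto simp: pair_def pfst_def psnd_def)

lemma pair_inj [simp]: "pair a b = pair c d \<longleftrightarrow> a = c \<and> b = d"
  by (auto simp: pair_def)

lemma le_pair: "a \<le> pair a b" "b \<le> pair a b"
  by (auto simp: pair_def le_prod_encode_1 le_prod_encode_2)

lemma pair_iff: "c = pair a b \<longleftrightarrow> c + c = (a + b) * Suc (a + b) + (a + a)"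
proof -
  have "2 * triangle n = n * Suc n" for n by (induction n) auto
  from this[of "a + b"] have "2 * pair a b = (a + b) * Suc (a + b) + 2 * a"
    unfolding pair_def prod_encode_def by simp
  then show ?thesis by linarith
qed

lemma rec_fun_pair: "rec_fun a \<Longrightarrow> rec_fun b \<Longrightarrow> rec_fun (\<lambda>f g v. pair (a f g v) (b f g v))"
proof (rule rec_fun_subst2[of "\<lambda>f g. pair"], rule rec_funI)
  show "sigma1 (\<lambda>f g v. v 0 = pair (v (Suc 0)) (v (Suc 1)))" unfolding pair_iff
    by (intro delta1_sigma1 delta1_rules rec_rules)
qed

lemma rec_fun_pfst: "rec_fun a \<Longrightarrow> rec_fun (\<lambda>f g v. pfst (a f g v))"
proof (rule rec_fun_subst1[of "\<lambda>f g. pfst"], rule rec_funI)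
  have "sigma1 (\<lambda>f g v. \<exists>b. v 1 = pair (v 0) b)" 
    by (intro sigma1_ex delta1_sigma1 delta1_rules rec_rules rec_fun_pair)
  moreover have "(\<exists>b. v 1 = pair (v 0) b) = (v 0 = pfst (v (Suc 0)))" for v :: "nat \<Rightarrow> nat"
    by (metis One_nat_def pair_simps)
  ultimately show "sigma1 (\<lambda>f g v. v 0 = pfst (v (Suc 0)))" by simp
qed

lemma rec_fun_psnd: "rec_fun a \<Longrightarrow> rec_fun (\<lambda>f g v. psnd (a f g v))"
proof (rule rec_fun_subst1[of "\<lambda>f g. psnd"], rule rec_funI)
  have "sigma1 (\<lambda>f g v. \<exists>b. v 1 = pair b (v 0))" 
    by (intro sigma1_ex delta1_sigma1 delta1_rules rec_rules rec_fun_pair)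
  moreover have "(\<exists>b. v 1 = pair b (v 0)) = (v 0 = psnd (v (Suc 0)))" for v :: "nat \<Rightarrow> nat"
    by (metis One_nat_def pair_simps)
  ultimately show "sigma1 (\<lambda>f g v. v 0 = psnd (v (Suc 0)))" by simp
qed

text \<open>
  Goedel's \<open>\<beta>\<close> function, with its two parameters packed into one number. It is total, so that every number codes a
  function, and every finite sequence is an initial segment of such a function.
\<close>

definition seq :: "nat \<Rightarrow> nat \<Rightarrow> nat" where
  "seq c i = pfst c mod Suc (Suc i * psnd c)"

lemma rec_fun_mod_Suc: "rec_fun a \<Longrightarrow> rec_fun b \<Longrightarrow> rec_fun (\<lambda>f g v. a f g v mod Suc (b f g v))"
proof (rule rec_fun_subst2[of "\<lambda>f g x y. x mod Suc y"], rule rec_funI)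
  have "sigma1 (\<lambda>f g v. \<exists>q. v 1 = q * Suc (v 2) + v 0 \<and> v 0 < Suc (v 2))" 
    by (intro sigma1_ex delta1_sigma1 delta1_rules rec_rules)
  moreover have "(\<exists>q. v 1 = q * Suc (v 2) + v 0 \<and> v 0 < Suc (v 2)) = (v 0 = v (Suc 0) mod Suc (v (Suc 1)))" for v :: "nat \<Rightarrow> nat"
  proof
    assume "v 0 = v (Suc 0) mod Suc (v (Suc 1))"
    then show "\<exists>q. v 1 = q * Suc (v 2) + v 0 \<and> v 0 < Suc (v 2)"
      by (intro exI[of _ "v 1 div Suc (v 2)"]) (metis One_nat_def Suc_1 div_mult_mod_eq mod_less_divisor zero_less_Suc)
  qed (auto simp: numeral_2_eq_2 simp del: mult_Suc_right)
  ultimately show "sigma1 (\<lambda>f g v. v 0 = v (Suc 0) mod Suc (v (Suc 1)))" by simp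
qed

lemma rec_fun_seq: "rec_fun a \<Longrightarrow> rec_fun b \<Longrightarrow> rec_fun (\<lambda>f g v. seq (a f g v) (b f g v))"
  unfolding seq_def
  by (intro rec_fun_mod_Suc rec_rules rec_fun_pfst rec_fun_psnd)

text \<open>
  Chinese remainder theorem. The moduli \<open>1 + (i + 1) b\<close> are coprime if \<open>b\<close> is divisible by all numbers below \<open>n\<close>, and
  exceed all values if \<open>b\<close> does; a large factorial has both properties.
\<close>

lemma seq_ex: "\<exists>c. \<forall>i<n. seq c i = u i"
proof -
  \<comment> \<open>Large enough to exceed all values and, through the factorial, to be divisible by all differences of indices.\<close>
  define M where "M = Suc (n + (\<Sum>i<n. u i))"
  define b :: nat where "b = fact M"
  have cop: "coprime (Suc (Suc i * b)) (Suc (Suc j * b))" if "i < n" "j < n" "i \<noteq> j" for i j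
  proof -
    have main: "coprime (Suc (Suc i * b)) (Suc (Suc j * b))" if "i < j" "j < n" for i j
    proof (rule ccontr)
      assume "\<not> ?thesis"
      then obtain p where p: "prime p" "p dvd Suc (Suc i * b)" "p dvd Suc (Suc j * b)"
        using prime_factor_nat[of "gcd (Suc (Suc i * b)) (Suc (Suc j * b))"]
        by (auto simp: coprime_iff_gcd_eq_1)
      have "Suc (Suc j * b) - Suc (Suc i * b) = (j - i) * b"
        using that by (simp add: algebra_simps diff_mult_distrib)
      then have "p dvd (j - i) * b" using p by (metis dvd_diff_nat)
      moreover have "(j - i) dvd b" unfolding b_def
        by (rule dvd_fact) (use that in \<open>auto simp: M_def\<close>)
      ultimately have "p dvd b" using p(1) by (meson dvd_trans prime_dvd_mult_iff)
      then have "p dvd Suc i * b" by simp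
      then have "p dvd 1" using p(2) by (metis dvd_add_right_iff plus_1_eq_Suc add.commute)
      then show False using p(1) by auto
    qed
    show ?thesis using that main[of i j] main[of j i] by (cases "i < j") (auto simp: coprime_commute)
  qed
  obtain a where a: "\<forall>i\<in>{..<n}. [a = u i] (mod Suc (Suc i * b))"
    using chinese_remainder_nat[of "{..<n}" "\<lambda>i. Suc (Suc i * b)" u] cop by auto
  have "seq (pair a b) i = u i" if "i < n" for i
  proof -
    have "u i \<le> (\<Sum>i<n. u i)" using that by (intro member_le_sum) auto
    then have "u i \<le> M" by (simp add: M_def)
    also have "M \<le> b" unfolding b_def by (rule fact_ge_self)
    also have "b < Suc (Suc i * b)" by simp
    finally have "u i < Suc (Suc i * b)" .
    moreover have "[a = u i] (mod Suc (Suc i * b))" using a that by auto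
    ultimately show ?thesis unfolding seq_def by (simp add: cong_def del: mult_Suc mult_Suc_right)
  qed
  then show ?thesis by blast
qed

lemma delta1_ren: "delta1 P \<Longrightarrow> inj r \<Longrightarrow> delta1 (\<lambda>f g v. P f g (\<lambda>i. v (r i)))"
  using sigma1_ren[of P r] sigma1_ren[of "\<lambda>f g v. \<not> P f g v" r] unfolding delta1_def by blast

text \<open>
  Primitive recursion is definable: its course of values is one coded sequence.
\<close>

lemma recursion_seq:
  "y = (rec_nat a s t :: nat) \<longleftrightarrow>
    (\<exists>c. seq c 0 = a \<and> (\<forall>k<t. seq c (Suc k) = s k (seq c k)) \<and> y = seq c t)"
proof
  assume y: "y = rec_nat a s t"
  obtain c where c: "\<forall>i<Suc t. seq c i = rec_nat a s i" using seq_ex by blast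
  show "\<exists>c. seq c 0 = a \<and> (\<forall>k<t. seq c (Suc k) = s k (seq c k)) \<and> y = seq c t"
    using c y by (intro exI[of _ c]) auto
next
  assume "\<exists>c. seq c 0 = a \<and> (\<forall>k<t. seq c (Suc k) = s k (seq c k)) \<and> y = seq c t"
  then obtain c where c: "seq c 0 = a" "\<forall>k<t. seq c (Suc k) = s k (seq c k)" "y = seq c t" by blast
  have "k \<le> t \<Longrightarrow> seq c k = rec_nat a s k" for k using c by (induction k) auto
  then show "y = rec_nat a s t" using c by simp
qed

text \<open>
  Counting is the recursion behind every statement on density.
\<close>

lemma rec_fun_count:
  assumes P: "delta1 (\<lambda>f g v. P f g (\<lambda>i. v (Suc i)) (v 0))" and t: "rec_fun t"
  shows "rec_fun (\<lambda>f g v. card {x. x < t f g v \<and> P f g v x})"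
proof -
  have card_rec: "card {x. x < n \<and> Q x} = rec_nat 0 (\<lambda>k r. r + (if Q k then 1 else 0)) n" for n :: nat and Q
  proof (induction n)
    case (Suc n)
    have "{x. x < Suc n \<and> Q x} = (if Q n then insert n {x. x < n \<and> Q x} else {x. x < n \<and> Q x})"
      by (auto simp: less_Suc_eq)
    then show ?case using Suc by simp
  qed simp
  have P': "delta1 (\<lambda>f g v. P f g (\<lambda>i. v (Suc (Suc (Suc i)))) (v 0))"
    using delta1_ren[OF P inj_lift[of "\<lambda>i. Suc (Suc i)"]] by (simp add: inj_def)
  have t': "rec_fun (\<lambda>f g v. t f g (\<lambda>i. v (Suc (Suc i))))"
    using rec_fun_ren[OF t, of "\<lambda>i. Suc (Suc i)"] by (simp add: inj_def)
  show ?thesis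
    unfolding card_rec rec_fun_def recursion_seq
    by (intro sigma1_ex delta1_sigma1 delta1_rules rec_rules rec_fun_seq rec_fun_if P' t')
qed

lemma rec_fun_pow2: "rec_fun a \<Longrightarrow> rec_fun (\<lambda>f g v. 2 ^ a f g v)"
proof (rule rec_fun_subst1[of "\<lambda>f g s. 2 ^ s"])
  have pow: "(2::nat) ^ n = rec_nat 1 (\<lambda>k r. r + r) n" for n by (induction n) auto
  show "rec_fun (\<lambda>f g v. 2 ^ v 0)"
    unfolding rec_fun_def pow recursion_seq
    by (intro sigma1_ex delta1_sigma1 delta1_rules rec_rules rec_fun_seq)
qed

definition dis :: "(nat \<Rightarrow> nat) \<Rightarrow> (nat \<Rightarrow> nat) \<Rightarrow> nat \<Rightarrow> nat" where
  "dis u h l = card {x. x < l \<and> u x \<noteq> h x}"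

section \<open>Programs for bounded formulas\<close>

text \<open>
  Functions computed by one program for all oracles. A valuation is passed to a program as a list of fixed length, and
  a relation counts as decidable if it is the zero set of such a function. With \<open>0\<close> for truth, conjunction is a sum
  and disjunction a product, and \<open>Minimize\<close> searches for a witness directly.
\<close>

definition comp_fun :: "nat \<Rightarrow> ((nat \<Rightarrow> nat) \<Rightarrow> nat list \<Rightarrow> nat) \<Rightarrow> bool" where
  "comp_fun K F \<longleftrightarrow> (\<exists>p. \<forall>A xs. length xs = K \<longrightarrow> runs A p xs (F A xs))"

lemma comp_fun_zero: "comp_fun K (\<lambda>A xs. 0)"
  unfolding comp_fun_def using runs.zero by blast

lemma comp_fun_proj: "i < K \<Longrightarrow> comp_fun K (\<lambda>A xs. xs ! i)"
  unfolding comp_fun_def using runs.proj by blast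

lemma comp_fun_Suc: "comp_fun K F \<Longrightarrow> comp_fun K (\<lambda>A xs. Suc (F A xs))"
proof -
  assume "comp_fun K F"
  then obtain p where p: "\<And>A xs. length xs = K \<Longrightarrow> runs A p xs (F A xs)" unfolding comp_fun_def by blast
  have "runs A (Comp Succ [p]) xs (Suc (F A xs))" if "length xs = K" for A xs
    by (rule runs.comp[of "[F A xs]"]) (use p that in \<open>auto intro: runs.succ\<close>)
  then show ?thesis unfolding comp_fun_def by blast
qed

lemma comp_fun_query: "comp_fun K F \<Longrightarrow> comp_fun K (\<lambda>A xs. A (F A xs))"
proof -
  assume "comp_fun K F"
  then obtain p where p: "\<And>A xs. length xs = K \<Longrightarrow> runs A p xs (F A xs)" unfolding comp_fun_def by blast
  have "runs A (Comp Query [p]) xs (A (F A xs))" if "length xs = K" for A xs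
    by (rule runs.comp[of "[F A xs]"]) (use p that in \<open>auto intro: runs.query\<close>)
  then show ?thesis unfolding comp_fun_def by blast
qed

lemma comp_fun_const: "comp_fun K (\<lambda>A xs. n)"
  by (induction n) (rule comp_fun_zero, rule comp_fun_Suc)

lemma comp_fun_comp2:
  assumes "comp_fun 2 (\<lambda>A xs. h (xs ! 0) (xs ! 1))" "comp_fun K F" "comp_fun K G"
  shows "comp_fun K (\<lambda>A xs. h (F A xs) (G A xs))"
proof -
  obtain p where p: "\<And>A xs. length xs = 2 \<Longrightarrow> runs A p xs (h (xs ! 0) (xs ! 1))"
    using assms(1) unfolding comp_fun_def by blast
  obtain q where q: "\<And>A xs. length xs = K \<Longrightarrow> runs A q xs (F A xs)"
    using assms(2) unfolding comp_fun_def by blast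
  obtain r where r: "\<And>A xs. length xs = K \<Longrightarrow> runs A r xs (G A xs)"
    using assms(3) unfolding comp_fun_def by blast
  have "runs A (Comp p [q, r]) xs (h (F A xs) (G A xs))" if "length xs = K" for A xs
    by (rule runs.comp[of "[F A xs, G A xs]"])
      (use p[of "[F A xs, G A xs]" A] q r that in \<open>auto simp: less_Suc_eq\<close>)
  then show ?thesis unfolding comp_fun_def by blast
qed

lemma comp_fun_rec:
  assumes "comp_fun 1 (\<lambda>A xs. a (xs ! 0))" "comp_fun 3 (\<lambda>A xs. s (xs ! 0) (xs ! 1) (xs ! 2))"
  shows "comp_fun 2 (\<lambda>A xs. rec_nat (a (xs ! 1)) (\<lambda>n r. s n r (xs ! 1)) (xs ! 0))"
proof -
  obtain p where p: "\<And>A xs. length xs = 1 \<Longrightarrow> runs A p xs (a (xs ! 0))"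
    using assms(1) unfolding comp_fun_def by blast
  obtain q where q: "\<And>A xs. length xs = 3 \<Longrightarrow> runs A q xs (s (xs ! 0) (xs ! 1) (xs ! 2))"
    using assms(2) unfolding comp_fun_def by blast
  have "runs A (PrimRec p q) [n, x] (rec_nat (a x) (\<lambda>n r. s n r x) n)" for A n x
  proof (induction n)
    case 0
    then show ?case using p[of "[x]" A] by (auto intro: runs.primrec_0)
  next
    case (Suc n)
    from runs.primrec_Suc[OF this] show ?case
      using q[of "[n, rec_nat (a x) (\<lambda>n r. s n r x) n, x]" A] by simp
  qed
  moreover have "xs = [xs ! 0, xs ! 1]" if "length xs = 2" for xs :: "nat list"
    using that by (auto simp: numeral_2_eq_2 length_Suc_conv)
  ultimately show ?thesis unfolding comp_fun_def by metis
qed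

lemma comp_fun_plus: "comp_fun K F \<Longrightarrow> comp_fun K G \<Longrightarrow> comp_fun K (\<lambda>A xs. F A xs + G A xs)"
proof (rule comp_fun_comp2[of "(+)"])
  have "rec_nat x (\<lambda>n r. Suc r) n = n + x" for n x :: nat by (induction n) auto
  then show "comp_fun 2 (\<lambda>A xs. xs ! 0 + xs ! 1)"
    using comp_fun_rec[of "\<lambda>x. x" "\<lambda>n r x. Suc r"] comp_fun_proj[of 0 1] comp_fun_Suc[OF comp_fun_proj[of 1 3]]
    by simp
qed

lemma comp_fun_times: "comp_fun K F \<Longrightarrow> comp_fun K G \<Longrightarrow> comp_fun K (\<lambda>A xs. F A xs * G A xs)"
proof (rule comp_fun_comp2[of "(*)"])
  have "rec_nat 0 (\<lambda>n r. r + x) n = n * x" for n x :: nat by (induction n) auto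
  then show "comp_fun 2 (\<lambda>A xs. xs ! 0 * xs ! 1)"
    using comp_fun_rec[of "\<lambda>x. 0" "\<lambda>n r x. r + x"] comp_fun_zero[of 1]
      comp_fun_plus[OF comp_fun_proj[of 1 3] comp_fun_proj[of 2 3]]
    by simp
qed

lemma comp_fun_diff: "comp_fun K F \<Longrightarrow> comp_fun K G \<Longrightarrow> comp_fun K (\<lambda>A xs. F A xs - G A xs)"
proof -
  have "rec_nat 0 (\<lambda>n r. n) n = n - 1" for n :: nat by (cases n) auto
  then have pred2: "comp_fun 2 (\<lambda>A xs. xs ! 0 - 1)"
    using comp_fun_rec[of "\<lambda>x. 0" "\<lambda>n r x. n"] comp_fun_zero[of 1] comp_fun_proj[of 0 3]
    by simp
  have pred: "comp_fun K (\<lambda>A xs. F A xs - 1)" if "comp_fun K F" for K F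
    using comp_fun_comp2[of "\<lambda>x y. x - 1", OF pred2 that that] .
  have "rec_nat x (\<lambda>n r. r - 1) n = x - n" for n x :: nat by (induction n) auto
  then have "comp_fun 2 (\<lambda>A xs. xs ! 1 - xs ! 0)"
    using comp_fun_rec[of "\<lambda>x. x" "\<lambda>n r x. r - 1"] comp_fun_proj[of 0 1] pred[OF comp_fun_proj[of 1 3]]
    by simp
  from comp_fun_comp2[of "\<lambda>x y. y - x", OF this]
  show "comp_fun K F \<Longrightarrow> comp_fun K G \<Longrightarrow> comp_fun K (\<lambda>A xs. F A xs - G A xs)" by blast
qed

definition decidable :: "nat \<Rightarrow> ((nat \<Rightarrow> nat) \<Rightarrow> nat list \<Rightarrow> bool) \<Rightarrow> bool" where
  "decidable K P \<longleftrightarrow> (\<exists>F. comp_fun K F \<and> (\<forall>A xs. length xs = K \<longrightarrow> (F A xs = 0 \<longleftrightarrow> P A xs)))"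

lemma decidable_not: "decidable K P \<Longrightarrow> decidable K (\<lambda>A xs. \<not> P A xs)"
proof -
  assume "decidable K P"
  then obtain F where "comp_fun K F" "\<forall>A xs. length xs = K \<longrightarrow> (F A xs = 0 \<longleftrightarrow> P A xs)"
    unfolding decidable_def by blast
  moreover have "1 - n = 0 \<longleftrightarrow> n \<noteq> 0" for n :: nat by auto
  ultimately show ?thesis unfolding decidable_def
    by (intro exI[of _ "\<lambda>A xs. 1 - F A xs"])
      (simp add: comp_fun_diff comp_fun_const del: diff_is_0_eq diff_is_0_eq' neq0_conv)
qed

lemma decidable_conj_disj:
  assumes "decidable K P" "decidable K Q"
  shows "decidable K (\<lambda>A xs. P A xs \<and> Q A xs)" "decidable K (\<lambda>A xs. P A xs \<or> Q A xs)"
proof -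
  obtain F where F: "comp_fun K F" "\<forall>A xs. length xs = K \<longrightarrow> (F A xs = 0 \<longleftrightarrow> P A xs)"
    using assms(1) unfolding decidable_def by blast
  obtain G where G: "comp_fun K G" "\<forall>A xs. length xs = K \<longrightarrow> (G A xs = 0 \<longleftrightarrow> Q A xs)"
    using assms(2) unfolding decidable_def by blast
  show "decidable K (\<lambda>A xs. P A xs \<and> Q A xs)" unfolding decidable_def
    using F G by (intro exI[of _ "\<lambda>A xs. F A xs + G A xs"]) (auto intro!: comp_fun_plus)
  show "decidable K (\<lambda>A xs. P A xs \<or> Q A xs)" unfolding decidable_def
    using F G by (intro exI[of _ "\<lambda>A xs. F A xs * G A xs"]) (auto intro!: comp_fun_times)
qed

lemma decidable_less: "comp_fun K F \<Longrightarrow> comp_fun K G \<Longrightarrow> decidable K (\<lambda>A xs. F A xs < G A xs)"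
  unfolding decidable_def
  by (intro exI[of _ "\<lambda>A xs. Suc (F A xs) - G A xs"]) (auto intro!: comp_fun_diff comp_fun_Suc)

lemma decidable_eq: "comp_fun K F \<Longrightarrow> comp_fun K G \<Longrightarrow> decidable K (\<lambda>A xs. F A xs = G A xs)"
  unfolding decidable_def
  by (intro exI[of _ "\<lambda>A xs. (F A xs - G A xs) + (G A xs - F A xs)"])
     (auto intro!: comp_fun_diff comp_fun_plus)

lemma search_program:
  assumes "decidable (Suc K) P"
  shows "\<exists>p. \<forall>A xs. length xs = K \<longrightarrow> (\<exists>n. P A (n # xs)) \<longrightarrow> runs A p xs (LEAST n. P A (n # xs))"
proof -
  obtain F where F: "comp_fun (Suc K) F" "\<And>A xs. length xs = Suc K \<Longrightarrow> (F A xs = 0 \<longleftrightarrow> P A xs)"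
    using assms unfolding decidable_def by blast
  obtain p where p: "\<And>A xs. length xs = Suc K \<Longrightarrow> runs A p xs (F A xs)"
    using F(1) unfolding comp_fun_def by blast
  have "runs A (Minimize p) xs (LEAST n. P A (n # xs))" if xs: "length xs = K" "\<exists>n. P A (n # xs)" for A xs
  proof (rule runs.minimize)
    have "P A ((LEAST n. P A (n # xs)) # xs)" using xs(2) by (rule LeastI_ex)
    then show "runs A p ((LEAST n. P A (n # xs)) # xs) 0"
      using F(2)[of "(LEAST n. P A (n # xs)) # xs" A] p[of "(LEAST n. P A (n # xs)) # xs" A] xs(1) by simp
    show "\<forall>m<LEAST n. P A (n # xs). \<exists>k. runs A p (m # xs) (Suc k)"
    proof (intro allI impI)
      fix m assume "m < (LEAST n. P A (n # xs))"
      then have "\<not> P A (m # xs)" by (rule not_less_Least)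
      then have "F A (m # xs) \<noteq> 0" using F(2)[of "m # xs" A] xs(1) by simp
      then show "\<exists>k. runs A p (m # xs) (Suc k)"
        using p[of "m # xs" A] xs(1) by (metis length_Cons not0_implies_Suc)
    qed
  qed
  then show ?thesis by blast
qed

lemma comp_fun_tl:
  assumes "comp_fun K F"
  shows "comp_fun (Suc K) (\<lambda>A xs. F A (tl xs))"
proof -
  obtain p where p: "\<And>A xs. length xs = K \<Longrightarrow> runs A p xs (F A xs)"
    using assms unfolding comp_fun_def by blast
  have "runs A (Comp p (map (\<lambda>i. Proj (Suc i)) [0..<K])) xs (F A (tl xs))" if "length xs = Suc K" for A xs
    by (rule runs.comp[of "tl xs"]) (use that p[of "tl xs" A] in \<open>auto simp: nth_tl intro!: runs.proj\<close>)
  then show ?thesis unfolding comp_fun_def by blast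
qed

text \<open>
  The least \<open>n\<close> that satisfies \<open>P\<close> or reaches the bound is found by a search that always ends, and it stays below the
  bound iff a witness exists.
\<close>

lemma decidable_bex:
  assumes P: "decidable (Suc K) P" and F: "comp_fun K F"
  shows "decidable K (\<lambda>A xs. \<exists>n<F A xs. P A (n # xs))"
proof -
  define Q where "Q A xs \<longleftrightarrow> \<not> xs ! 0 < F A (tl xs) \<or> P A xs" for A xs
  have "decidable (Suc K) Q" unfolding Q_def
    by (intro decidable_conj_disj decidable_not decidable_less comp_fun_proj comp_fun_tl F P) simp
  from search_program[OF this] obtain p where
    p: "\<And>A xs. length xs = K \<Longrightarrow> (\<exists>n. Q A (n # xs)) \<Longrightarrow> runs A p xs (LEAST n. Q A (n # xs))" by blast
  have ex: "Q A (F A xs # xs)" for A xs by (simp add: Q_def)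
  have "comp_fun K (\<lambda>A xs. LEAST n. Q A (n # xs))" unfolding comp_fun_def using p ex by blast
  from decidable_less[OF this F]
  have "decidable K (\<lambda>A xs. (LEAST n. Q A (n # xs)) < F A xs)" .
  moreover have "(LEAST n. Q A (n # xs)) < F A xs \<longleftrightarrow> (\<exists>n<F A xs. P A (n # xs))" for A xs
  proof
    assume "(LEAST n. Q A (n # xs)) < F A xs"
    moreover have "Q A ((LEAST n. Q A (n # xs)) # xs)" using ex by (rule LeastI)
    ultimately show "\<exists>n<F A xs. P A (n # xs)" unfolding Q_def by auto
  next
    assume "\<exists>n<F A xs. P A (n # xs)"
    then obtain n where "n < F A xs" "Q A (n # xs)" unfolding Q_def by auto
    then show "(LEAST n. Q A (n # xs)) < F A xs" by (meson Least_le le_less_trans)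
  qed
  ultimately show ?thesis by simp
qed

lemma comp_fun_term:
  assumes "\<And>i. r i < K"
  shows "comp_fun K (\<lambda>A xs. tm_val A A (\<lambda>i. xs ! r i) t)"
  using assms
  by (induction t) (auto intro!: comp_fun_proj comp_fun_zero comp_fun_Suc comp_fun_plus comp_fun_times comp_fun_query)

text \<open>
  The renaming \<open>r\<close> says at which position of the list the value of a variable is found. A quantifier puts its variable in
  front of the list, whatever its name is.
\<close>

lemma decidable_bounded_fm:
  assumes "bounded_fm \<phi>" "\<And>i. r i < K"
  shows "decidable K (\<lambda>A xs. sat A A (\<lambda>i. xs ! r i) \<phi>)"
  using assms
proof (induction \<phi> arbitrary: K r)
  case (BExists x t \<phi>)
  have upd: "(\<lambda>i. (n # xs) ! (if i = x then 0 else Suc (r i))) = (\<lambda>i. xs ! r i)(x := n)" for n xs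
    by auto
  have "decidable (Suc K) (\<lambda>A xs. sat A A (\<lambda>i. xs ! (if i = x then 0 else Suc (r i))) \<phi>)"
    by (rule BExists.IH) (use BExists.prems in auto)
  from decidable_bex[OF this comp_fun_term[where t = t, OF BExists.prems(2)]]
  show ?case unfolding upd by simp
next
  case (BForall x t \<phi>)
  have upd: "(\<lambda>i. (n # xs) ! (if i = x then 0 else Suc (r i))) = (\<lambda>i. xs ! r i)(x := n)" for n xs
    by auto
  have "decidable (Suc K) (\<lambda>A xs. \<not> sat A A (\<lambda>i. xs ! (if i = x then 0 else Suc (r i))) \<phi>)"
    by (rule decidable_not, rule BForall.IH) (use BForall.prems in auto)
  from decidable_not[OF decidable_bex[OF this comp_fun_term[where t = t, OF BForall.prems(2)]]]
  show ?case unfolding upd by simp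
qed (auto intro!: decidable_eq decidable_less decidable_not decidable_conj_disj comp_fun_term)

lemma decidable_delta0:
  assumes "delta0 R"
  shows "decidable (Suc K) (\<lambda>A xs. R A A (\<lambda>i. xs ! min i K))"
proof -
  obtain \<phi> where "bounded_fm \<phi>" and \<phi>: "\<And>f g v. sat f g v \<phi> \<longleftrightarrow> R f g v"
    using assms unfolding delta0_def by auto
  then show ?thesis using decidable_bounded_fm[of \<phi> "\<lambda>i. min i K" "Suc K"] by (simp add: \<phi>)
qed

text \<open>
  A value is not simply the first component of the first witness, because decoding pairs would have to be programmed.
  Instead one first searches for a bound below which some value and some witness of it exist, and then for the least
  value that has a witness below this bound. Both searches are for bounded formulas. The parameters \<open>e\<close> and \<open>c\<close>
  enter the program as constants.
\<close>

lemma sigma1_uniformization: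
  assumes "sigma1 P"
  shows "\<exists>p. \<forall>A. (\<forall>x. \<exists>y. P A A (\<lambda>i. [y, x, e, c] ! min i 3)) \<longrightarrow>
    (\<exists>h. computes_via p A h \<and> (\<forall>x. P A A (\<lambda>i. [h x, x, e, c] ! min i 3)))"
proof -
  obtain Q where Q: "delta0_matrix Q" "\<forall>f g v. P f g v \<longleftrightarrow> (\<exists>m. Q f g v m)"
    using sigma1E[OF assms] by blast
  note Q1 = Q(1)[unfolded delta0_matrix_def]
  have dB: "delta0 (\<lambda>f g v. \<exists>y<v 0. \<exists>m<v 0. Q f g (case_nat y (\<lambda>i. v (Suc i))) m)"
    using delta0_matrix_skip[OF Q(1)] by (auto intro!: delta0_ex term_fun_intros)
  have dC: "delta0 (\<lambda>f g v. \<exists>m<v 1. Q f g (case_nat (v 0) (\<lambda>i. v (Suc (Suc i)))) m)"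
    using delta0_matrix_skip[OF Q(1)] by (auto intro!: delta0_ex term_fun_intros)
  define env where "env y x = (\<lambda>i. [y, x, e, c] ! min i 3)" for y x
  have env1: "case_nat y (\<lambda>i. [b, x, e, c] ! min (Suc i) 3) = env y x" for b x y
  proof
    fix i consider "i = 0" | "i = 1" | "i = 2" | j where "i = Suc (Suc (Suc j))"
      by (metis One_nat_def Suc_1 old.nat.exhaust)
    then show "case_nat y (\<lambda>i. [b, x, e, c] ! min (Suc i) 3) i = env y x i"
      by cases (simp_all add: env_def)
  qed
  have env2: "case_nat y (\<lambda>i. [y, b, x, e, c] ! min (Suc (Suc i)) 4) = env y x" for b x y
  proof
    fix i consider "i = 0" | "i = 1" | "i = 2" | j where "i = Suc (Suc (Suc j))"
      by (metis One_nat_def Suc_1 old.nat.exhaust)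
    then show "case_nat y (\<lambda>i. [y, b, x, e, c] ! min (Suc (Suc i)) 4) i = env y x i"
      by cases (simp_all add: env_def)
  qed
  have B: "decidable (Suc 3) (\<lambda>A xs. \<exists>y<xs ! 0. \<exists>m<xs ! 0. Q A A (case_nat y (\<lambda>i. xs ! min (Suc i) 3)) m)"
    using decidable_delta0[OF dB, of 3] by (simp only: min_0L)
  have C: "decidable (Suc 4) (\<lambda>A xs. \<exists>m<xs ! 1. Q A A (case_nat (xs ! 0) (\<lambda>i. xs ! min (Suc (Suc i)) 4)) m)"
    using decidable_delta0[OF dC, of 4] by simp
  define b where "b A x = (LEAST b. \<exists>y<b. \<exists>m<b. Q A A (env y x) m)" for A x
  obtain pB where pB: "\<And>A x. \<exists>b. \<exists>y<b. \<exists>m<b. Q A A (env y x) m \<Longrightarrow> runs A pB [x, e, c] (b A x)"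
  proof -
    from search_program[OF B] obtain p where p: "\<And>A xs. length xs = 3 \<Longrightarrow>
      (\<exists>n. \<exists>y<n. \<exists>m<n. Q A A (case_nat y (\<lambda>i. (n # xs) ! min (Suc i) 3)) m) \<Longrightarrow>
      runs A p xs (LEAST n. \<exists>y<n. \<exists>m<n. Q A A (case_nat y (\<lambda>i. (n # xs) ! min (Suc i) 3)) m)"
      by (auto simp only: nth_Cons_0)
    show thesis
      by (rule that[of p]) (use p[of "[x, e, c]" A for A x, unfolded env1] in \<open>simp add: b_def\<close>)
  qed
  obtain pC where pC: "\<And>A b x. \<exists>y. \<exists>m<b. Q A A (env y x) m \<Longrightarrow>
    runs A pC [b, x, e, c] (LEAST y. \<exists>m<b. Q A A (env y x) m)"
  proof -
    from search_program[OF C] obtain p where p: "\<And>A xs. length xs = 4 \<Longrightarrow>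
      (\<exists>n. \<exists>m<(n # xs) ! 1. Q A A (case_nat n (\<lambda>i. (n # xs) ! min (Suc (Suc i)) 4)) m) \<Longrightarrow>
      runs A p xs (LEAST n. \<exists>m<(n # xs) ! 1. Q A A (case_nat n (\<lambda>i. (n # xs) ! min (Suc (Suc i)) 4)) m)"
      by (auto simp only: nth_Cons_0)
    show thesis
      by (rule that[of p]) (use p[of "[b, x, e, c]" A for A x b, unfolded env2] in simp)
  qed
  obtain E where E: "\<And>A xs. length xs = 1 \<Longrightarrow> runs A E xs e"
    using comp_fun_const[of 1 e] unfolding comp_fun_def by blast
  obtain D where D: "\<And>A xs. length xs = 1 \<Longrightarrow> runs A D xs c"
    using comp_fun_const[of 1 c] unfolding comp_fun_def by blast
  have x: "runs A (Proj 0) [x] x" for A x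
    using runs.proj[of 0 "[x]" A] by simp
  \<comment> \<open>\<open>pB\<close> finds the bound, which \<open>pC\<close> then takes as its first argument.\<close>
  let ?p = "Comp pC [Comp pB [Proj 0, E, D], Proj 0, E, D]"
  have "\<exists>h. computes_via ?p A h \<and> (\<forall>x. P A A (env (h x) x))" if tot: "\<forall>x. \<exists>y. P A A (env y x)" for A
  proof -
    define h where "h x = (LEAST y. \<exists>m<b A x. Q A A (env y x) m)" for x
    have main: "runs A ?p [x] (h x) \<and> P A A (env (h x) x)" for x
    proof -
      obtain y m where "Q A A (env y x) m" using tot Q(2) by blast
      then have ex: "\<exists>b. \<exists>y<b. \<exists>m<b. Q A A (env y x) m"
        by (rule_tac exI[of _ "Suc (max y m)"]) (metis less_Suc_eq_le max.cobounded1 max.cobounded2)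
      then have "\<exists>y<b A x. \<exists>m<b A x. Q A A (env y x) m"
        unfolding b_def by (rule LeastI_ex)
      then have ex2: "\<exists>y. \<exists>m<b A x. Q A A (env y x) m" by blast
      then have "\<exists>m<b A x. Q A A (env (h x) x) m" unfolding h_def by (rule LeastI_ex)
      then have "P A A (env (h x) x)" using Q(2) by blast
      moreover have "runs A (Comp pB [Proj 0, E, D]) [x] (b A x)"
        by (rule runs.comp[of "[x, e, c]"]) (use pB[OF ex] E[of "[x]" A] D[of "[x]" A] x in \<open>auto simp: less_Suc_eq\<close>)
      then have "runs A ?p [x] (h x)"
        by (intro runs.comp[of "[b A x, x, e, c]"])
          (use pC[OF ex2] E[of "[x]" A] D[of "[x]" A] x in \<open>auto simp: less_Suc_eq h_def\<close>)
      ultimately show ?thesis by blast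
    qed
    then show ?thesis unfolding computes_via_def by blast
  qed
  then show ?thesis unfolding env_def by blast
qed

section \<open>A universal Sigma-1 relation for computations\<close>

definition cons_code :: "nat \<Rightarrow> nat \<Rightarrow> nat" where "cons_code x xs = Suc (pair x xs)"

lemma cons_code_simps [simp]:
  "cons_code x xs \<noteq> 0" "0 \<noteq> cons_code x xs"
  "cons_code x xs = cons_code y ys \<longleftrightarrow> x = y \<and> xs = ys"
  by (auto simp: cons_code_def)

lemma list_encode_code: "list_encode [] = 0" "list_encode (x # xs) = cons_code x (list_encode xs)"
  by (auto simp: cons_code_def pair_def)

declare list_encode.simps [simp del] list_encode_code [simp]

lemma list_encode_eq_iff [simp]:
  "list_encode xs = 0 \<longleftrightarrow> xs = []"
  "list_encode xs = cons_code x l \<longleftrightarrow> (\<exists>r. xs = x # r \<and> l = list_encode r)"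
proof -
  show "list_encode xs = 0 \<longleftrightarrow> xs = []" by (cases xs) simp_all
  show "list_encode xs = cons_code x l \<longleftrightarrow> (\<exists>r. xs = x # r \<and> l = list_encode r)"
  proof (cases xs)
    case (Cons a r)
    show ?thesis unfolding Cons list_encode_code cons_code_simps by auto
  qed (simp add: cons_code_def)
qed

text \<open>
  The tags \<open>7\<close> and \<open>8\<close> are reserved for two auxiliary judgements on codes: \<open>pair 7 q\<close> evaluates a list of programs to the
  list of their values, and \<open>pair 8 p\<close>, applied to \<open>n # xs\<close>, yields \<open>0\<close> if \<open>p\<close> has a positive value at all \<open>m # xs\<close>
  with \<open>m < n\<close>. They split the rules for composition and minimization, which have unboundedly many premises,
  into rules with at most two.
\<close>

primrec prog_code :: "prog \<Rightarrow> nat" where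
  "prog_code Zero = pair 0 0"
| "prog_code Succ = pair 1 0"
| "prog_code (Proj i) = pair 2 i"
| "prog_code Query = pair 3 0"
| "prog_code (Comp p qs) = pair 4 (pair (prog_code p) (list_encode (map prog_code qs)))"
| "prog_code (PrimRec p q) = pair 5 (pair (prog_code p) (prog_code q))"
| "prog_code (Minimize p) = pair 6 (prog_code p)"

lemma prog_code_inj: "prog_code p = prog_code q \<Longrightarrow> p = q"
proof (induction p arbitrary: q)
  case (Comp p qs)
  from Comp.prems obtain p' qs' where q: "q = Comp p' qs'" by (cases q) auto
  have "map prog_code qs = map prog_code qs'"
    using Comp.prems by (simp add: q list_encode_eq)
  then have "qs = qs'" using Comp.IH(2)
    by (metis (no_types, lifting) list.inj_map_strong)
  then show ?case using Comp.prems Comp.IH(1) q by simp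
next
  case Zero then show ?case by (cases q) auto
next
  case Succ then show ?case by (cases q) auto
next
  case (Proj i) then show ?case by (cases q) auto
next
  case Query then show ?case by (cases q) auto
next
  case (PrimRec p1 p2) from PrimRec.prems PrimRec.IH show ?case by (cases q) auto
next
  case (Minimize p) from Minimize.prems Minimize.IH show ?case by (cases q) auto
qed

text \<open>
  The judgement that code \<open>e\<close> maps the list code \<open>xs\<close> to \<open>y\<close> follows from judgements in \<open>F\<close> by one evaluation rule.
  The oracle \<open>Q\<close> is a relation, so that it may be a finite string. All quantifiers are bounded by \<open>B\<close>, which keeps
  the notion decidable.
\<close>

definition justified ::
  "nat \<Rightarrow> (nat \<Rightarrow> nat \<Rightarrow> nat \<Rightarrow> bool) \<Rightarrow> (nat \<Rightarrow> nat \<Rightarrow> bool) \<Rightarrow> nat \<Rightarrow> nat \<Rightarrow> nat \<Rightarrow> bool" where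
  "justified B F Q e xs y \<longleftrightarrow>
     e = pair 0 0 \<and> y = 0 \<or>
     e = pair 1 0 \<and> (\<exists>x<B. xs = cons_code x 0 \<and> y = Suc x) \<or>
     (\<exists>i<B. \<exists>x<B. \<exists>r<B. e = pair 2 i \<and> xs = cons_code x r \<and>
       (i = 0 \<and> y = x \<or> (\<exists>j<B. i = Suc j \<and> F (pair 2 j) r y))) \<or>
     e = pair 3 0 \<and> (\<exists>x<B. xs = cons_code x 0 \<and> Q x y) \<or>
     (\<exists>p<B. \<exists>q<B. \<exists>ys<B. e = pair 4 (pair p q) \<and> F (pair 7 q) xs ys \<and> F p ys y) \<or>
     (\<exists>p<B. \<exists>q<B. \<exists>n<B. \<exists>r<B. e = pair 5 (pair p q) \<and> xs = cons_code n r \<and>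
       (n = 0 \<and> F p r y \<or>
        (\<exists>m<B. \<exists>k<B. n = Suc m \<and> F e (cons_code m r) k \<and> F q (cons_code m (cons_code k r)) y))) \<or>
     (\<exists>p<B. e = pair 6 p \<and> F p (cons_code y xs) 0 \<and> F (pair 8 p) (cons_code y xs) 0) \<or>
     (\<exists>q<B. e = pair 7 q \<and> (q = 0 \<and> y = 0 \<or>
        (\<exists>p<B. \<exists>r<B. \<exists>a<B. \<exists>b<B. q = cons_code p r \<and> y = cons_code a b \<and> F p xs a \<and> F (pair 7 r) xs b))) \<or>
     (\<exists>p<B. \<exists>n<B. \<exists>r<B. e = pair 8 p \<and> xs = cons_code n r \<and> y = 0 \<and> (n = 0 \<or>
        (\<exists>m<B. \<exists>k<B. n = Suc m \<and> F p (cons_code m r) (Suc k) \<and> F (pair 8 p) (cons_code m r) 0)))"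

lemma justified_mono:
  assumes "justified B F Q e xs y" "B \<le> B'" "\<And>e xs y. F e xs y \<Longrightarrow> F' e xs y"
    "\<And>x y. Q x y \<Longrightarrow> Q' x y"
  shows "justified B' F' Q' e xs y"
proof -
  have B: "\<And>x. x < B \<Longrightarrow> x < B'" using assms(2) by simp
  show ?thesis using assms(1) unfolding justified_def
    by - (elim disj_forward conj_forward ex_forward, (assumption | erule B | erule assms(3) | erule assms(4))+)
qed

text \<open>
  A finite set of judgements, each justified by others of the set. Such a set cannot support itself circularly, because
  in every rule the premises have a simpler program or, in the recursive rules, a smaller first argument. So a run
  of a program can be replaced by an unordered set.
\<close>

definition closed :: "nat \<Rightarrow> (nat \<Rightarrow> nat \<Rightarrow> nat \<Rightarrow> bool) \<Rightarrow> (nat \<Rightarrow> nat \<Rightarrow> bool) \<Rightarrow> bool" where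
  "closed B F Q \<longleftrightarrow> (\<forall>e xs y. F e xs y \<longrightarrow> pair e (pair xs y) < B \<and> justified B F Q e xs y)"

definition derivable :: "(nat \<Rightarrow> nat \<Rightarrow> bool) \<Rightarrow> nat \<Rightarrow> nat \<Rightarrow> nat \<Rightarrow> bool" where
  "derivable Q e xs y \<longleftrightarrow> (\<exists>B F. closed B F Q \<and> F e xs y)"

lemma derivable_mono:
  assumes "derivable Q e xs y" "\<And>x y. Q x y \<Longrightarrow> Q' x y"
  shows "derivable Q' e xs y"
proof -
  obtain B F where "closed B F Q" "F e xs y" using assms(1) unfolding derivable_def by auto
  moreover have "closed B F Q'" unfolding closed_def
  proof (intro allI impI conjI)
    fix e xs y assume F: "F e xs y"
    show "pair e (pair xs y) < B" using \<open>closed B F Q\<close> F unfolding closed_def by blast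
    have "justified B F Q e xs y" using \<open>closed B F Q\<close> F unfolding closed_def by blast
    then show "justified B F Q' e xs y"
      by (rule justified_mono[OF _ order_refl]) (assumption | rule assms(2))+
  qed
  ultimately show ?thesis unfolding derivable_def by (intro exI conjI)
qed

text \<open>
  A finite set of judgements queries the oracle below its bound only.
\<close>

lemma derivable_finite_use:
  assumes "derivable Q e xs y"
  shows "\<exists>n. derivable (\<lambda>x y. x < n \<and> Q x y) e xs y"
proof -
  obtain B F where BF: "closed B F Q" "F e xs y" using assms(1) unfolding derivable_def by auto
  have "closed B F (\<lambda>x y. x < B \<and> Q x y)" unfolding closed_def
  proof (intro allI impI conjI)
    fix e xs y assume F: "F e xs y"
    show "pair e (pair xs y) < B" using BF(1) F unfolding closed_def by blast
    have "justified B F Q e xs y" using BF(1) F unfolding closed_def by blast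
    moreover have eq: "(\<exists>x<B. xs = cons_code x 0 \<and> Q x y) =
        (\<exists>x<B. xs = cons_code x 0 \<and> x < B \<and> Q x y)" by blast
    ultimately show "justified B F (\<lambda>x y. x < B \<and> Q x y) e xs y"
      unfolding justified_def by (subst (asm) eq)
  qed
  then show ?thesis using BF(2) unfolding derivable_def by (intro exI conjI)
qed

text \<open>
  The union of closed sets for the premises, together with the conclusion, is closed. The finite set \<open>G\<close> of premises
  is chosen anew for each rule.
\<close>

lemma derivableI:
  assumes just: "justified B0 (\<lambda>e xs y. (e, xs, y) \<in> G) Q e xs y" and G: "finite G"
    and der: "\<And>e xs y. (e, xs, y) \<in> G \<Longrightarrow> derivable Q e xs y"
  shows "derivable Q e xs y"
proof -
  have "\<forall>t\<in>G. \<exists>B F. closed B F Q \<and> F (fst t) (fst (snd t)) (snd (snd t))"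
    using der unfolding derivable_def by force
  then obtain B F where BF: "\<And>t. t \<in> G \<Longrightarrow> closed (B t) (F t) Q"
    "\<And>t. t \<in> G \<Longrightarrow> F t (fst t) (fst (snd t)) (snd (snd t))" by metis
  define B' where "B' = B0 + Suc (pair e (pair xs y)) + (\<Sum>t\<in>G. B t)"
  define F' where "F' a b c \<longleftrightarrow> (a, b, c) = (e, xs, y) \<or> (\<exists>t\<in>G. F t a b c)" for a b c
  have le: "B t \<le> B'" if "t \<in> G" for t
    using member_le_sum[of t G B] that G by (simp add: B'_def)
  have "pair a (pair b c) < B' \<and> justified B' F' Q a b c" if "F' a b c" for a b c
  proof -
    consider "a = e" "b = xs" "c = y" | t where "t \<in> G" "F t a b c" using \<open>F' a b c\<close> unfolding F'_def by blast
    then show ?thesis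
    proof cases
      case 1
      have "(e, xs, y) \<in> G \<Longrightarrow> F' e xs y" for e xs y using BF(2)[of "(e, xs, y)"] unfolding F'_def by auto
      then have "justified B' F' Q e xs y"
        by (intro justified_mono[OF just]) (auto simp: B'_def)
      then show ?thesis using 1 by (simp add: B'_def)
    next
      case 2
      then have "pair a (pair b c) < B t" "justified (B t) (F t) Q a b c"
        using BF(1) unfolding closed_def by blast+
      moreover have "justified B' F' Q a b c"
        by (rule justified_mono[OF \<open>justified (B t) (F t) Q a b c\<close> le[OF 2(1)]]) (use 2(1) in \<open>auto simp: F'_def\<close>)
      ultimately show ?thesis using le[OF 2(1)] by simp
    qed
  qed
  then have "closed B' F' Q" unfolding closed_def by blast
  moreover have "F' e xs y" by (simp add: F'_def)
  ultimately show ?thesis unfolding derivable_def by (intro exI conjI)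
qed

text \<open>
  The rules with an intermediate value that does not occur in the conclusion.
\<close>

lemma justified_intermediate:
  "p < B \<Longrightarrow> q < B \<Longrightarrow> ys < B \<Longrightarrow> F (pair 7 q) xs ys \<Longrightarrow> F p ys y \<Longrightarrow>
    justified B F Q (pair 4 (pair p q)) xs y"
  "p < B \<Longrightarrow> q < B \<Longrightarrow> Suc m < B \<Longrightarrow> r < B \<Longrightarrow> k < B \<Longrightarrow> F (pair 5 (pair p q)) (cons_code m r) k \<Longrightarrow>
    F q (cons_code m (cons_code k r)) y \<Longrightarrow> justified B F Q (pair 5 (pair p q)) (cons_code (Suc m) r) y"
  "p < B \<Longrightarrow> Suc m < B \<Longrightarrow> r < B \<Longrightarrow> k < B \<Longrightarrow> F p (cons_code m r) (Suc k) \<Longrightarrow>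
    F (pair 8 p) (cons_code m r) 0 \<Longrightarrow> justified B F Q (pair 8 p) (cons_code (Suc m) r) 0"
  subgoal by (auto simp: justified_def)
  subgoal by (simp add: justified_def, rule exI[of _ m], simp, rule exI[of _ k], simp)
  subgoal by (simp add: justified_def, rule exI[of _ m], simp, rule exI[of _ k], simp)
  done

lemma derivable_rules:
  "derivable Q (pair 0 0) xs 0"
  "derivable Q (pair 1 0) (cons_code x 0) (Suc x)"
  "derivable Q (pair 2 0) (cons_code x r) x"
  "derivable Q (pair 2 j) r y \<Longrightarrow> derivable Q (pair 2 (Suc j)) (cons_code x r) y"
  "Q x y \<Longrightarrow> derivable Q (pair 3 0) (cons_code x 0) y"
  "derivable Q (pair 7 q) xs ys \<Longrightarrow> derivable Q p ys y \<Longrightarrow> derivable Q (pair 4 (pair p q)) xs y"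
  "derivable Q p r y \<Longrightarrow> derivable Q (pair 5 (pair p q)) (cons_code 0 r) y"
  "derivable Q (pair 5 (pair p q)) (cons_code m r) k \<Longrightarrow> derivable Q q (cons_code m (cons_code k r)) y \<Longrightarrow>
     derivable Q (pair 5 (pair p q)) (cons_code (Suc m) r) y"
  "derivable Q p (cons_code y xs) 0 \<Longrightarrow> derivable Q (pair 8 p) (cons_code y xs) 0 \<Longrightarrow> derivable Q (pair 6 p) xs y"
  "derivable Q (pair 7 0) xs 0"
  "derivable Q p xs a \<Longrightarrow> derivable Q (pair 7 r) xs b \<Longrightarrow> derivable Q (pair 7 (cons_code p r)) xs (cons_code a b)"
  "derivable Q (pair 8 p) (cons_code 0 r) 0"
  "derivable Q p (cons_code m r) (Suc k) \<Longrightarrow> derivable Q (pair 8 p) (cons_code m r) 0 \<Longrightarrow>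
     derivable Q (pair 8 p) (cons_code (Suc m) r) 0"
  subgoal by (rule derivableI[of 0 "{}"]) (auto simp: justified_def)
  subgoal by (rule derivableI[of "Suc x" "{}"]) (auto simp: justified_def)
  subgoal by (rule derivableI[of "Suc (x + r)" "{}"]) (auto simp: justified_def)
  subgoal by (rule derivableI[of "Suc (Suc (x + r + j))" "{(pair 2 j, r, y)}"]) (auto simp: justified_def)
  subgoal by (rule derivableI[of "Suc x" "{}"]) (auto simp: justified_def)
  subgoal by (rule derivableI[of "Suc (p + q + ys)" "{(pair 7 q, xs, ys), (p, ys, y)}"])
    (auto intro: justified_intermediate(1)[where ys = ys])
  subgoal by (rule derivableI[of "Suc (p + q + r)" "{(p, r, y)}"]) (auto simp: justified_def)
  subgoal by (rule derivableI[of "Suc (Suc (p + q + r + m + k))"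
      "{(pair 5 (pair p q), cons_code m r, k), (q, cons_code m (cons_code k r), y)}"])
    (auto intro: justified_intermediate(2)[where k = k])
  subgoal by (rule derivableI[of "Suc p" "{(p, cons_code y xs, 0), (pair 8 p, cons_code y xs, 0)}"]) 
    (auto simp: justified_def)
  subgoal by (rule derivableI[of 1 "{}"]) (auto simp: justified_def)
  subgoal by (rule derivableI[of "Suc (cons_code p r + p + r + a + b)" "{(p, xs, a), (pair 7 r, xs, b)}"])
    (auto simp: justified_def)
  subgoal by (rule derivableI[of "Suc (p + r)" "{}"]) (auto simp: justified_def)
  subgoal by (rule derivableI[of "Suc (Suc (p + r + m + k))" 
     "{(p, cons_code m r, Suc k), (pair 8 p, cons_code m r, 0)}"]) (auto intro: justified_intermediate(3)[where k = k])
  done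

lemma derivable_runs:
  assumes "runs A p xs y"
  shows "derivable (\<lambda>x y. y = A x) (prog_code p) (list_encode xs) y"
  using assms
proof (induction rule: runs.induct)
  case (proj i xs)
  then show ?case
  proof (induction xs arbitrary: i)
    case (Cons x xs)
    then show ?case by (cases i) (auto intro!: derivable_rules)
  qed simp
next
  case (comp ys qs xs p y)
  have "derivable (\<lambda>x y. y = A x) (pair 7 (list_encode (map prog_code qs))) (list_encode xs) (list_encode ys)"
    if "length ys = length qs"
      "\<forall>i<length qs. derivable (\<lambda>x y. y = A x) (prog_code (qs ! i)) (list_encode xs) (ys ! i)" for ys qs
    using that
  proof (induction ys qs rule: list_induct2)
    case Nil
    then show ?case by (auto intro!: derivable_rules)
  next
    case (Cons y ys q qs)
    have "derivable (\<lambda>x y. y = A x) (prog_code q) (list_encode xs) y"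
      using Cons.prems by (auto dest: spec[of _ 0])
    moreover have "derivable (\<lambda>x y. y = A x) (pair 7 (list_encode (map prog_code qs))) (list_encode xs) (list_encode ys)"
      using Cons.prems by (intro Cons.IH) (auto dest: spec[of _ "Suc i" for i])
    ultimately show ?case by (auto intro!: derivable_rules)
  qed
  from this[of ys qs] show ?case using comp.hyps(1) comp.IH by (auto intro!: derivable_rules)
next
  case (minimize p n xs)
  have "m \<le> n \<Longrightarrow> derivable (\<lambda>x y. y = A x) (pair 8 (prog_code p)) (cons_code m (list_encode xs)) 0" for m
  proof (induction m)
    case 0
    show ?case by (rule derivable_rules(12))
  next
    case (Suc m)
    then have "m < n" by simp
    with minimize.IH(2) obtain k where "derivable (\<lambda>x y. y = A x) (prog_code p) (cons_code m (list_encode xs)) (Suc k)"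
      by auto
    then show ?case using Suc by (intro derivable_rules(13)) auto
  qed
  from this[of n] show ?case using minimize.IH(1)
    by (auto intro!: derivable_rules)
qed (auto intro: derivable_rules derivable_rules(2)[simplified])

text \<open>
  Induction on the program, and for recursion and minimization on the first argument. It is here that closed sets
  are seen not to contain circular justifications.
\<close>

lemma closed_sound:
  assumes closed: "closed B F Q" and Q: "\<And>x y. Q x y \<Longrightarrow> y = A x"
  shows "F (prog_code p) (list_encode xs) y \<Longrightarrow> runs A p xs y"
proof (induction p arbitrary: xs y)
  note J = closed[unfolded closed_def, rule_format, THEN conjunct2, unfolded justified_def]
  case Zero
  from J[OF this] show ?case by (auto intro: runs.zero)
next
  note J = closed[unfolded closed_def, rule_format, THEN conjunct2, unfolded justified_def]
  case Succ
  from J[OF this] show ?case by (auto intro: runs.succ)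
next
  note J = closed[unfolded closed_def, rule_format, THEN conjunct2, unfolded justified_def]
  case (Proj i)
  have "F (pair 2 i) (list_encode xs) y \<Longrightarrow> i < length xs \<and> y = xs ! i" for i
  proof (induction i arbitrary: xs)
    case 0
    from J[OF this] show ?case by auto
  next
    case (Suc i)
    from J[OF Suc.prems] show ?case using Suc.IH by auto
  qed
  then show ?case using Proj by (auto intro: runs.proj)
next
  note J = closed[unfolded closed_def, rule_format, THEN conjunct2, unfolded justified_def]
  case Query
  from J[OF this] show ?case using Q by (auto intro: runs.query)
next
  note J = closed[unfolded closed_def, rule_format, THEN conjunct2, unfolded justified_def]
  case (Comp p qs)
  have *: "F (pair 7 (list_encode (map prog_code qs))) (list_encode xs) l \<Longrightarrow>
    \<exists>ys. l = list_encode ys \<and> length ys = length qs \<and> (\<forall>i<length qs. runs A (qs ! i) xs (ys ! i))" for l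
    using Comp.IH(2)
  proof (induction qs arbitrary: l)
    case Nil
    from J[OF Nil(1)] show ?case by auto
  next
    case (Cons q qs)
    from J[OF Cons.prems(1)] obtain a b where ab: "l = cons_code a b" "F (prog_code q) (list_encode xs) a"
      "F (pair 7 (list_encode (map prog_code qs))) (list_encode xs) b"
      by auto
    obtain ys where ys: "b = list_encode ys" "length ys = length qs" "\<forall>i<length qs. runs A (qs ! i) xs (ys ! i)"
      using Cons.IH[OF ab(3)] Cons.prems(2) by auto
    have "runs A q xs a" using Cons.prems(2) ab(2) by simp
    then show ?case using ys ab(1)
      by (intro exI[of _ "a # ys"]) (auto simp: nth_Cons split: nat.split)
  qed
  from J[OF Comp.prems] obtain l where "F (pair 7 (list_encode (map prog_code qs))) (list_encode xs) l"
    "F (prog_code p) l y" by auto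
  then show ?case using *[of l] Comp.IH(1) by (blast intro: runs.comp)
next
  note J = closed[unfolded closed_def, rule_format, THEN conjunct2, unfolded justified_def]
  case (PrimRec p q)
  have *: "F (pair 5 (pair (prog_code p) (prog_code q))) (cons_code n (list_encode r)) y \<Longrightarrow> runs A (PrimRec p q) (n # r) y" for n r y
  proof (induction n arbitrary: y)
    case 0
    from J[OF this] have "F (prog_code p) (list_encode r) y" by auto
    then show ?case by (intro runs.primrec_0 PrimRec.IH)
  next
    case (Suc n)
    from J[OF Suc.prems] obtain k where "F (pair 5 (pair (prog_code p) (prog_code q))) (cons_code n (list_encode r)) k"
      "F (prog_code q) (cons_code n (cons_code k (list_encode r))) y" by auto
    then show ?case using Suc.IH PrimRec.IH(2)[of "n # k # r"]
      by (intro runs.primrec_Suc) auto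
  qed
  from J[OF PrimRec.prems] obtain n r where "xs = n # r" by auto
  then show ?case using * PrimRec.prems by simp
next
  note J = closed[unfolded closed_def, rule_format, THEN conjunct2, unfolded justified_def]
  case (Minimize p)
  have *: "F (pair 8 (prog_code p)) (cons_code n (list_encode xs)) z \<Longrightarrow> \<forall>m<n. \<exists>k. runs A p (m # xs) (Suc k)" for n z
  proof (induction n arbitrary: z)
    case (Suc n)
    from J[OF Suc.prems] obtain k where k: "F (prog_code p) (cons_code n (list_encode xs)) (Suc k)"
      "F (pair 8 (prog_code p)) (cons_code n (list_encode xs)) 0" by auto
    have "runs A p (n # xs) (Suc k)"
      by (rule Minimize.IH) (use k(1) in \<open>simp\<close>)
    then show ?case using Suc.IH[OF k(2)] by (auto simp: less_Suc_eq)
  qed simp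
  from J[OF Minimize.prems] have "F (prog_code p) (cons_code y (list_encode xs)) 0"
    "F (pair 8 (prog_code p)) (cons_code y (list_encode xs)) 0" by auto
  then show ?case using * Minimize.IH[of "y # xs"]
    by (intro runs.minimize) auto
qed

section \<open>Conditions\<close>

text \<open>
  A condition is a single number, read as a sequence: its length, its gap, and then the entries of its string. In this
  way every number is a condition.
\<close>

definition len :: "nat \<Rightarrow> nat" where "len c = seq c 0"
definition gap :: "nat \<Rightarrow> nat" where "gap c = seq c 1"
definition str :: "nat \<Rightarrow> nat \<Rightarrow> nat" where "str c i = seq c (Suc (Suc i))"

definition triple_in :: "nat \<Rightarrow> nat \<Rightarrow> nat \<Rightarrow> nat \<Rightarrow> bool" where
  "triple_in z e xs y \<longleftrightarrow> pair e (pair xs y) < seq z 0 \<and> seq z (Suc (pair e (pair xs y))) = 1"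

text \<open>
  \<open>z\<close> codes a finite set of judgements by its characteristic function, with the bound of the set as the first entry.
\<close>

definition conv_by :: "nat \<Rightarrow> nat \<Rightarrow> nat \<Rightarrow> nat \<Rightarrow> nat \<Rightarrow> bool" where
  "conv_by e c x y z \<longleftrightarrow> triple_in z e (cons_code x 0) y \<and>
     (\<forall>t<seq z 0. seq z (Suc t) = 1 \<longrightarrow>
        justified (seq z 0) (triple_in z) (\<lambda>x y. x < len c \<and> y = str c x) (pfst t) (pfst (psnd t)) (psnd (psnd t)))"

text \<open>
  Functional \<open>e\<close> converges to \<open>y\<close> at \<open>x\<close> with oracle queries inside the string of \<open>c\<close> only. The relation is \<open>\<Sigma>\<close>-1, and its
  sections for fixed \<open>e\<close> include all programs (\<open>conv_sound\<close>, \<open>conv_complete\<close>).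
\<close>

definition conv :: "nat \<Rightarrow> nat \<Rightarrow> nat \<Rightarrow> nat \<Rightarrow> bool" where
  "conv e c x y \<longleftrightarrow> (\<exists>z. conv_by e c x y z)"

lemma conv_iff_derivable:
  "conv e c x y \<longleftrightarrow> derivable (\<lambda>x y. x < len c \<and> y = str c x) e (cons_code x 0) y"
proof
  assume "conv e c x y"
  then obtain z where z: "conv_by e c x y z" unfolding conv_def by auto
  have "closed (seq z 0) (triple_in z) (\<lambda>x y. x < len c \<and> y = str c x)"
    unfolding closed_def
  proof (intro allI impI conjI)
    fix e xs y assume t: "triple_in z e xs y"
    then show "pair e (pair xs y) < seq z 0" by (simp add: triple_in_def)
    show "justified (seq z 0) (triple_in z) (\<lambda>x y. x < len c \<and> y = str c x) e xs y"
      using z[unfolded conv_by_def, THEN conjunct2, rule_format, of "pair e (pair xs y)"] t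
      by (simp add: triple_in_def)
  qed
  then show "derivable (\<lambda>x y. x < len c \<and> y = str c x) e (cons_code x 0) y"
    using z unfolding derivable_def conv_by_def by auto
next
  let ?Q = "\<lambda>x y. x < len c \<and> y = str c x"
  assume "derivable ?Q e (cons_code x 0) y"
  then obtain B F where BF: "closed B F ?Q" "F e (cons_code x 0) y" unfolding derivable_def by auto
  obtain z where z: "\<forall>i<Suc B. seq z i = (case i of 0 \<Rightarrow> B | Suc t \<Rightarrow> 
      if F (pfst t) (pfst (psnd t)) (psnd (psnd t)) then 1 else 0)" using seq_ex by blast
  have z0: "seq z 0 = B" using z by simp
  have zS: "seq z (Suc t) = 1 \<longleftrightarrow> F (pfst t) (pfst (psnd t)) (psnd (psnd t))" if "t < B" for t
    using z that by simp
  have F: "triple_in z e xs y" if "F e xs y" for e xs y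
    using BF(1) that zS[of "pair e (pair xs y)"] unfolding closed_def triple_in_def z0 by simp
  have "justified B (triple_in z) ?Q (pfst t) (pfst (psnd t)) (psnd (psnd t))"
    if "t < B" "seq z (Suc t) = 1" for t
  proof -
    have "justified B F ?Q (pfst t) (pfst (psnd t)) (psnd (psnd t))"
      using BF(1) zS[OF that(1)] that(2) unfolding closed_def by simp
    then show ?thesis by (rule justified_mono[OF _ order_refl]) (assumption | rule F)+
  qed
  then have "conv_by e c x y z" unfolding conv_by_def z0 using F[OF BF(2)] by simp
  then show "conv e c x y" unfolding conv_def by (rule exI)
qed

lemma conv_mono:
  assumes "conv e c x y" "len c \<le> len d" "\<forall>i<len c. str d i = str c i"
  shows "conv e d x y"
  using assms(1) unfolding conv_iff_derivable
  by (rule derivable_mono) (use assms(2,3) in auto)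

lemma conv_sound:
  assumes "conv (prog_code p) c x y" "\<forall>i<len c. str c i = A i"
  shows "runs A p [x] y"
proof -
  obtain B F where "closed B F (\<lambda>x y. x < len c \<and> y = str c x)" "F (prog_code p) (cons_code x 0) y"
    using assms(1) unfolding conv_iff_derivable derivable_def by auto
  from closed_sound[OF this(1), of A p "[x]" y] this(2) assms(2) show ?thesis by simp
qed

lemma conv_complete:
  assumes "runs A p [x] y"
  shows "\<exists>n. \<forall>c. n \<le> len c \<longrightarrow> (\<forall>i<n. str c i = A i) \<longrightarrow> conv (prog_code p) c x y"
proof -
  obtain n where n: "derivable (\<lambda>x y. x < n \<and> y = A x) (prog_code p) (cons_code x 0) y"
    using derivable_finite_use[OF derivable_runs[OF assms]] by auto
  have "conv (prog_code p) c x y" if "n \<le> len c" "\<forall>i<n. str c i = A i" for c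
    unfolding conv_iff_derivable by (rule derivable_mono[OF n]) (use that in auto)
  then show ?thesis by blast
qed

lemma rec_fun_cond:
  "rec_fun a \<Longrightarrow> rec_fun (\<lambda>f g v. len (a f g v))"
  "rec_fun a \<Longrightarrow> rec_fun (\<lambda>f g v. gap (a f g v))"
  "rec_fun a \<Longrightarrow> rec_fun b \<Longrightarrow> rec_fun (\<lambda>f g v. str (a f g v) (b f g v))"
  unfolding len_def gap_def str_def by (intro rec_fun_seq rec_rules; assumption)+

text \<open>
  Five places suffice for all relations below; those with fewer are padded with dummy arguments.
\<close>

lemma delta1_subst5:
  assumes "delta1 (\<lambda>f g v. R f g (v 0) (v 1) (v 2) (v 3) (v 4))"
    "rec_fun a" "rec_fun b" "rec_fun c" "rec_fun d" "rec_fun e"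
  shows "delta1 (\<lambda>f g v. R f g (a f g v) (b f g v) (c f g v) (d f g v) (e f g v))"
  using delta1_subst_all[OF assms(1), of "\<lambda>i. if i = 0 then a else if i = 1 then b else if i = 2 then c
    else if i = 3 then d else e"] assms(2-6) by simp

lemma delta1_conv_by:
  assumes "rec_fun a" "rec_fun b" "rec_fun c" "rec_fun d" "rec_fun e"
  shows "delta1 (\<lambda>f g v. conv_by (a f g v) (b f g v) (c f g v) (d f g v) (e f g v))"
proof (rule delta1_subst5[of "\<lambda>f g. conv_by", OF _ assms])
  show "delta1 (\<lambda>f g v. conv_by (v 0) (v 1) (v 2) (v 3) (v 4))"
    unfolding conv_by_def justified_def triple_in_def cons_code_def
    by (intro delta1_rules rec_rules rec_fun_cond rec_fun_seq rec_fun_pair rec_fun_pfst rec_fun_psnd)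
qed

section \<open>Density of disagreements and extension of conditions\<close>

lemma dis_le: "dis u h l \<le> l"
proof -
  have "card {x. x < l \<and> u x \<noteq> h x} \<le> card {..<l}" by (intro card_mono) auto
  then show ?thesis by (simp add: dis_def)
qed

lemma dis_sym: "dis u h l = dis h u l"
  unfolding dis_def by metis

lemma dis_cong: "(\<And>x. x < l \<Longrightarrow> u x = u' x) \<Longrightarrow> (\<And>x. x < l \<Longrightarrow> h x = h' x) \<Longrightarrow> dis u h l = dis u' h' l"
  unfolding dis_def by (rule arg_cong[where f = card]) auto

lemma dis_union:
  assumes "\<And>x. x < l \<Longrightarrow> u x \<noteq> h x \<Longrightarrow> (x < l1 \<and> u1 x \<noteq> h1 x) \<or> (x < l2 \<and> u2 x \<noteq> h2 x)"
  shows "dis u h l \<le> dis u1 h1 l1 + dis u2 h2 l2"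
proof -
  have "card {x. x < l \<and> u x \<noteq> h x} \<le> card ({x. x < l1 \<and> u1 x \<noteq> h1 x} \<union> {x. x < l2 \<and> u2 x \<noteq> h2 x})"
    using assms by (intro card_mono) auto
  also have "\<dots> \<le> dis u1 h1 l1 + dis u2 h2 l2" unfolding dis_def by (rule card_Un_le)
  finally show ?thesis unfolding dis_def .
qed

lemma dis_triangle: "dis u w l \<le> dis u h l + dis h w l"
  by (rule dis_union) auto

lemma dis_mono: "l \<le> l' \<Longrightarrow> dis u h l \<le> dis u h l'"
  unfolding dis_def by (intro card_mono) auto

text \<open>
  Vanishing density in terms of natural numbers, as needed for an arithmetical formula.
\<close>

lemma density_zero_iff: "density_zero D \<longleftrightarrow> (\<forall>m. \<exists>N. \<forall>l\<ge>N. m * card (D \<inter> {..<l}) \<le> l)"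
proof
  assume D: "density_zero D"
  show "\<forall>m. \<exists>N. \<forall>l\<ge>N. m * card (D \<inter> {..<l}) \<le> l"
  proof
    fix m :: nat
    show "\<exists>N. \<forall>l\<ge>N. m * card (D \<inter> {..<l}) \<le> l"
    proof (cases "m = 0")
      case False
      then have "1 / real m > 0" by simp
      from LIMSEQ_D[OF D[unfolded density_zero_def] this] obtain N where
        N: "\<And>l. l \<ge> N \<Longrightarrow> \<bar>real (card (D \<inter> {..<l})) / real l\<bar> < 1 / real m" by auto
      have "m * card (D \<inter> {..<l}) \<le> l" if "l \<ge> Suc N" for l
      proof -
        have "real (card (D \<inter> {..<l})) / real l < 1 / real m" "real l > 0" using N[of l] that by auto
        then have "real m * real (card (D \<inter> {..<l})) < real l" using False by (simp add: field_simps)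
        then have "real (m * card (D \<inter> {..<l})) < real l" by simp
        then show ?thesis by linarith
      qed
      then show ?thesis by blast
    qed simp
  qed
next
  assume D: "\<forall>m. \<exists>N. \<forall>l\<ge>N. m * card (D \<inter> {..<l}) \<le> l"
  show "density_zero D" unfolding density_zero_def
  proof (rule LIMSEQ_I)
    fix r :: real assume "0 < r"
    then obtain n where n: "inverse (real (Suc n)) < r" using reals_Archimedean by blast
    obtain N where N: "\<And>l. l \<ge> N \<Longrightarrow> Suc n * card (D \<inter> {..<l}) \<le> l" using D by blast
    have "norm (real (card (D \<inter> {..<l})) / real l - 0) < r" if "l \<ge> N" for l
    proof (cases "l = 0")
      case False
      have "real (Suc n * card (D \<inter> {..<l})) \<le> real l" using N[OF that] by (simp only: of_nat_le_iff)
      then have "real (card (D \<inter> {..<l})) / real l \<le> inverse (real (Suc n))"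
        using False by (simp add: field_simps)
      then show ?thesis using n by simp
    qed (use \<open>0 < r\<close> in simp)
    then show "\<exists>N. \<forall>l\<ge>N. norm (real (card (D \<inter> {..<l})) / real l - 0) < r" by blast
  qed
qed

lemma coarse_description_iff:
  "coarse_description u h \<longleftrightarrow> (\<forall>m. \<exists>N. \<forall>l\<ge>N. m * dis u h l \<le> l)"
proof -
  have "card ({x. h x \<noteq> u x} \<inter> {..<l}) = dis u h l" for l
    unfolding dis_def by (rule arg_cong[where f = card]) auto
  then show ?thesis unfolding coarse_description_def density_zero_iff by simp
qed

lemma coarse_description_sym: "coarse_description u h \<Longrightarrow> coarse_description h u"
  unfolding coarse_description_iff by (simp add: dis_sym)

text \<open>
  The density bound imposed by \<open>c\<close> starts at the end of the string of \<open>c\<close>. The gap may only grow, so that the bounds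
  become stricter along extensions.
\<close>

definition ext :: "(nat \<Rightarrow> nat) \<Rightarrow> nat \<Rightarrow> nat \<Rightarrow> bool" where
  "ext f c t \<longleftrightarrow> len c \<le> len t \<and> (\<forall>i<len c. str t i = str c i) \<and> gap c \<le> gap t \<and>
     (\<forall>l<Suc (len t). len c \<le> l \<longrightarrow> gap c * dis (str t) f l \<le> l)"

text \<open>
  The string itself meets the bound at its end. Otherwise a condition has no extension at all, while a valid one can be
  continued with the values of \<open>f\<close> (\<open>valid_extension\<close>).
\<close>

definition valid :: "(nat \<Rightarrow> nat) \<Rightarrow> nat \<Rightarrow> bool" where
  "valid f c \<longleftrightarrow> gap c * dis (str c) f (len c) \<le> len c"

lemma ext_len: "ext f c t \<Longrightarrow> len c \<le> len t"
  and ext_str: "ext f c t \<Longrightarrow> i < len c \<Longrightarrow> str t i = str c i"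
  and ext_gap: "ext f c t \<Longrightarrow> gap c \<le> gap t"
  and ext_dis: "ext f c t \<Longrightarrow> len c \<le> l \<Longrightarrow> l \<le> len t \<Longrightarrow> gap c * dis (str t) f l \<le> l"
  unfolding ext_def by auto

lemma ext_refl: "valid f c \<Longrightarrow> ext f c c"
  unfolding ext_def valid_def by (auto dest: le_antisym)

lemma ext_trans:
  assumes "ext f c d" "ext f d t"
  shows "ext f c t"
  unfolding ext_def
proof (intro conjI allI impI)
  show "len c \<le> len t" using assms ext_len le_trans by blast
  show "gap c \<le> gap t" using assms ext_gap le_trans by blast
  show "str t i = str c i" if "i < len c" for i
    using that ext_str[OF assms(1), of i] ext_str[OF assms(2), of i] ext_len[OF assms(1)] by simp
  show "gap c * dis (str t) f l \<le> l" if "l < Suc (len t)" "len c \<le> l" for l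
  proof (cases "l \<le> len d")
    case True
    have "dis (str t) f l = dis (str d) f l"
      by (rule dis_cong) (use True ext_str[OF assms(2)] in auto)
    then show ?thesis using ext_dis[OF assms(1) that(2) True] by simp
  next
    case False
    have "gap c * dis (str t) f l \<le> gap d * dis (str t) f l"
      using ext_gap[OF assms(1)] by simp
    also have "\<dots> \<le> l" using ext_dis[OF assms(2), of l] False that by simp
    finally show ?thesis .
  qed
qed

lemma cond_ex: "\<exists>c. len c = n \<and> gap c = k \<and> (\<forall>i<n. str c i = u i)"
proof -
  obtain c where "\<forall>i<Suc (Suc n). seq c i = (case i of 0 \<Rightarrow> n | Suc 0 \<Rightarrow> k | Suc (Suc j) \<Rightarrow> u j)"
    using seq_ex by blast
  then have "len c = n \<and> gap c = k \<and> (\<forall>i<n. str c i = u i)"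
    unfolding len_def gap_def str_def by simp
  then show ?thesis ..
qed

lemma conv_ext: "conv e c x y \<Longrightarrow> ext f c t \<Longrightarrow> conv e t x y"
  by (erule conv_mono) (auto simp: ext_len ext_str)

lemma valid_extension:
  assumes "valid f c"
  shows "\<exists>t. ext f c t \<and> valid f t \<and> n \<le> len t \<and> k \<le> gap t"
proof -
  define G where "G = max k (gap c)"
  \<comment> \<open>The disagreements of the new string all lie below \<open>len c\<close>, so length \<open>G * len c\<close> makes it valid for gap \<open>G\<close>.\<close>
  define L where "L = max n (len c) + G * len c"
  obtain t where t: "len t = L" "gap t = G" "\<forall>i<L. str t i = (if i < len c then str c i else f i)"
    using cond_ex[of L G "\<lambda>i. if i < len c then str c i else f i"] by blast
  have cL: "len c \<le> L" by (simp add: L_def)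
  have d: "dis (str t) f l \<le> dis (str c) f (len c)" if "l \<le> L" for l
    using dis_union[of l "str t" f "len c" "str c" f 0 f f] t that by (auto simp: dis_def split: if_splits)
  have "ext f c t" unfolding ext_def
  proof (intro conjI allI impI)
    show "gap c * dis (str t) f l \<le> l" if "l < Suc (len t)" "len c \<le> l" for l
    proof -
      have "gap c * dis (str t) f l \<le> gap c * dis (str c) f (len c)" using d[of l] that t by simp
      also have "\<dots> \<le> l" using assms that unfolding valid_def by simp
      finally show ?thesis .
    qed
  qed (use t cL in \<open>auto simp: G_def\<close>)
  moreover have "valid f t" unfolding valid_def
  proof -
    have "gap t * dis (str t) f (len t) \<le> G * len c"
      using d[of L] dis_le[of "str c" f "len c"] t by simp
    also have "\<dots> \<le> len t" using t by (simp add: L_def)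
    finally show "gap t * dis (str t) f (len t) \<le> len t" .
  qed
  ultimately show ?thesis using t by (intro exI[of _ t]) (simp add: L_def G_def)
qed

section \<open>Forcing and generic coarse descriptions\<close>

text \<open>
  Whatever \<open>e\<close> computes below \<open>d\<close> is within \<open>l / m\<close> errors of \<open>g\<close>, from the length of \<open>d\<close> on. That the length of \<open>d\<close> also
  serves as the threshold for \<open>l\<close> saves a quantifier.
\<close>

definition accurate :: "(nat \<Rightarrow> nat) \<Rightarrow> (nat \<Rightarrow> nat) \<Rightarrow> nat \<Rightarrow> nat \<Rightarrow> nat \<Rightarrow> bool" where
  "accurate f g e m d \<longleftrightarrow> (\<forall>t w l. ext f d t \<and> len d \<le> l \<and> (\<forall>i<l. conv e t i (seq w i)) \<longrightarrow>
     m * dis (seq w) g l \<le> l)"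

definition forces :: "(nat \<Rightarrow> nat) \<Rightarrow> (nat \<Rightarrow> nat) \<Rightarrow> nat \<Rightarrow> nat \<Rightarrow> bool" where
  "forces f g e c \<longleftrightarrow> valid f c \<and> (\<forall>m c'. ext f c c' \<and> valid f c' \<longrightarrow>
     (\<exists>d. ext f c' d \<and> valid f d \<and> (\<exists>y. conv e d m y) \<and> accurate f g e m d))"

text \<open>
  Below \<open>d\<close> the functional \<open>e\<close> never converges at \<open>m\<close>, or errors beyond \<open>l / m\<close> can always still be enforced. A point of
  \<open>d\<close> that meets the corresponding dense sets is not mapped to a coarse description of \<open>g\<close>.
\<close>

definition hopeless :: "(nat \<Rightarrow> nat) \<Rightarrow> (nat \<Rightarrow> nat) \<Rightarrow> nat \<Rightarrow> nat \<Rightarrow> nat \<Rightarrow> bool" where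
  "hopeless f g e m d \<longleftrightarrow> (\<forall>t. ext f d t \<and> valid f t \<longrightarrow> \<not> (\<exists>y. conv e t m y)) \<or>
     (\<forall>t. ext f d t \<and> valid f t \<longrightarrow> \<not> accurate f g e m t)"

lemma hopeless_ext: "hopeless f g e m d \<Longrightarrow> ext f d t \<Longrightarrow> hopeless f g e m t"
  unfolding hopeless_def by (meson ext_trans)

text \<open>
  If one extension converges at \<open>m\<close>, so do all its extensions, and then failure of forcing leaves only inaccuracy
  below it.
\<close>

lemma not_forces_hopeless:
  assumes "valid f c" "\<not> forces f g e c"
  shows "\<exists>m d. ext f c d \<and> valid f d \<and> hopeless f g e m d"
proof -
  obtain m c' where c': "ext f c c'" "valid f c'"
    "\<And>d. ext f c' d \<Longrightarrow> valid f d \<Longrightarrow> \<exists>y. conv e d m y \<Longrightarrow> \<not> accurate f g e m d"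
    using assms unfolding forces_def by auto
  show ?thesis
  proof (cases "\<exists>d y. ext f c' d \<and> valid f d \<and> conv e d m y")
    case True
    then obtain d y where d: "ext f c' d" "valid f d" "conv e d m y" by blast
    have "\<not> accurate f g e m t" if "ext f d t" "valid f t" for t
      using c'(3)[of t] ext_trans[OF d(1) that(1)] that(2) conv_ext[OF d(3) that(1)] by blast
    then have "hopeless f g e m d" unfolding hopeless_def by blast
    then show ?thesis using d ext_trans[OF c'(1)] by blast
  next
    case False
    then have "hopeless f g e m c'" unfolding hopeless_def by blast
    then show ?thesis using c' by blast
  qed
qed

text \<open>
  The witness can be taken valid, as only its string matters: with the gap of \<open>d\<close> it satisfies the bound that is known
  for it anyway.
\<close>

lemma not_accurate_witness:
  assumes "\<not> accurate f g e m d"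
  shows "\<exists>t w l. ext f d t \<and> valid f t \<and> len d \<le> l \<and> (\<forall>i<l. conv e t i (seq w i)) \<and> l < m * dis (seq w) g l"
proof -
  obtain t w l where t: "ext f d t" "len d \<le> l" "\<forall>i<l. conv e t i (seq w i)" "\<not> m * dis (seq w) g l \<le> l"
    using assms unfolding accurate_def by blast
  \<comment> \<open>The same string with the least admissible gap.\<close>
  obtain t' where t': "len t' = len t" "gap t' = gap d" "\<forall>i<len t. str t' i = str t i"
    using cond_ex[of "len t" "gap d" "str t"] by blast
  have d: "dis (str t') f l = dis (str t) f l" if "l \<le> len t" for l
    by (rule dis_cong) (use t' that in auto)
  have "ext f d t'" using t(1) t' d unfolding ext_def by (simp add: less_Suc_eq_le)
  moreover have "valid f t'" using ext_dis[OF t(1) ext_len[OF t(1)]] d unfolding valid_def t' by simp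
  moreover have "conv e t' i (seq w i)" if "i < l" for i
    by (rule conv_mono[of e t]) (use t t' that in auto)
  ultimately show ?thesis using t by (metis not_le)
qed

text \<open>
  The generic point. Step \<open>s\<close> makes \<open>P (pfst s)\<close> hopeless and, if accuracy for \<open>m = pfst (psnd s)\<close> fails at the current
  condition, adds an error that violates it. The remaining component of \<open>s\<close> only serves to return to each pair
  infinitely often. Since \<open>s\<close> bounds the length and the gap of the \<open>s\<close>-th condition from below, the limit is total
  and a coarse description of \<open>f\<close>, and the errors occur at arbitrarily large lengths.
\<close>

lemma generic_coarse_description:
  fixes P :: "nat \<Rightarrow> prog"
  assumes c: "valid f c"
    and dense: "\<And>i d. ext f c d \<Longrightarrow> valid f d \<Longrightarrow> \<exists>m t. ext f d t \<and> valid f t \<and> hopeless f g (prog_code (P i)) m t"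
  shows "\<exists>A. coarse_description A f \<and> (\<forall>i g'. coarse_description g' g \<longrightarrow> \<not> computes_via (P i) A g')"
proof -
  define step where "step s d d' \<longleftrightarrow> ext f d d' \<and> (\<exists>m. hopeless f g (prog_code (P (pfst s))) m d') \<and>
     (accurate f g (prog_code (P (pfst s))) (pfst (psnd s)) d \<or>
       (\<exists>w l. len d \<le> l \<and> (\<forall>i<l. conv (prog_code (P (pfst s))) d' i (seq w i)) \<and> l < pfst (psnd s) * dis (seq w) g l))" for s d d'
  have "\<exists>d. \<forall>s. (ext f c (d s) \<and> valid f (d s) \<and> s \<le> len (d s) \<and> s \<le> gap (d s)) \<and> step s (d s) (d (Suc s))"
  proof (rule dependent_nat_choice)
    show "\<exists>d. ext f c d \<and> valid f d \<and> 0 \<le> len d \<and> 0 \<le> gap d"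
      using c ext_refl by blast
  next
    fix d s assume d: "ext f c d \<and> valid f d \<and> s \<le> len d \<and> s \<le> gap d"
    let ?e = "prog_code (P (pfst s))" and ?m = "pfst (psnd s)"
    have "\<exists>d1. ext f d d1 \<and> valid f d1 \<and> (accurate f g ?e ?m d \<or>
       (\<exists>w l. len d \<le> l \<and> (\<forall>i<l. conv ?e d1 i (seq w i)) \<and> l < ?m * dis (seq w) g l))"
    proof (cases "accurate f g ?e ?m d")
      case True
      then show ?thesis using d ext_refl by blast
    next
      case False
      from not_accurate_witness[OF this] show ?thesis by blast
    qed
    then obtain d1 where d1: "ext f d d1" "valid f d1" "accurate f g ?e ?m d \<or>
       (\<exists>w l. len d \<le> l \<and> (\<forall>i<l. conv ?e d1 i (seq w i)) \<and> l < ?m * dis (seq w) g l)" by blast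
    have cd1: "ext f c d1" using d d1(1) ext_trans by blast
    obtain m d2 where d2: "ext f d1 d2" "valid f d2" "hopeless f g ?e m d2" using dense[OF cd1 d1(2)] by blast
    obtain d3 where d3: "ext f d2 d3" "valid f d3" "Suc s \<le> len d3" "Suc s \<le> gap d3"
      using valid_extension[OF d2(2)] by blast
    have d13: "ext f d1 d3" using d2(1) d3(1) by (rule ext_trans)
    have "step s d d3" unfolding step_def
    proof (intro conjI)
      show "ext f d d3" using d1(1) d13 by (rule ext_trans)
      show "\<exists>m. hopeless f g ?e m d3" using hopeless_ext[OF d2(3) d3(1)] by blast
      show "accurate f g ?e ?m d \<or>
       (\<exists>w l. len d \<le> l \<and> (\<forall>i<l. conv ?e d3 i (seq w i)) \<and> l < ?m * dis (seq w) g l)"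
        using d1(3) conv_ext[OF _ d13] by blast
    qed
    moreover have "ext f c d3" using cd1 d13 by (rule ext_trans)
    ultimately show "\<exists>d'. (ext f c d' \<and> valid f d' \<and> Suc s \<le> len d' \<and> Suc s \<le> gap d') \<and> step s d d'"
      using d3 by blast
  qed
  then obtain d where d: "\<And>s. ext f c (d s)" "\<And>s. valid f (d s)" "\<And>s. s \<le> len (d s)" "\<And>s. s \<le> gap (d s)"
    "\<And>s. step s (d s) (d (Suc s))" by blast
  have mono: "ext f (d s) (d t)" if "s \<le> t" for s t
    using that
  proof (induction rule: dec_induct)
    case base
    then show ?case using d(2) by (rule ext_refl)
  next
    case (step n)
    then show ?case using d(5)[of n] ext_trans unfolding step_def by blast
  qed
  define A where "A x = str (d (Suc x)) x" for x
  have A: "str (d s) x = A x" if "x < len (d s)" for s x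
  proof (cases "s \<le> Suc x")
    case True
    then show ?thesis using ext_str[OF mono[OF True] that] by (simp add: A_def)
  next
    case False
    then have "Suc x \<le> s" by simp
    moreover have "x < len (d (Suc x))" using d(3)[of "Suc x"] by simp
    ultimately show ?thesis using ext_str[OF mono[of "Suc x" s]] by (simp add: A_def)
  qed
  have "coarse_description A f" unfolding coarse_description_iff
  proof
    fix m
    have "m * dis A f l \<le> l" if l: "len (d m) \<le> l" for l
    proof -
      \<comment> \<open>Far enough along the sequence to have gap at least \<open>m\<close> and to cover the first \<open>l\<close> arguments.\<close>
      define r where "r = max m l"
      have r: "m \<le> r" "l \<le> len (d r)" using d(3)[of r] by (auto simp: r_def)
      have "dis A f l = dis (str (d r)) f l" by (rule dis_cong) (use A[of _ r] r in auto)
      then have "m * dis A f l \<le> gap (d m) * dis (str (d r)) f l" using d(4)[of m] by simp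
      also have "\<dots> \<le> l" using ext_dis[OF mono[OF r(1)] l r(2)] .
      finally show ?thesis .
    qed
    then show "\<exists>N. \<forall>l\<ge>N. m * dis A f l \<le> l" by blast
  qed
  moreover have False if g': "coarse_description g' g" and comp: "computes_via (P i) A g'" for i g'
  proof -
    let ?e = "prog_code (P i)"
    obtain m where m: "hopeless f g ?e m (d (Suc (pair i 0)))"
      using d(5)[of "pair i 0"] unfolding step_def by auto
    let ?s = "Suc (pair i 0)"
    show False
    proof (cases "\<forall>t. ext f (d ?s) t \<and> valid f t \<longrightarrow> \<not> (\<exists>y. conv ?e t m y)")
      case True
      obtain n where n: "\<forall>c. n \<le> len c \<longrightarrow> (\<forall>i<n. str c i = A i) \<longrightarrow> conv ?e c m (g' m)"
        using conv_complete comp unfolding computes_via_def by blast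
      let ?t = "d (?s + n)"
      have "n \<le> len ?t" using d(3)[of "?s + n"] by simp
      then have "conv ?e ?t m (g' m)" using n A[of _ "?s + n"] by simp
      moreover have "ext f (d ?s) ?t" by (rule mono) simp
      ultimately show False using True d(2) by blast
    next
      case False
      then have hopeless: "\<And>t. ext f (d ?s) t \<Longrightarrow> valid f t \<Longrightarrow> \<not> accurate f g ?e m t"
        using m unfolding hopeless_def by blast
      obtain N where N: "\<And>l. l \<ge> N \<Longrightarrow> m * dis g' g l \<le> l"
        using g' unfolding coarse_description_iff by blast
      \<comment> \<open>A step for \<open>i\<close> and \<open>m\<close> that is late enough to be below the hopeless condition and beyond \<open>N\<close>.\<close>
      define r where "r = pair i (pair m (?s + N))"
      have "?s + N \<le> r" unfolding r_def using le_pair le_trans by blast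
      then have r: "?s \<le> r" "N \<le> r" by auto
      have "\<not> accurate f g ?e m (d r)" by (rule hopeless[OF mono[OF r(1)] d(2)])
      then obtain w l where wl: "len (d r) \<le> l" "\<forall>i<l. conv ?e (d (Suc r)) i (seq w i)" "l < m * dis (seq w) g l"
        using d(5)[of r] unfolding step_def by (auto simp: r_def)
      have "seq w x = g' x" if "x < l" for x
      proof (rule runs_deterministic)
        show "runs A (P i) [x] (seq w x)"
          by (rule conv_sound[of _ "d (Suc r)"]) (use wl(2) that A in auto)
        show "runs A (P i) [x] (g' x)" using comp unfolding computes_via_def by blast
      qed
      then have "dis (seq w) g l = dis g' g l" by (intro dis_cong) auto
      moreover have "l \<ge> N" using r(2) d(3)[of r] wl(1) by simp
      ultimately show False using N[of l] wl(3) by simp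
    qed
  qed
  ultimately show ?thesis by blast
qed

section \<open>Invariance of forcing under coarse equality\<close>

text \<open>
  Continue the string of \<open>c\<close> with \<open>f\<close> until \<open>f\<close> and \<open>h\<close> are close, and halve the admitted density: a string that is
  \<open>1 / (2 k)\<close>-close to \<open>h\<close> is then \<open>1 / k\<close>-close to \<open>f\<close>.
\<close>

lemma transfer_condition:
  assumes fh: "coarse_description f h" and c: "valid f c"
  shows "\<exists>d. valid h d \<and> (\<forall>t. ext h d t \<longrightarrow> ext f c t)"
proof -
  define k where "k = 2 * gap c"
  obtain N where N: "\<And>l. l \<ge> N \<Longrightarrow> 2 * k * dis f h l \<le> l"
    using fh unfolding coarse_description_iff by blast
  \<comment> \<open>Beyond \<open>N\<close> the functions \<open>f\<close> and \<open>h\<close> are close enough; the last summand absorbs the disagreements of the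
    string of \<open>c\<close>.\<close>
  define L where "L = N + len c + 2 * k * len c"
  define u where "u i = (if i < len c then str c i else f i)" for i
  obtain d where d: "len d = L" "gap d = k" "\<forall>i<L. str d i = u i"
    using cond_ex[of L k u] by blast
  have u: "dis u h l \<le> len c + dis f h l" for l
  proof -
    have "dis u h l \<le> dis u f l + dis f h l" by (rule dis_triangle)
    moreover have "dis u f l \<le> dis u f (len c) + dis f f 0"
      by (rule dis_union) (auto simp: u_def split: if_splits)
    ultimately show ?thesis using dis_le[of u f "len c"] by (simp add: dis_def)
  qed
  have "valid h d" unfolding valid_def
  proof -
    have "2 * (k * dis u h L) \<le> 2 * k * len c + 2 * k * dis f h L"
      using mult_le_mono2[OF u[of L], of "2 * k"] by (simp add: algebra_simps)
    also have "\<dots> \<le> L + L" using N[of L] by (intro add_mono) (auto simp: L_def)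
    finally have "k * dis u h L \<le> L" by simp
    moreover have "dis (str d) h L = dis u h L" by (rule dis_cong) (use d in auto)
    ultimately show "gap d * dis (str d) h (len d) \<le> len d" using d by simp
  qed
  moreover have "ext f c t" if t: "ext h d t" for t
    unfolding ext_def
  proof (intro conjI allI impI)
    show "len c \<le> len t" using ext_len[OF t] d by (simp add: L_def)
    show "str t i = str c i" if "i < len c" for i
      using ext_str[OF t, of i] d that by (simp add: L_def u_def)
    show "gap c \<le> gap t" using ext_gap[OF t] d by (simp add: k_def)
    show "gap c * dis (str t) f l \<le> l" if "l < Suc (len t)" "len c \<le> l" for l
    proof (cases "L \<le> l")
      case True
      have "dis (str t) f l \<le> dis (str t) h l + dis f h l"
        using dis_triangle[of "str t" f l h] dis_sym[of f h l] by simp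
      from mult_le_mono2[OF this, of "2 * k"]
      have "2 * k * dis (str t) f l \<le> 2 * (k * dis (str t) h l) + 2 * k * dis f h l"
        by (simp add: algebra_simps)
      also have "\<dots> \<le> 2 * l + l"
        using ext_dis[OF t, of l] N[of l] d that True by (intro add_mono mult_le_mono2) (auto simp: L_def)
      finally show ?thesis by (simp add: k_def)
    next
      case False
      have "dis (str t) f l \<le> dis (str c) f (len c) + dis f f 0"
        by (rule dis_union) (use False ext_str[OF t] d in \<open>auto simp: u_def split: if_splits\<close>)
      then have "gap c * dis (str t) f l \<le> gap c * dis (str c) f (len c)" by (simp add: dis_def)
      also have "\<dots> \<le> l" using c that unfolding valid_def by simp
      finally show ?thesis .
    qed
  qed
  ultimately show ?thesis by blast
qed

text \<open>
  Given a condition relative to \<open>h\<close>, pass to one relative to \<open>f\<close> inside it, use forcing there, and pass back. The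
  hypothesis on \<open>d\<close> is that all points of \<open>d\<close>, in the sense of \<open>h\<close>, are points of \<open>c\<close> in the sense of \<open>f\<close>.
\<close>

lemma transfer_forces:
  assumes fh: "coarse_description f h" and forces: "forces f g e c"
    and d: "valid h d" "\<And>t. ext h d t \<Longrightarrow> ext f c t"
  shows "forces h g e d"
  unfolding forces_def
proof (intro conjI allI impI d(1))
  fix m a assume a: "ext h d a \<and> valid h a"
  obtain b where b: "valid f b" "\<And>t. ext f b t \<Longrightarrow> ext h a t"
    using transfer_condition[OF coarse_description_sym[OF fh], of a] a by blast
  have "ext h d b" using b(2)[OF ext_refl[OF b(1)]] a ext_trans by blast
  then have "ext f c b" by (rule d(2))
  then obtain b' y where b': "ext f b b'" "valid f b'" "conv e b' m y" "accurate f g e m b'"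
    using forces b(1) unfolding forces_def by blast
  obtain a' where a': "valid h a'" "\<And>t. ext h a' t \<Longrightarrow> ext f b' t"
    using transfer_condition[OF fh b'(2)] by blast
  have ba: "ext f b' a'" using a'(2)[OF ext_refl[OF a'(1)]] .
  have "ext h a a'" using b(2) ext_trans[OF b'(1) ba] by blast
  moreover have "conv e a' m y" using conv_ext[OF b'(3) ba] .
  moreover have "accurate h g e m a'" unfolding accurate_def
  proof (intro allI impI)
    fix t w l assume t: "ext h a' t \<and> len a' \<le> l \<and> (\<forall>i<l. conv e t i (seq w i))"
    then have "ext f b' t" "len b' \<le> l" using a'(2) ext_len[OF ba] by auto
    then show "m * dis (seq w) g l \<le> l" using b'(4) t unfolding accurate_def by blast
  qed
  ultimately show "\<exists>d. ext h a d \<and> valid h d \<and> (\<exists>y. conv e d m y) \<and> accurate h g e m d"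
    using a'(1) by blast
qed

section \<open>Computing a coarse description from f\<close>

text \<open>
  The substitute for closeness to \<open>g\<close> that can be refuted by a finite search relative to \<open>f\<close>.
\<close>

definition coherent :: "(nat \<Rightarrow> nat) \<Rightarrow> nat \<Rightarrow> nat \<Rightarrow> nat \<Rightarrow> bool" where
  "coherent f e m a \<longleftrightarrow> (\<forall>t t' w w' l. ext f a t \<and> ext f a t' \<and> len a \<le> l \<and>
     (\<forall>i<l. conv e t i (seq w i)) \<and> (\<forall>i<l. conv e t' i (seq w' i)) \<longrightarrow>
     m * dis (seq w) (seq w') l \<le> 2 * l)"

text \<open>
  A refutation \<open>r\<close> packs the two strings, their outputs, the length, and witnesses for the computations.
\<close>

definition refutes :: "(nat \<Rightarrow> nat) \<Rightarrow> nat \<Rightarrow> nat \<Rightarrow> nat \<Rightarrow> nat \<Rightarrow> bool" where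
  "refutes f e m a r \<longleftrightarrow> ext f a (seq r 0) \<and> ext f a (seq r 1) \<and> len a \<le> seq r 4 \<and>
     (\<forall>i<seq r 4. conv_by e (seq r 0) i (seq (seq r 2) i) (seq (seq r 5) i)) \<and>
     (\<forall>i<seq r 4. conv_by e (seq r 1) i (seq (seq r 3) i) (seq (seq r 6) i)) \<and>
     2 * seq r 4 < m * dis (seq (seq r 2)) (seq (seq r 3)) (seq r 4)"

lemma conv_all_iff: "(\<forall>i<l. conv e t i (seq w i)) \<longleftrightarrow> (\<exists>z. \<forall>i<l. conv_by e t i (seq w i) (seq z i))"
proof
  assume "\<forall>i<l. conv e t i (seq w i)"
  then obtain u where u: "\<And>i. i < l \<Longrightarrow> conv_by e t i (seq w i) (u i)" unfolding conv_def by metis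
  obtain z where "\<forall>i<l. seq z i = u i" using seq_ex by blast
  then show "\<exists>z. \<forall>i<l. conv_by e t i (seq w i) (seq z i)" using u by (intro exI[of _ z]) simp
qed (auto simp: conv_def)

lemma coherent_iff: "coherent f e m a \<longleftrightarrow> (\<forall>r. \<not> refutes f e m a r)"
proof
  assume c: "coherent f e m a"
  show "\<forall>r. \<not> refutes f e m a r"
  proof (intro allI notI)
    fix r assume r: "refutes f e m a r"
    then have "\<forall>i<seq r 4. conv e (seq r 0) i (seq (seq r 2) i)" "\<forall>i<seq r 4. conv e (seq r 1) i (seq (seq r 3) i)"
      unfolding refutes_def conv_def by blast+
    then have "m * dis (seq (seq r 2)) (seq (seq r 3)) (seq r 4) \<le> 2 * seq r 4"
      using c r unfolding coherent_def refutes_def by blast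
    then show False using r unfolding refutes_def by simp
  qed
next
  assume r: "\<forall>r. \<not> refutes f e m a r"
  show "coherent f e m a" unfolding coherent_def
  proof (intro allI impI)
    fix t t' w w' l assume *: "ext f a t \<and> ext f a t' \<and> len a \<le> l \<and>
     (\<forall>i<l. conv e t i (seq w i)) \<and> (\<forall>i<l. conv e t' i (seq w' i))"
    then obtain z z' where z: "\<forall>i<l. conv_by e t i (seq w i) (seq z i)" "\<forall>i<l. conv_by e t' i (seq w' i) (seq z' i)"
      unfolding conv_all_iff by blast
    obtain r where "\<forall>i<7. seq r i = [t, t', w, w', l, z, z'] ! i" using seq_ex by blast
    then have "seq r 0 = t" "seq r 1 = t'" "seq r 2 = w" "seq r 3 = w'" "seq r 4 = l" "seq r 5 = z" "seq r 6 = z'"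
      by simp_all
    then show "m * dis (seq w) (seq w') l \<le> 2 * l"
      using r[rule_format, of r] * z unfolding refutes_def by simp
  qed
qed

definition candidate :: "(nat \<Rightarrow> nat) \<Rightarrow> nat \<Rightarrow> nat \<Rightarrow> nat \<Rightarrow> nat \<Rightarrow> nat \<Rightarrow> bool" where
  "candidate f e m s a b \<longleftrightarrow> ext f a b \<and> valid f b \<and> (\<forall>r<s. \<not> refutes f e m b r)"

text \<open>
  The guess at stage \<open>s\<close> for a descending sequence of coherent conditions of levels \<open>0, 1, \<dots>\<close>, with \<open>s\<close> as the time bound
  for refutations.
\<close>

definition chain :: "(nat \<Rightarrow> nat) \<Rightarrow> nat \<Rightarrow> nat \<Rightarrow> nat \<Rightarrow> nat \<Rightarrow> bool" where
  "chain f e c s q \<longleftrightarrow> seq q 0 = c \<and> (\<forall>j<s. candidate f e j s (seq q j) (seq q (Suc j)) \<and>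
     (\<forall>b<seq q (Suc j). \<not> candidate f e j s (seq q j) b))"

text \<open>
  A chain, a string below its last condition, and the outputs of this string on all arguments below \<open>2 ^ Suc s\<close>, with
  witnesses.
\<close>

definition stage :: "(nat \<Rightarrow> nat) \<Rightarrow> nat \<Rightarrow> nat \<Rightarrow> nat \<Rightarrow> nat \<Rightarrow> bool" where
  "stage f e c s r \<longleftrightarrow> chain f e c s (seq r 0) \<and> ext f (seq (seq r 0) s) (seq r 1) \<and>
     (\<forall>i<2 ^ Suc s. conv_by e (seq r 1) i (seq (seq r 2) i) (seq (seq r 3) i))"

text \<open>
  The stage responsible for \<open>x\<close> is the \<open>s\<close> with \<open>2 ^ s \<le> Suc x < 2 ^ Suc s\<close>, and its least code is used. The code must be
  a function of \<open>s\<close>: the values on one block have to come from one string, as errors of different strings could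
  add up.
\<close>

definition block_value :: "(nat \<Rightarrow> nat) \<Rightarrow> nat \<Rightarrow> nat \<Rightarrow> nat \<Rightarrow> nat \<Rightarrow> bool" where
  "block_value f e c x y \<longleftrightarrow> (\<exists>s r. 2 ^ s \<le> Suc x \<and> Suc x < 2 ^ Suc s \<and> stage f e c s r \<and>
     (\<forall>r'<r. \<not> stage f e c s r') \<and> y = seq (seq r 2) x)"

lemma block_ex: "\<exists>s. 2 ^ s \<le> Suc x \<and> Suc x < 2 ^ Suc s"
proof -
  obtain s where s: "(LEAST n. Suc x < 2 ^ n) = Suc s"
  proof (cases "LEAST n. Suc x < 2 ^ n")
    case 0
    have "Suc x < 2 ^ (LEAST n. Suc x < 2 ^ n)" by (rule LeastI[of _ "Suc x"]) (rule less_exp)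
    then show ?thesis using 0 by simp
  qed (rule that)
  have "Suc x < 2 ^ (LEAST n. Suc x < 2 ^ n)" by (rule LeastI[of _ "Suc x"]) (rule less_exp)
  moreover have "\<not> Suc x < 2 ^ s" by (rule not_less_Least) (simp add: s)
  ultimately show ?thesis unfolding s by (intro exI[of _ s]) (simp add: not_less)
qed

lemma block_unique:
  assumes "2 ^ s \<le> Suc x" "Suc x < 2 ^ Suc s" "2 ^ t \<le> Suc x" "Suc x < 2 ^ Suc t"
  shows "s = t"
proof -
  have "(2::nat) ^ s < 2 ^ Suc t" "(2::nat) ^ t < 2 ^ Suc s" using assms by linarith+
  then have "s < Suc t" "t < Suc s" by (simp_all only: power_strict_increasing_iff one_less_numeral_iff semiring_norm)
  then show ?thesis by simp
qed

text \<open>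
  Since block lengths double, the errors on all earlier blocks add up to a constant multiple of the error that is allowed
  at the current length.
\<close>

lemma coarse_description_from_blocks:
  assumes h: "\<And>x s. 2 ^ s \<le> Suc x \<Longrightarrow> Suc x < 2 ^ Suc s \<Longrightarrow> h x = w s x"
    and w: "\<And>m. \<exists>k. \<forall>s\<ge>k. m * dis (w s) g (2 ^ Suc s) \<le> 3 * 2 ^ Suc s"
  shows "coarse_description h g"
  unfolding coarse_description_iff
proof
  fix m0 :: nat
  \<comment> \<open>The estimates below bound \<open>m\<close> times the number of errors by \<open>14 * l\<close>.\<close>
  define m where "m = 14 * m0"
  obtain k where k: "\<And>s. s \<ge> k \<Longrightarrow> m * dis (w s) g (2 ^ Suc s) \<le> 3 * 2 ^ Suc s" using w by blast
  have D: "m * dis h g (2 ^ s - 1) \<le> m * 2 ^ k + 6 * 2 ^ s" if "k \<le> s" for s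
    using that
  proof (induction rule: dec_induct)
    case base
    have "dis h g (2 ^ k - 1) \<le> 2 ^ k" using dis_le[of h g "2 ^ k - 1"] by linarith
    then have "m * dis h g (2 ^ k - 1) \<le> m * 2 ^ k" by (rule mult_le_mono2)
    then show ?case by (rule trans_le_add1)
  next
    case (step s)
    have "dis h g (2 ^ Suc s - 1) \<le> dis h g (2 ^ s - 1) + dis (w s) g (2 ^ Suc s)"
    proof (rule dis_union)
      fix x assume x: "x < 2 ^ Suc s - 1" "h x \<noteq> g x"
      show "x < 2 ^ s - 1 \<and> h x \<noteq> g x \<or> x < 2 ^ Suc s \<and> w s x \<noteq> g x"
      proof (cases "x < 2 ^ s - 1")
        case False
        then have "h x = w s x" using x by (intro h) auto
        then show ?thesis using x by auto
      qed (use x in auto)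
    qed
    from mult_le_mono2[OF this, of m]
    have "m * dis h g (2 ^ Suc s - 1) \<le> m * dis h g (2 ^ s - 1) + m * dis (w s) g (2 ^ Suc s)"
      by (simp add: algebra_simps)
    also have "\<dots> \<le> m * 2 ^ k + 6 * 2 ^ s + 3 * 2 ^ Suc s"
      using step.IH k[of s] step.hyps by (intro add_mono) auto
    finally show ?case by simp
  qed
  have "m0 * dis h g l \<le> l" if l: "l \<ge> m * 2 ^ k + 2 ^ Suc k + 12" for l
  proof -
    obtain s where s: "2 ^ s \<le> Suc l" "Suc l < 2 ^ Suc s" using block_ex by blast
    have "k \<le> s"
    proof (rule ccontr)
      assume "\<not> k \<le> s"
      then have "(2::nat) ^ Suc s \<le> 2 ^ k" by (intro power_increasing) auto
      moreover have "(2::nat) ^ k \<le> 2 ^ Suc k" by simp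
      ultimately show False using s l by linarith
    qed
    have "dis h g l \<le> dis h g (2 ^ Suc s - 1)" by (rule dis_mono) (use s in linarith)
    then have "m * dis h g l \<le> m * dis h g (2 ^ Suc s - 1)" by simp
    also have "\<dots> \<le> m * 2 ^ k + 6 * 2 ^ Suc s" using D[of "Suc s"] \<open>k \<le> s\<close> by simp
    also have "\<dots> \<le> m * 2 ^ k + 12 * Suc l" using s by simp
    also have "\<dots> \<le> 14 * l" using l by simp
    finally show ?thesis by (simp add: m_def)
  qed
  then show "\<exists>N. \<forall>l\<ge>N. m0 * dis h g l \<le> l" by blast
qed

context
  fixes f g :: "nat \<Rightarrow> nat" and e c :: nat
  assumes forces: "forces f g e c"
begin

lemma forced_extension:
  assumes "ext f c a" "valid f a"
  shows "\<exists>d. ext f a d \<and> valid f d \<and> (\<exists>y. conv e d m y) \<and> accurate f g e m d"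
  using forces assms unfolding forces_def by blast

lemma forced_values:
  assumes "ext f c a" "valid f a"
  shows "\<exists>t w. ext f a t \<and> valid f t \<and> (\<forall>i<l. conv e t i (seq w i))"
proof -
  have "\<exists>t. ext f a t \<and> valid f t \<and> (\<forall>i<l. \<exists>y. conv e t i y)"
  proof (induction l)
    case 0
    show ?case using assms(2) ext_refl[OF assms(2)] by (intro exI[of _ a]) simp
  next
    case (Suc l)
    then obtain t where t: "ext f a t" "valid f t" "\<forall>i<l. \<exists>y. conv e t i y" by auto
    obtain d y where d: "ext f t d" "valid f d" "conv e d l y"
      using forced_extension[OF ext_trans[OF assms(1) t(1)] t(2), of l] by auto
    have "\<exists>y. conv e d i y" if "i < Suc l" for i
    proof (cases "i = l")
      case False
      then have "i < l" using that by simp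
      then obtain y where "conv e t i y" using t(3) by auto
      from conv_ext[OF this d(1)] show ?thesis ..
    next
      case True
      then show ?thesis using d(3) by auto
    qed
    then show ?case using d(2) ext_trans[OF t(1) d(1)] by (intro exI[of _ d]) simp
  qed
  then obtain t where t12: "ext f a t" "valid f t" and "\<forall>i<l. \<exists>y. conv e t i y" by auto
  then have "\<exists>u. \<forall>i<l. conv e t i (u i)"
    using choice[of "\<lambda>i y. i < l \<longrightarrow> conv e t i y"] by auto
  then obtain u where t: "\<forall>i<l. conv e t i (u i)" by auto
  obtain w where "\<forall>i<l. seq w i = u i" using seq_ex[of l u] by auto
  then have "\<forall>i<l. conv e t i (seq w i)" using t by simp
  then show ?thesis using t12 by auto
qed

lemma coherent_dense:
  assumes "ext f c a" "valid f a"
  shows "\<exists>b. ext f a b \<and> valid f b \<and> coherent f e m b"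
proof -
  obtain b where b: "ext f a b" "valid f b" "accurate f g e m b"
    using forced_extension[OF assms] by blast
  have "coherent f e m b" unfolding coherent_def
  proof (intro allI impI)
    fix t t' w w' l assume *: "ext f b t \<and> ext f b t' \<and> len b \<le> l \<and>
     (\<forall>i<l. conv e t i (seq w i)) \<and> (\<forall>i<l. conv e t' i (seq w' i))"
    then have "m * dis (seq w) g l \<le> l" "m * dis (seq w') g l \<le> l" using b(3) unfolding accurate_def by blast+
    moreover have "m * dis (seq w) (seq w') l \<le> m * dis (seq w) g l + m * dis (seq w') g l"
      using mult_le_mono2[OF dis_triangle[of "seq w" "seq w'" l g], of m] dis_sym[of g "seq w'" l]
      by (simp add: algebra_simps)
    ultimately show "m * dis (seq w) (seq w') l \<le> 2 * l" by simp
  qed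
  then show ?thesis using b by blast
qed

text \<open>
  Any string below \<open>b\<close> is compared with a string below an accurate extension of \<open>b\<close>: the latter contributes \<open>l\<close>, the
  comparison \<open>2 * l\<close>.
\<close>

lemma coherent_correct:
  assumes b: "ext f c b" "valid f b" "coherent f e m b"
  shows "\<exists>N. \<forall>t w l. ext f b t \<and> N \<le> l \<and> (\<forall>i<l. conv e t i (seq w i)) \<longrightarrow> m * dis (seq w) g l \<le> 3 * l"
proof -
  obtain d where d: "ext f b d" "valid f d" "accurate f g e m d"
    using forced_extension[OF b(1,2)] by blast
  have "m * dis (seq w) g l \<le> 3 * l" if *: "ext f b t" "len d \<le> l" "\<forall>i<l. conv e t i (seq w i)" for t w l
  proof -
    obtain t' w' where t': "ext f d t'" "\<forall>i<l. conv e t' i (seq w' i)"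
      using forced_values[OF ext_trans[OF b(1) d(1)] d(2)] by blast
    have 1: "m * dis (seq w') g l \<le> l" using d(3) t' *(2) unfolding accurate_def by blast
    have "len b \<le> l" using ext_len[OF d(1)] *(2) by simp
    then have 2: "m * dis (seq w) (seq w') l \<le> 2 * l"
      using b(3) * t' ext_trans[OF d(1) t'(1)] unfolding coherent_def by blast
    have "m * dis (seq w) g l \<le> m * dis (seq w) (seq w') l + m * dis (seq w') g l"
      using mult_le_mono2[OF dis_triangle[of "seq w" g l "seq w'"], of m] by (simp add: algebra_simps)
    then show ?thesis using 1 2 by simp
  qed
  then show ?thesis by blast
qed

lemma candidate_ex:
  assumes "ext f c a" "valid f a"
  shows "\<exists>b. candidate f e m s a b"
  using coherent_dense[OF assms] unfolding candidate_def coherent_iff by blast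

lemma chain_ex: "\<exists>q. chain f e c s q"
proof -
  define D where "D = rec_nat c (\<lambda>j a. LEAST b. candidate f e j s a b)"
  have D: "D 0 = c" "\<And>j. D (Suc j) = (LEAST b. candidate f e j s (D j) b)" by (simp_all add: D_def)
  have v: "ext f c (D j) \<and> valid f (D j)" for j
  proof (induction j)
    case 0
    then show ?case using forces ext_refl by (simp add: D forces_def)
  next
    case (Suc j)
    then have "candidate f e j s (D j) (D (Suc j))"
      unfolding D(2) by (intro LeastI_ex[OF candidate_ex]) auto
    then have "ext f (D j) (D (Suc j))" "valid f (D (Suc j))" unfolding candidate_def by auto
    then show ?case using Suc ext_trans by auto
  qed
  obtain q where q: "\<forall>i<Suc s. seq q i = D i" using seq_ex[of "Suc s" D] by auto
  have "chain f e c s q" unfolding chain_def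
  proof (intro conjI allI impI)
    show "seq q 0 = c" using q D by simp
    fix j assume j: "j < s"
    then have qj: "seq q j = D j" "seq q (Suc j) = D (Suc j)" using q by auto
    show "candidate f e j s (seq q j) (seq q (Suc j))"
      unfolding qj D(2) using v by (intro LeastI_ex[OF candidate_ex]) auto
    show "\<not> candidate f e j s (seq q j) b" if "b < seq q (Suc j)" for b
      using that unfolding qj D(2) by (rule not_less_Least)
  qed
  then show ?thesis ..
qed

lemma chain_step:
  assumes "chain f e c s q" "j < s"
  shows "ext f (seq q j) (seq q (Suc j))" "valid f (seq q (Suc j))"
  using assms unfolding chain_def candidate_def by auto

lemma chain_valid:
  assumes "chain f e c s q" "j \<le> s"
  shows "valid f (seq q j) \<and> ext f c (seq q j)"
  using assms(2)
proof (induction j)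
  case 0
  have "seq q 0 = c" using assms(1) unfolding chain_def by auto
  then show ?case using forces ext_refl unfolding forces_def by simp
next
  case (Suc j)
  then show ?case using chain_step[OF assms(1), of j] ext_trans[of f c "seq q j"] by simp
qed

lemma chain_ext:
  assumes "chain f e c s q" "j \<le> k" "k \<le> s"
  shows "ext f (seq q j) (seq q k)"
  using assms(2,3)
proof (induction rule: dec_induct)
  case base
  then show ?case using chain_valid[OF assms(1), of j] ext_refl by auto
next
  case (step n)
  then show ?case using chain_step[OF assms(1), of n] ext_trans[of f "seq q j" "seq q n"] by simp
qed

lemma stage_ex: "\<exists>r. stage f e c s r"
proof -
  obtain q where q: "chain f e c s q" using chain_ex by blast
  obtain t w where t: "ext f (seq q s) t" "\<forall>i<2 ^ Suc s. conv e t i (seq w i)"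
    using forced_values chain_valid[OF q order_refl] by blast
  obtain z where z: "\<forall>i<2 ^ Suc s. conv_by e t i (seq w i) (seq z i)"
    using t(2) unfolding conv_all_iff by blast
  obtain r where "\<forall>i<4. seq r i = [q, t, w, z] ! i" using seq_ex by blast
  then have "seq r 0 = q" "seq r 1 = t" "seq r 2 = w" "seq r 3 = z" by simp_all
  then have "stage f e c s r" using q t z unfolding stage_def by simp
  then show ?thesis ..
qed

text \<open>
  Finite injury. Once the first \<open>k\<close> links have stabilized, the next one settles on the least truly coherent condition
  as soon as the finitely many smaller ones that are not coherent have been refuted.
\<close>

lemma chain_stabilizes:
  "\<exists>C. C 0 = c \<and> (\<forall>j. ext f c (C j) \<and> valid f (C j) \<and> coherent f e j (C (Suc j))) \<and>
     (\<forall>k. \<exists>S. \<forall>s\<ge>S. k \<le> s \<and> (\<forall>q. chain f e c s q \<longrightarrow> seq q k = C k))"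
proof -
  define C where "C = rec_nat c (\<lambda>j a. LEAST b. ext f a b \<and> valid f b \<and> coherent f e j b)"
  have C0: "C 0 = c" and CS: "\<And>j. C (Suc j) = (LEAST b. ext f (C j) b \<and> valid f b \<and> coherent f e j b)"
    by (simp_all add: C_def)
  have least: "ext f (C j) (C (Suc j)) \<and> valid f (C (Suc j)) \<and> coherent f e j (C (Suc j))"
    if "ext f c (C j)" "valid f (C j)" for j
    unfolding CS using coherent_dense[OF that] by (rule LeastI_ex)
  have v: "ext f c (C j) \<and> valid f (C j)" for j
  proof (induction j)
    case 0
    then show ?case using forces ext_refl by (simp add: C0 forces_def)
  next
    case (Suc j)
    then show ?case using least ext_trans by blast
  qed
  have CSj: "ext f (C j) (C (Suc j))" "valid f (C (Suc j))" "coherent f e j (C (Suc j))" for j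
    using least v by blast+
  have "\<exists>K. \<forall>s\<ge>K. k \<le> s \<and> (\<forall>q. chain f e c s q \<longrightarrow> seq q k = C k)" for k
  proof (induction k)
    case 0
    then show ?case by (auto simp: chain_def C0)
  next
    case (Suc k)
    then obtain K where K: "\<And>s q. s \<ge> K \<Longrightarrow> chain f e c s q \<Longrightarrow> seq q k = C k" by blast
    have "\<exists>r. refutes f e k b r" if "b < C (Suc k)" "ext f (C k) b" "valid f b" for b
      using that not_less_Least[of b "\<lambda>b. ext f (C k) b \<and> valid f b \<and> coherent f e k b"]
      unfolding CS coherent_iff by blast
    then obtain R where R: "\<And>b. b < C (Suc k) \<Longrightarrow> ext f (C k) b \<Longrightarrow> valid f b \<Longrightarrow> refutes f e k b (R b)" by metis
    have "Suc k \<le> s \<and> (\<forall>q. chain f e c s q \<longrightarrow> seq q (Suc k) = C (Suc k))"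
      if s: "s \<ge> K + Suc k + Suc (\<Sum>b<C (Suc k). R b)" for s
    proof (intro conjI allI impI)
      show "Suc k \<le> s" using s by simp
      fix q assume q: "chain f e c s q"
      have ck: "seq q k = C k" using K[of s q] q s by simp
      have cand: "candidate f e k s (C k) (seq q (Suc k))" "\<forall>b<seq q (Suc k). \<not> candidate f e k s (C k) b"
        using q[unfolded chain_def, THEN conjunct2, rule_format, of k] s unfolding ck by auto
      have "candidate f e k s (C k) (C (Suc k))"
        using CSj[of k] unfolding candidate_def coherent_iff by blast
      then have le: "seq q (Suc k) \<le> C (Suc k)" using cand(2) not_less by blast
      moreover have False if lt: "seq q (Suc k) < C (Suc k)"
      proof -
        have "R (seq q (Suc k)) \<le> (\<Sum>b<C (Suc k). R b)" by (rule member_le_sum) (use lt in auto)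
        then have "R (seq q (Suc k)) < s" using s by simp
        then show False using R[OF lt] cand(1) unfolding candidate_def by blast
      qed
      ultimately show "seq q (Suc k) = C (Suc k)" by fastforce
    qed
    then show ?case by blast
  qed
  then show ?thesis using C0 v CSj by blast
qed

text \<open>
  The output of a stage comes from below the last link of its chain, hence from below the link of level \<open>m\<close>, which is
  right at all late stages.
\<close>

lemma stage_correct:
  "\<exists>K. \<forall>s\<ge>K. \<forall>r. stage f e c s r \<longrightarrow> m * dis (seq (seq r 2)) g (2 ^ Suc s) \<le> 3 * 2 ^ Suc s"
proof -
  obtain C where C: "\<And>j. ext f c (C j)" "\<And>j. valid f (C j)" "\<And>j. coherent f e j (C (Suc j))"
    "\<And>k. \<exists>K. \<forall>s\<ge>K. k \<le> s \<and> (\<forall>q. chain f e c s q \<longrightarrow> seq q k = C k)"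
    using chain_stabilizes by blast
  obtain K where K: "\<And>s. s \<ge> K \<Longrightarrow> Suc m \<le> s" "\<And>s q. s \<ge> K \<Longrightarrow> chain f e c s q \<Longrightarrow> seq q (Suc m) = C (Suc m)"
    using C(4)[of "Suc m"] by auto
  obtain N where N': "\<forall>t w l. ext f (C (Suc m)) t \<and> N \<le> l \<and> (\<forall>i<l. conv e t i (seq w i)) \<longrightarrow>
      m * dis (seq w) g l \<le> 3 * l"
    using coherent_correct[OF C(1) C(2) C(3), of m] ..
  have N: "m * dis (seq w) g l \<le> 3 * l"
    if "ext f (C (Suc m)) t" "N \<le> l" "\<forall>i<l. conv e t i (seq w i)" for t w l
    using N' that by blast
  have "m * dis (seq (seq r 2)) g (2 ^ Suc s) \<le> 3 * 2 ^ Suc s" if s: "s \<ge> K + N" and r: "stage f e c s r" for s r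
  proof (rule N)
    have q: "chain f e c s (seq r 0)" using r unfolding stage_def by blast
    have "ext f (C (Suc m)) (seq (seq r 0) s)"
      using chain_ext[OF q, of "Suc m" s] K(1)[of s] K(2)[OF _ q] s by simp
    moreover have "ext f (seq (seq r 0) s) (seq r 1)" using r unfolding stage_def by blast
    ultimately show "ext f (C (Suc m)) (seq r 1)" by (rule ext_trans)
    have "Suc s < 2 ^ Suc s" by (rule less_exp)
    then show "N \<le> 2 ^ Suc s" using s by linarith
    show "\<forall>i<2 ^ Suc s. conv e (seq r 1) i (seq (seq r 2) i)"
      using r unfolding stage_def conv_def by auto
  qed
  then show ?thesis by auto
qed

lemma block_value_total: "\<exists>y. block_value f e c x y"
proof -
  obtain s where s: "2 ^ s \<le> Suc x" "Suc x < 2 ^ Suc s" using block_ex by blast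
  obtain r where "stage f e c s r" "\<forall>r'<r. \<not> stage f e c s r'"
    using stage_ex[of s] unfolding exists_least_iff[of "stage f e c s"] by auto
  then show ?thesis using s unfolding block_value_def by auto
qed

lemma block_value_correct:
  assumes h: "\<And>x. block_value f e c x (h x)"
  shows "coarse_description h g"
proof (rule coarse_description_from_blocks[where w = "\<lambda>s. seq (seq (LEAST r. stage f e c s r) 2)"])
  let ?r = "\<lambda>s. LEAST r. stage f e c s r"
  have r: "stage f e c s (?r s)" for s using stage_ex by (rule LeastI_ex)
  show "h x = seq (seq (?r s) 2) x" if s: "2 ^ s \<le> Suc x" "Suc x < 2 ^ Suc s" for x s
  proof -
    obtain s' r' where s': "2 ^ s' \<le> Suc x" "Suc x < 2 ^ Suc s'" "stage f e c s' r'"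
      "\<forall>r<r'. \<not> stage f e c s' r" "h x = seq (seq r' 2) x" using h[of x] unfolding block_value_def by auto
    have "s' = s" by (rule block_unique[OF s'(1,2) s])
    moreover have "r' = ?r s'"
      by (rule Least_equality[symmetric]) (use s'(3,4) not_less in auto)
    ultimately show ?thesis using s'(5) by simp
  qed
  show "\<exists>k. \<forall>s\<ge>k. m * dis (seq (seq (?r s) 2)) g (2 ^ Suc s) \<le> 3 * 2 ^ Suc s" for m
  proof -
    obtain k where "\<forall>s\<ge>k. \<forall>r. stage f e c s r \<longrightarrow> m * dis (seq (seq r 2)) g (2 ^ Suc s) \<le> 3 * 2 ^ Suc s"
      using stage_correct[of m] ..
    then show ?thesis using r by (intro exI[of _ k]) simp
  qed
qed

end

section \<open>Definability of forcing\<close>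

lemma rec_fun_dis:
  "rec_fun a \<Longrightarrow> rec_fun l \<Longrightarrow> rec_fun (\<lambda>f g v. dis (str (a f g v)) f (l f g v))"
  "rec_fun a \<Longrightarrow> rec_fun l \<Longrightarrow> rec_fun (\<lambda>f g v. dis (seq (a f g v)) g (l f g v))"
  "rec_fun a \<Longrightarrow> rec_fun l \<Longrightarrow> rec_fun b \<Longrightarrow> rec_fun (\<lambda>f g v. dis (seq (a f g v)) (seq (b f g v)) (l f g v))"
proof -
  have 1: "rec_fun (\<lambda>f g v. dis (str (v 0)) f (v 1))" unfolding dis_def
    by (intro rec_fun_count delta1_rules rec_rules rec_fun_cond rec_fun_f)
  show "rec_fun a \<Longrightarrow> rec_fun l \<Longrightarrow> rec_fun (\<lambda>f g v. dis (str (a f g v)) f (l f g v))"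
    by (rule rec_fun_subst2[of "\<lambda>f g a l. dis (str a) f l", OF 1])
  have 2: "rec_fun (\<lambda>f g v. dis (seq (v 0)) g (v 1))" unfolding dis_def
    by (intro rec_fun_count delta1_rules rec_rules rec_fun_seq rec_fun_g)
  show "rec_fun a \<Longrightarrow> rec_fun l \<Longrightarrow> rec_fun (\<lambda>f g v. dis (seq (a f g v)) g (l f g v))"
    by (rule rec_fun_subst2[of "\<lambda>f g a l. dis (seq a) g l", OF 2])
  have 3: "rec_fun (\<lambda>f g v. dis (seq (v 0)) (seq (v 1)) (v 2))" unfolding dis_def
    by (intro rec_fun_count delta1_rules rec_rules rec_fun_seq)
  show "rec_fun a \<Longrightarrow> rec_fun l \<Longrightarrow> rec_fun b \<Longrightarrow> rec_fun (\<lambda>f g v. dis (seq (a f g v)) (seq (b f g v)) (l f g v))"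
    using rec_fun_subst_all[OF 3, of "\<lambda>i. if i = 0 then a else if i = 1 then b else l"] by simp
qed

lemma delta1_ext:
  assumes "rec_fun a" "rec_fun b"
  shows "delta1 (\<lambda>f g v. ext f (a f g v) (b f g v))"
proof (rule delta1_subst5[of "\<lambda>f g a b _ _ _. ext f a b", OF _ assms assms assms(1)])
  show "delta1 (\<lambda>f g v. ext f (v 0) (v 1))" unfolding ext_def
    by (intro delta1_rules rec_rules rec_fun_cond rec_fun_dis)
qed

lemma delta1_valid:
  assumes "rec_fun a"
  shows "delta1 (\<lambda>f g v. valid f (a f g v))"
proof (rule delta1_subst5[of "\<lambda>f g a _ _ _ _. valid f a", OF _ assms assms assms assms assms])
  show "delta1 (\<lambda>f g v. valid f (v 0))" unfolding valid_def
    by (intro delta1_rules rec_rules rec_fun_cond rec_fun_dis)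
qed

lemma delta1_candidate:
  assumes "rec_fun a" "rec_fun b" "rec_fun c" "rec_fun d" "rec_fun e"
  shows "delta1 (\<lambda>f g v. candidate f (a f g v) (b f g v) (c f g v) (d f g v) (e f g v))"
proof (rule delta1_subst5[of "\<lambda>f g. candidate f", OF _ assms])
  show "delta1 (\<lambda>f g v. candidate f (v 0) (v 1) (v 2) (v 3) (v 4))" unfolding candidate_def refutes_def
    by (intro delta1_rules rec_rules rec_fun_cond rec_fun_dis rec_fun_seq delta1_ext delta1_valid delta1_conv_by)
qed

lemma delta1_stage:
  assumes "rec_fun a" "rec_fun b" "rec_fun c" "rec_fun d"
  shows "delta1 (\<lambda>f g v. stage f (a f g v) (b f g v) (c f g v) (d f g v))"
proof (rule delta1_subst5[of "\<lambda>f g a b c d _. stage f a b c d", OF _ assms assms(1)])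
  show "delta1 (\<lambda>f g v. stage f (v 0) (v 1) (v 2) (v 3))" unfolding stage_def chain_def
    by (intro delta1_rules rec_rules rec_fun_seq rec_fun_pow2 delta1_ext delta1_candidate delta1_conv_by)
qed

lemma sigma1_block_value: "sigma1 (\<lambda>f g v. block_value f (v 2) (v 3) (v 1) (v 0))"
  unfolding block_value_def
  by (intro sigma1_ex delta1_sigma1 delta1_rules rec_rules rec_fun_seq rec_fun_pow2 delta1_stage)

lemma pi_class_1_if_sigma1_not:
  assumes "sigma1 (\<lambda>f g v. \<not> P f g v)"
  shows "pi_class (Suc 0) P"
proof -
  obtain Q where Q: "delta0_matrix Q" "\<forall>f g v. (\<not> P f g v) \<longleftrightarrow> (\<exists>m. Q f g v m)"
    by (rule sigma1E[OF assms])
  have "delta0 (\<lambda>f g v. \<not> Q f g (\<lambda>i. v (Suc i)) (v 0))"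
    using Q(1) unfolding delta0_matrix_def by (rule delta0_intros(3))
  then have "sigma 0 (\<lambda>f g v. \<not> Q f g (\<lambda>i. v (Suc i)) (v 0))"
    unfolding delta0_def sigma_def using Sigma0_Pi0.intros(1) by blast
  then have "pi_class (Suc 0) (\<lambda>f g v. \<forall>m. \<not> Q f g v m)" by (intro pi_all pi_Suc)
  moreover have "(\<lambda>f g v. \<forall>m. \<not> Q f g v m) = P" using Q(2) by (intro ext) blast
  ultimately show ?thesis by simp
qed

text \<open>
  Forcing in prenex form: what remains behind the quantifiers over \<open>m\<close>, \<open>a\<close> and over \<open>d\<close>, \<open>y\<close>, \<open>z\<close> is \<open>\<Pi>\<close>-1, because
  \<open>accurate\<close> is and everything else is decidable.
\<close>

definition forces_matrix ::
  "(nat \<Rightarrow> nat) \<Rightarrow> (nat \<Rightarrow> nat) \<Rightarrow> nat \<Rightarrow> nat \<Rightarrow> nat \<Rightarrow> nat \<Rightarrow> nat \<Rightarrow> nat \<Rightarrow> nat \<Rightarrow> bool" where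
  "forces_matrix f g e c m a d y z \<longleftrightarrow> valid f c \<and> (ext f c a \<and> valid f a \<longrightarrow>
     ext f a d \<and> valid f d \<and> conv_by e d m y z \<and> accurate f g e m d)"

lemma forces_iff: "forces f g e c \<longleftrightarrow> (\<forall>m a. \<exists>d y z. forces_matrix f g e c m a d y z)"
  unfolding forces_def forces_matrix_def conv_def by blast

lemma sigma1_not_accurate:
  assumes "rec_fun a" "rec_fun b" "rec_fun c"
  shows "sigma1 (\<lambda>f g v. \<not> accurate f g (a f g v) (b f g v) (c f g v))"
proof -
  have eq: "\<not> accurate f g e m d \<longleftrightarrow> (\<exists>t w l z. ext f d t \<and> len d \<le> l \<and>
      (\<forall>i<l. conv_by e t i (seq w i) (seq z i)) \<and> \<not> m * dis (seq w) g l \<le> l)" for f g e m d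
    unfolding accurate_def conv_all_iff by blast
  have "sigma1 (\<lambda>f g v. \<not> accurate f g (v 0) (v 1) (v 2))" unfolding eq
    by (intro sigma1_ex delta1_sigma1 delta1_rules rec_rules rec_fun_seq rec_fun_cond rec_fun_dis delta1_ext delta1_conv_by)
  from sigma1_subst_all[OF this, of "\<lambda>i. if i = 0 then a else if i = 1 then b else c"] assms
  show ?thesis by simp
qed

text \<open>
  The restriction \<open>T\<close> selects the admissible initial conditions: all of them for non-uniform reducibility, those
  without constraints for uniform reducibility.
\<close>

lemma sigma_4_forces:
  assumes T: "\<And>a. rec_fun a \<Longrightarrow> delta1 (\<lambda>f g v. T (a f g v))"
  shows "sigma 4 (\<lambda>f g v. \<exists>e c. T c \<and> forces f g e c)"
proof -
  have eq: "T c \<and> forces f g e c \<longleftrightarrow> (\<forall>m a. \<exists>d y z. T c \<and> forces_matrix f g e c m a d y z)" for f g e c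
    unfolding forces_iff by blast
  have neg: "\<not> (T c \<and> forces_matrix f g e c m a d y z) \<longleftrightarrow> \<not> T c \<or> \<not> valid f c \<or> (ext f c a \<and> valid f a) \<and>
     (\<not> (ext f a d \<and> valid f d \<and> conv_by e d m y z) \<or> \<not> accurate f g e m d)" for f g e c m a d y z
    unfolding forces_matrix_def by blast
  have "pi_class (Suc 0) (\<lambda>f g v. T (v 5) \<and> forces_matrix f g (v 6) (v 5) (v 4) (v 3) (v 2) (v 1) (v 0))"
    by (rule pi_class_1_if_sigma1_not, unfold neg)
      (intro sigma1_disj sigma1_conj sigma1_not_accurate delta1_sigma1 delta1_rules rec_rules T
         delta1_valid delta1_ext delta1_conv_by)
  then have "sigma (Suc (Suc (Suc (Suc 0)))) (\<lambda>f g v. \<exists>e c. \<forall>m a. \<exists>d y z. T c \<and> forces_matrix f g e c m a d y z)"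
    by - (rule sigma_ex, rule sigma_ex, rule sigma_Suc, rule pi_all, rule pi_all, rule pi_Suc,
      rule sigma_ex, rule sigma_ex, rule sigma_ex, rule sigma_Suc, simp add: eval_nat_numeral)
  then show ?thesis unfolding eq by (simp add: eval_nat_numeral)
qed

text \<open>
  The program depends on neither function, only on the functional and the condition. This uniformity is what the case
  of uniform reducibility rests on.
\<close>

lemma forces_computes:
  "\<exists>p. \<forall>f g. forces f g e c \<longrightarrow> (\<exists>h. coarse_description h g \<and> computes_via p f h)"
proof -
  obtain p where p: "\<forall>A. (\<forall>x. \<exists>y. block_value A e c x y) \<longrightarrow>
    (\<exists>h. computes_via p A h \<and> (\<forall>x. block_value A e c x (h x)))"
    using sigma1_uniformization[OF sigma1_block_value, of e c] by (auto simp: eval_nat_numeral)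
  have "\<exists>h. coarse_description h g \<and> computes_via p f h" if "forces f g e c" for f g
    using p block_value_total[OF that] block_value_correct[OF that] by blast
  then show ?thesis by blast
qed

text \<open>
  A condition of length and gap \<open>0\<close> imposes nothing. It is therefore its own transfer to any other function, which
  keeps the program uniform.
\<close>

lemma trivial_condition:
  assumes "len c = 0" "gap c = 0"
  shows "valid f c" "ext f c t"
  using assms by (simp_all add: valid_def ext_def)

text \<open>
  If a fixed program \<open>p\<close> is not forced by the trivial condition, it is hopeless below some condition, and a generic point of
  that condition defeats \<open>p\<close>.
\<close>

lemma uc_reducible_iff: "f \<ge>\<^sub>U\<^sub>C g \<longleftrightarrow> (\<exists>e c. (len c = 0 \<and> gap c = 0) \<and> forces f g e c)"
proof
  assume "f \<ge>\<^sub>U\<^sub>C g"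
  then obtain p where p: "\<And>f'. coarse_description f' f \<Longrightarrow> \<exists>g'. coarse_description g' g \<and> computes_via p f' g'"
    unfolding uc_reducible_def by blast
  obtain c where c: "len c = 0" "gap c = 0" using cond_ex[of 0 0] by blast
  have "forces f g (prog_code p) c"
  proof (rule ccontr)
    assume "\<not> forces f g (prog_code p) c"
    then obtain m d where d: "valid f d" "hopeless f g (prog_code p) m d"
      using not_forces_hopeless[OF trivial_condition(1)[OF c]] by blast
    have "\<exists>m t. ext f d' t \<and> valid f t \<and> hopeless f g (prog_code p) m t" if "ext f d d'" "valid f d'" for d'
      using hopeless_ext[OF d(2) that(1)] ext_refl[OF that(2)] that(2) by blast
    from generic_coarse_description[OF d(1), where g = g and P = "\<lambda>_. p", OF this] show False using p by blast
  qed
  then show "\<exists>e c. (len c = 0 \<and> gap c = 0) \<and> forces f g e c" using c by blast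
next
  assume "\<exists>e c. (len c = 0 \<and> gap c = 0) \<and> forces f g e c"
  then obtain e c where c: "len c = 0" "gap c = 0" and F: "forces f g e c" by blast
  obtain p where p: "\<And>f g. forces f g e c \<Longrightarrow> \<exists>h. coarse_description h g \<and> computes_via p f h"
    using forces_computes by blast
  have "\<exists>g'. coarse_description g' g \<and> computes_via p f' g'" if "coarse_description f' f" for f'
    by (rule p, rule transfer_forces[OF coarse_description_sym[OF that] F]) (rule trivial_condition[OF c])+
  then show "f \<ge>\<^sub>U\<^sub>C g" unfolding uc_reducible_def by blast
qed

text \<open>
  If nothing is forced, then every program is hopeless densely often, and one generic point defeats all of them.
\<close>

lemma nc_reducible_iff: "f \<ge>\<^sub>N\<^sub>C g \<longleftrightarrow> (\<exists>e c. forces f g e c)"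
proof
  assume nc: "f \<ge>\<^sub>N\<^sub>C g"
  show "\<exists>e c. forces f g e c"
  proof (rule ccontr)
    assume no: "\<not> (\<exists>e c. forces f g e c)"
    obtain c where c: "len c = 0" "gap c = 0" using cond_ex[of 0 0] by blast
    define P where "P i = (SOME p. prog_code p = i)" for i
    have P: "P (prog_code p) = p" for p
      unfolding P_def by (rule some_equality) (rule refl, rule prog_code_inj)
    have "\<exists>m t. ext f d t \<and> valid f t \<and> hopeless f g (prog_code (P i)) m t" if "valid f d" for i d
      using not_forces_hopeless[OF that] no by blast
    from generic_coarse_description[OF trivial_condition(1)[OF c], where g = g and P = P, OF this]
    obtain A where A: "coarse_description A f"
      "\<And>i g'. coarse_description g' g \<Longrightarrow> \<not> computes_via (P i) A g'" by blast
    obtain g' p where "coarse_description g' g" "computes_via p A g'"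
      using nc A(1) unfolding nc_reducible_def turing_computes_def by blast
    then show False using A(2)[of g' "prog_code p"] P by simp
  qed
next
  assume "\<exists>e c. forces f g e c"
  then obtain e c where F: "forces f g e c" by blast
  have "\<exists>g'. coarse_description g' g \<and> turing_computes f' g'" if "coarse_description f' f" for f'
  proof -
    have "coarse_description f f'" using that by (rule coarse_description_sym)
    moreover obtain d where "valid f' d" "\<And>t. ext f' d t \<Longrightarrow> ext f c t"
      using transfer_condition[OF \<open>coarse_description f f'\<close>, of c] F unfolding forces_def by blast
    ultimately have "forces f' g e d" using F transfer_forces by blast
    then show ?thesis using forces_computes[of e d] unfolding turing_computes_def by blast
  qed
  then show "f \<ge>\<^sub>N\<^sub>C g" unfolding nc_reducible_def by blast
qed

theorem theorem4:
  "\<exists>\<psi>\<^sub>U \<psi>\<^sub>N.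
     Sigma0 4 \<psi>\<^sub>U \<and> free_num_vars \<psi>\<^sub>U = {} \<and>
     Sigma0 4 \<psi>\<^sub>N \<and> free_num_vars \<psi>\<^sub>N = {} \<and>
     (\<forall>f g :: nat \<Rightarrow> nat.
        (f \<ge>\<^sub>N\<^sub>C g \<longleftrightarrow> holds \<psi>\<^sub>N f g) \<and>
        (f \<ge>\<^sub>U\<^sub>C g \<longleftrightarrow> holds \<psi>\<^sub>U f g))"
proof -
  have U: "sigma 4 (\<lambda>f g v. f \<ge>\<^sub>U\<^sub>C g)" unfolding uc_reducible_iff
    by (rule sigma_4_forces) (intro delta1_rules rec_fun_cond rec_rules)
  have N: "sigma 4 (\<lambda>f g v. f \<ge>\<^sub>N\<^sub>C g)" unfolding nc_reducible_iff
    using sigma_4_forces[of "\<lambda>_. True"] delta1_const by simp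
  have four: "4 = Suc 3" by simp
  obtain \<psi>\<^sub>U where "Sigma0 4 \<psi>\<^sub>U" "free_num_vars \<psi>\<^sub>U = {}" "\<forall>f g. holds \<psi>\<^sub>U f g \<longleftrightarrow> f \<ge>\<^sub>U\<^sub>C g"
    using sigma_sentence[OF U[unfolded four]] unfolding four by auto
  moreover obtain \<psi>\<^sub>N where "Sigma0 4 \<psi>\<^sub>N" "free_num_vars \<psi>\<^sub>N = {}" "\<forall>f g. holds \<psi>\<^sub>N f g \<longleftrightarrow> f \<ge>\<^sub>N\<^sub>C g"
    using sigma_sentence[OF N[unfolded four]] unfolding four by auto
  ultimately show ?thesis by blast
qed

end
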